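(* Let $d \geq 3$ and $\varepsilon > 0$ be fixed. Let $\mathbf{G}$ be a random edge-signed $d$-regular $n$-vertex graph, i.e. a uniformly random $d$-regular graph on $n$ vertices each of whose edges is independently given a uniformly random sign in $\{\pm 1\}$. Then $$\Pr\left[\rho(\mathbf{G}) \leq 2\sqrt{d-1} + \varepsilon\right] \geq 1 - o_n(1),$$ where $\rho(\mathbf{G})$ is the spectral radius (largest eigenvalue magnitude) of the signed adjacency matrix of $\mathbf{G}$.
   Context: The signed adjacency matrix of an edge-signed graph with signing $w: E \to \{\pm1\}$ has entry $w(u,v)$ at $(u,v)$ and $(v,u)$ for each edge $\{u,v\}$, and $0$ elsewhere. *)

theory Defs
  imports
    "HOL-Probability.Probability"
    "HOL-Library.Landau_Symbols"
    "Jordan_Normal_Form.Spectral_Radius"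
begin

text \<open>Simple graphs on the vertex set \<open>{..<n}\<close>, given by their sets of edges \<open>{u, v}\<close> with \<open>u \<noteq> v\<close>.\<close>

definition regular_graphs :: "nat \<Rightarrow> nat \<Rightarrow> nat set set set" where
  "regular_graphs n d =
     {E. E \<subseteq> {e. e \<subseteq> {..<n} \<and> card e = 2} \<and> (\<forall>v<n. card {e \<in> E. v \<in> e} = d)}"

text \<open>The signing has the dummy value 1 outside the edge set.
  If \<open>d < n\<close> and \<open>n * d\<close> is even, the set \<open>regular_graphs n d\<close> is nonempty;
  otherwise, apart from \<open>n = 0\<close>, it is empty and the distribution below is meaningless.\<close>

definition random_signed_regular_graph ::
    "nat \<Rightarrow> nat \<Rightarrow> (nat set set \<times> (nat set \<Rightarrow> int)) pmf" where
  "random_signed_regular_graph n d =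
     do {
       E \<leftarrow> pmf_of_set (regular_graphs n d);
       w \<leftarrow> Pi_pmf E 1 (\<lambda>_. pmf_of_set {-1, 1});
       return_pmf (E, w)
     }"

definition signed_adjacency_matrix ::
    "nat \<Rightarrow> nat set set \<Rightarrow> (nat set \<Rightarrow> int) \<Rightarrow> complex mat" where
  "signed_adjacency_matrix n E w =
     mat n n (\<lambda>(u, v). if {u, v} \<in> E then of_int (w {u, v}) else 0)"

lemma finite_regular_graphs: "finite (regular_graphs n d)"
  by (rule finite_subset[of _ "Pow (Pow {..<n})"]) (auto simp: regular_graphs_def)

end

theory Submission
  imports Defs "HOL-Real_Asymp.Real_Asymp"
begin

text \<open>Write \<open>q = d - 1\<close>.  For a signed \<open>d\<close>-regular graph with adjacency matrix \<open>A\<close>, the matrix of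
  signed sums over non-backtracking walks of length \<open>k\<close> is a polynomial in \<open>A\<close>, whose value at an
  eigenvalue beyond \<open>sqrt q * (s + 1 / s)\<close> with \<open>s > 1\<close> is at least \<open>(s * sqrt q) ^ k\<close> in absolute value.
  Averaged over the signs, its squared Frobenius norm is at most the number of hikes: pairs of
  non-backtracking walks of length \<open>k\<close> with common ends that traverse no edge exactly once.

  A hike has at most \<open>k\<close> steps along new edges, each with at most \<open>q\<close> continuations.  It leaves the
  new edges only by closing a cycle or at its turning point, which happens boundedly often if no
  connected piece with \<open>O(k)\<close> edges has many more edges than vertices.  The steps along old edges are
  cut into chunks of length at most \<open>r\<close>; if every connected piece of size \<open>O(r)\<close> has at most one cycle,
  its edges are \<open>{v, p v}\<close> for a function \<open>p\<close>, and a non-backtracking walk of given length and ends in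
  such a piece is determined by the time at which it starts to go against \<open>p\<close>.  With \<open>k\<close> and \<open>r\<close>
  proportional to \<open>ln n\<close> the number of hikes is therefore \<open>n * q ^ k\<close> up to polylogarithmic factors.

  That a random regular graph has both sparsity properties is a first moment computation.  A
  switching argument shows that each prescribed edge costs a factor \<open>2 * d / n\<close>, and the pieces are
  spanned by walks, of which there are at most \<open>n * d ^ L\<close> with \<open>L\<close> steps.\<close>

section \<open>Walks and neighbourhoods\<close>

text \<open>The moment is taken over the signs alone, with the graph fixed, so sparsity is a plain
  hypothesis on the graph and need not be carried through an expectation. Non-backtracking sums
  replace powers of \<open>A\<close> because they remove the tree-like excursions from the count;
  the threshold \<open>2 * sqrt q\<close> then comes back through the polynomial. Two scales are
  forced. To beat the factor \<open>n\<close> for the starting point, \<open>s ^ k\<close> has to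
  reach a power of \<open>n\<close>, and then \<open>d ^ (2 * k)\<close> is a possibly large power
  of \<open>n\<close>: on pieces of that size the first moment excludes only a constant number
  \<open>x\<close> of surplus edges. This bounds how often a hike switches between new and old
  edges, but not its choices along the old ones. At the smaller scale \<open>r\<close> two surplus
  edges can be excluded. One has to be allowed, since a single factor \<open>2 * d / n\<close> does
  not beat the \<open>n\<close> starting points. As \<open>k / r\<close> stays bounded, each chunk
  may cost a polylogarithmic factor.\<close>

definition nbr :: "'a set set \<Rightarrow> 'a \<Rightarrow> 'a set" where
  "nbr E x = {y. {x, y} \<in> E}"

fun edge_seq :: "'a list \<Rightarrow> 'a set list" where
  "edge_seq (x # y # zs) = {x, y} # edge_seq (y # zs)"
| "edge_seq _ = []"

lemma length_edge_seq [simp]: "length (edge_seq xs) = length xs - 1"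
  by (induction xs rule: edge_seq.induct) auto

lemma edge_seq_nth: "Suc i < length xs \<Longrightarrow> edge_seq xs ! i = {xs ! i, xs ! Suc i}"
proof (induction xs arbitrary: i rule: edge_seq.induct)
  case (1 x y zs)
  then show ?case by (cases i) auto
qed auto

lemma set_edge_seq: "set (edge_seq xs) = {{xs ! i, xs ! Suc i} | i. Suc i < length xs}"
proof -
  have "set (edge_seq xs) = (!) (edge_seq xs) ` {..<length xs - 1}"
    by (metis length_edge_seq lessThan_atLeast0 nth_image order_refl take_all)
  also have "\<dots> = (\<lambda>i. {xs ! i, xs ! Suc i}) ` {..<length xs - 1}"
    by (rule image_cong) (auto simp: edge_seq_nth)
  finally show ?thesis by auto
qed

lemma edge_seq_append: "edge_seq (xs @ u # ys) = edge_seq (xs @ [u]) @ edge_seq (u # ys)"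
proof (induction xs)
  case (Cons a xs)
  then show ?case by (cases xs) auto
qed simp

lemma edge_seq_take: "edge_seq (take (Suc m) xs) = take m (edge_seq xs)"
proof (induction xs arbitrary: m rule: edge_seq.induct)
  case (1 x y zs)
  then show ?case by (cases m) auto
qed auto

lemma edge_seq_rev: "edge_seq (rev xs) = rev (edge_seq xs)"
proof (induction xs rule: edge_seq.induct)
  case (1 x y zs)
  have "edge_seq (rev (x # y # zs)) = edge_seq (rev zs @ y # [x])" by simp
  also have "\<dots> = edge_seq (rev zs @ [y]) @ edge_seq (y # [x])" by (rule edge_seq_append)
  also have "edge_seq (rev zs @ [y]) = rev (edge_seq (y # zs))" using 1 by simp
  finally show ?case by (simp add: insert_commute)
qed auto

lemma edge_seq_subset: "e \<in> set (edge_seq xs) \<Longrightarrow> e \<subseteq> set xs"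
  by (induction xs rule: edge_seq.induct) auto

lemma edge_seq_Cons: "edge_seq (x # xs) = (if xs = [] then [] else {x, hd xs} # edge_seq xs)"
  by (cases xs) auto

definition walks :: "'a set set \<Rightarrow> nat \<Rightarrow> 'a \<Rightarrow> 'a list set" where
  "walks E m x = {xs. length xs = Suc m \<and> hd xs = x \<and> set (edge_seq xs) \<subseteq> E}"

lemma walks_0: "walks E 0 x = {[x]}"
  by (auto simp: walks_def length_Suc_conv)

lemma walks_Suc: "walks E (Suc m) x = (\<Union>y\<in>nbr E x. (#) x ` walks E m y)"
proof (intro equalityI subsetI)
  fix xs assume "xs \<in> walks E (Suc m) x"
  then obtain ys where xs: "xs = x # ys" "length ys = Suc m" "set (edge_seq (x # ys)) \<subseteq> E"
    by (cases xs) (auto simp: walks_def)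
  then have "ys \<noteq> []" by auto
  with xs show "xs \<in> (\<Union>y\<in>nbr E x. (#) x ` walks E m y)"
    by (auto simp: walks_def nbr_def edge_seq_Cons)
next
  fix xs assume "xs \<in> (\<Union>y\<in>nbr E x. (#) x ` walks E m y)"
  then show "xs \<in> walks E (Suc m) x" by (auto simp: walks_def nbr_def edge_seq_Cons split: if_splits)
qed

lemma walks_finite_card:
  assumes "\<And>x. finite (nbr E x)" and "\<And>x. card (nbr E x) \<le> d"
  shows "finite (walks E m x) \<and> card (walks E m x) \<le> d ^ m"
proof (induction m arbitrary: x)
  case 0
  then show ?case by (simp add: walks_0)
next
  case (Suc m)
  have "card (walks E (Suc m) x) \<le> (\<Sum>y\<in>nbr E x. card ((#) x ` walks E m y))"
    unfolding walks_Suc by (rule card_UN_le) (rule assms)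
  also have "\<dots> \<le> (\<Sum>y\<in>nbr E x. d ^ m)"
    by (rule sum_mono) (use Suc card_image_le order_trans in blast)
  also have "\<dots> \<le> d ^ Suc m" using assms(2)[of x] by simp
  finally show ?case using Suc assms(1) by (simp add: walks_Suc)
qed

text \<open>\<open>surplus E L x\<close>: some connected piece of \<open>E\<close>, spanned by the edges of a walk with at most
  \<open>L\<close> steps, contains at least \<open>x\<close> further edges.\<close>

definition surplus :: "'a set set \<Rightarrow> nat \<Rightarrow> nat \<Rightarrow> bool" where
  "surplus E L x \<longleftrightarrow> (\<exists>xs F. xs \<noteq> [] \<and> length xs \<le> Suc L \<and> set (edge_seq xs) \<subseteq> E \<and>
     F \<subseteq> E - set (edge_seq xs) \<and> finite F \<and> card F = x \<and> (\<forall>e\<in>F. e \<subseteq> set xs))"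

section \<open>Degrees and neighbourhoods in regular graphs\<close>

lemma regular_graphsD:
  assumes "E \<in> regular_graphs n d"
  shows "finite E" "e \<in> E \<Longrightarrow> e \<subseteq> {..<n}" "e \<in> E \<Longrightarrow> card e = 2"
    "{x, y} \<in> E \<Longrightarrow> x < n \<and> y < n \<and> x \<noteq> y"
proof -
  have *: "E \<subseteq> {e. e \<subseteq> {..<n} \<and> card e = 2}" using assms by (auto simp: regular_graphs_def)
  then have "E \<subseteq> Pow {..<n}" by auto
  then show "finite E" using finite_subset by auto
  show 1: "e \<in> E \<Longrightarrow> e \<subseteq> {..<n}" and 2: "e \<in> E \<Longrightarrow> card e = 2" for e using * by auto
  show "{x, y} \<in> E \<Longrightarrow> x < n \<and> y < n \<and> x \<noteq> y" using 1[of "{x, y}"] 2[of "{x, y}"] by (auto split: if_splits)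
qed

lemma card_nbr_eq:
  assumes "\<And>e. e \<in> E \<Longrightarrow> card e = 2"
  shows "card (nbr E x) = card {e \<in> E. x \<in> e}"
proof (rule bij_betw_same_card[of "\<lambda>y. {x, y}"])
  have "inj_on (\<lambda>y. {x, y}) (nbr E x)" by (auto simp: inj_on_def doubleton_eq_iff)
  moreover have "(\<lambda>y. {x, y}) ` nbr E x = {e \<in> E. x \<in> e}"
  proof (intro equalityI subsetI)
    fix e assume e: "e \<in> {e \<in> E. x \<in> e}"
    then obtain a b where "e = {a, b}" using assms[of e] by (auto simp: card_2_iff)
    with e show "e \<in> (\<lambda>y. {x, y}) ` nbr E x" by (auto simp: nbr_def insert_commute)
  qed (auto simp: nbr_def)
  ultimately show "bij_betw (\<lambda>y. {x, y}) (nbr E x) {e \<in> E. x \<in> e}" by (simp add: bij_betw_def)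
qed

lemma regular_nbr:
  assumes "E \<in> regular_graphs n d"
  shows "finite (nbr E x)" "nbr E x \<subseteq> {..<n}" "x < n \<Longrightarrow> card (nbr E x) = d" "card (nbr E x) \<le> d"
proof -
  show sub: "nbr E x \<subseteq> {..<n}" using regular_graphsD(4)[OF assms] by (auto simp: nbr_def)
  then show "finite (nbr E x)" using finite_subset by auto
  have *: "card (nbr E x) = card {e \<in> E. x \<in> e}"
    by (rule card_nbr_eq) (use regular_graphsD(3)[OF assms] in auto)
  show 1: "x < n \<Longrightarrow> card (nbr E x) = d" using assms * by (auto simp: regular_graphs_def)
  have "nbr E x = {}" if "\<not> x < n" using that regular_graphsD(4)[OF assms] by (auto simp: nbr_def)
  then show "card (nbr E x) \<le> d" using 1 by (cases "x < n") auto
qed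

section \<open>Switchings and dense pieces\<close>

lemma regular_card_arcs:
  assumes "E \<in> regular_graphs n d"
  shows "card {(x, y). {x, y} \<in> E} = n * d" and "finite {(x, y). {x, y} \<in> E}"
proof -
  have eq: "{(x, y). {x, y} \<in> E} = Sigma {..<n} (nbr E)"
    using regular_graphsD(4)[OF assms] by (auto simp: nbr_def)
  have "card (Sigma {..<n} (nbr E)) = (\<Sum>x<n. card (nbr E x))"
    by (rule card_SigmaI) (auto simp: regular_nbr[OF assms])
  then show "card {(x, y). {x, y} \<in> E} = n * d" using regular_nbr(3)[OF assms] eq by simp
  show "finite {(x, y). {x, y} \<in> E}" unfolding eq using regular_nbr(1)[OF assms] by auto
qed

definition switch :: "'a \<Rightarrow> 'a \<Rightarrow> 'a \<Rightarrow> 'a \<Rightarrow> 'a set set \<Rightarrow> 'a set set" where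
  "switch u v x y G = (G - {{u, v}, {x, y}}) \<union> {{u, x}, {v, y}}"

text \<open>These conditions keep the switched graph simple and keep \<open>H\<close> inside it. For
  an edge \<open>{u, v}\<close> of \<open>G\<close>, the last two also rule out \<open>x = v\<close>
  and \<open>y = u\<close>. Pairs are ordered because the two orientations of an edge give different
  switchings.\<close>

definition switchable :: "'a set set \<Rightarrow> 'a \<Rightarrow> 'a \<Rightarrow> 'a set set \<Rightarrow> ('a \<times> 'a) set" where
  "switchable H u v G =
     {(x, y). {x, y} \<in> G \<and> {x, y} \<notin> H \<and> x \<noteq> u \<and> y \<noteq> v \<and> {u, x} \<notin> G \<and> {v, y} \<notin> G}"

lemma card_exchange: "finite A \<Longrightarrow> v \<in> A \<Longrightarrow> x \<notin> A \<Longrightarrow> card (insert x (A - {v})) = card A"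
  by (simp add: card_Suc_Diff1 del: card_Diff_insert)

lemma nbr_switch:
  "nbr (switch u v x y G) z = (nbr G z - {w. {z, w} = {u, v} \<or> {z, w} = {x, y}})
     \<union> {w. {z, w} = {u, x} \<or> {z, w} = {v, y}}"
proof (rule Set.set_eqI)
  show "w \<in> nbr (switch u v x y G) z \<longleftrightarrow> w \<in> (nbr G z - {w. {z, w} = {u, v} \<or> {z, w} = {x, y}})
     \<union> {w. {z, w} = {u, x} \<or> {z, w} = {v, y}}" for w
    by (simp only: nbr_def switch_def Un_iff Diff_iff mem_Collect_eq insert_iff empty_iff simp_thms)
qed

text \<open>Each of the four vertices trades one neighbour for a new one; all other neighbourhoods
  stay the same.\<close>

lemma switch_regular:
  assumes G: "G \<in> regular_graphs n d" and uv: "{u, v} \<in> G" and xy: "(x, y) \<in> switchable H u v G"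
  shows "switch u v x y G \<in> regular_graphs n d"
proof -
  note D = regular_graphsD[OF G]
  have xyG: "{x, y} \<in> G" and ne: "x \<noteq> u" "y \<noteq> v" and nin: "{u, x} \<notin> G" "{v, y} \<notin> G"
    using xy by (auto simp: switchable_def)
  have lt: "u < n" "v < n" "x < n" "y < n" "u \<noteq> v" "x \<noteq> y" using D(4)[OF uv] D(4)[OF xyG] by auto
  have ne2: "x \<noteq> v" "y \<noteq> u" using nin uv by (auto simp: insert_commute)
  have neq: "u \<noteq> v" "x \<noteq> y" "u \<noteq> x" "u \<noteq> y" "v \<noteq> x" "v \<noteq> y"
    using lt ne ne2 by simp_all
  let ?G = "switch u v x y G"
  have "?G \<subseteq> {e. e \<subseteq> {..<n} \<and> card e = 2}"
    using D(2,3) lt ne ne2 by (auto simp: switch_def)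
  moreover have "card {e \<in> ?G. z \<in> e} = d" if "z < n" for z
  proof -
    have e2: "\<And>e. e \<in> ?G \<Longrightarrow> card e = 2" using calculation by auto
    have "card (nbr ?G z) = d"
    proof -
      have c: "card (nbr G z) = d" and f: "finite (nbr G z)" using regular_nbr[OF G] that by auto
      consider "z = u" | "z = v" | "z = x" | "z = y" | "z \<notin> {u, v, x, y}" by auto
      then show ?thesis
      proof cases
        case 1
        have "{w. {z, w} = {u, v} \<or> {z, w} = {x, y}} = {v}" "{w. {z, w} = {u, x} \<or> {z, w} = {v, y}} = {x}"
          unfolding 1 using neq by (auto simp: doubleton_eq_iff)
        then have "nbr ?G z = insert x (nbr G z - {v})" unfolding nbr_switch by simp
        moreover have "v \<in> nbr G z" "x \<notin> nbr G z" unfolding 1 using uv nin by (auto simp: nbr_def)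
        ultimately show ?thesis using f c by (metis card_exchange)
      next
        case 2
        have "{w. {z, w} = {u, v} \<or> {z, w} = {x, y}} = {u}" "{w. {z, w} = {u, x} \<or> {z, w} = {v, y}} = {y}"
          unfolding 2 using neq by (auto simp: doubleton_eq_iff)
        then have "nbr ?G z = insert y (nbr G z - {u})" unfolding nbr_switch by simp
        moreover have "u \<in> nbr G z" "y \<notin> nbr G z" unfolding 2 using uv nin by (auto simp: nbr_def insert_commute)
        ultimately show ?thesis using f c by (metis card_exchange)
      next
        case 3
        have "{w. {z, w} = {u, v} \<or> {z, w} = {x, y}} = {y}" "{w. {z, w} = {u, x} \<or> {z, w} = {v, y}} = {u}"
          unfolding 3 using neq by (auto simp: doubleton_eq_iff)
        then have "nbr ?G z = insert u (nbr G z - {y})" unfolding nbr_switch by simp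
        moreover have "y \<in> nbr G z" "u \<notin> nbr G z" unfolding 3 using xyG nin by (auto simp: nbr_def insert_commute)
        ultimately show ?thesis using f c by (metis card_exchange)
      next
        case 4
        have "{w. {z, w} = {u, v} \<or> {z, w} = {x, y}} = {x}" "{w. {z, w} = {u, x} \<or> {z, w} = {v, y}} = {v}"
          unfolding 4 using neq by (auto simp: doubleton_eq_iff)
        then have "nbr ?G z = insert v (nbr G z - {x})" unfolding nbr_switch by simp
        moreover have "x \<in> nbr G z" "v \<notin> nbr G z" unfolding 4 using xyG nin by (auto simp: nbr_def insert_commute)
        ultimately show ?thesis using f c by (metis card_exchange)
      next
        case 5
        then have "{w. {z, w} = {u, v} \<or> {z, w} = {x, y}} = {}" "{w. {z, w} = {u, x} \<or> {z, w} = {v, y}} = {}"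
          by (auto simp: doubleton_eq_iff)
        then have "nbr ?G z = nbr G z" unfolding nbr_switch by simp
        then show ?thesis using c by simp
      qed
    qed
    then show ?thesis using card_nbr_eq[of ?G z] e2 by simp
  qed
  ultimately show ?thesis by (simp add: regular_graphs_def)
qed

text \<open>The reverse move is again a switching, so the switched graph together with
  \<open>(x, y)\<close> determines \<open>G\<close>. This is the injectivity behind the double
  counting.\<close>

lemma switch_inverse:
  assumes uv: "{u, v} \<in> G" and xy: "(x, y) \<in> switchable H u v G"
  shows "switch u x v y (switch u v x y G) = G"
proof -
  have "{x, y} \<in> G" "{u, x} \<notin> G" "{v, y} \<notin> G" using xy by (auto simp: switchable_def)
  with uv show ?thesis unfolding switch_def by blast
qed

text \<open>Of the \<open>n * d\<close> arcs, the excluded ones lie in \<open>H\<close> (two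
  orientations per edge), start at \<open>u\<close> or end at \<open>v\<close> (at most
  \<open>d\<close> each), or start next to \<open>u\<close> or end next to \<open>v\<close> (at most
  \<open>d\<^sup>2\<close> each).\<close>

lemma card_switchable:
  assumes G: "G \<in> regular_graphs n d" and H: "finite H" and u: "u < n" and v: "v < n"
  shows "n * d \<le> card (switchable H u v G) + (2 * card H + 2 * d + 2 * d\<^sup>2)"
proof -
  note N = regular_nbr[OF G]
  let ?A = "{(x, y). {x, y} \<in> G}"
  let ?B1 = "{(x, y). {x, y} \<in> H \<inter> G}"
  let ?B2 = "{u} \<times> nbr G u" let ?B3 = "nbr G v \<times> {v}"
  let ?B4 = "Sigma (nbr G u) (nbr G)" let ?B5 = "prod.swap ` Sigma (nbr G v) (nbr G)"
  have fs: "finite (Sigma (nbr G w) (nbr G))" for w by (intro finite_SigmaI N)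
  have c45: "card (Sigma (nbr G w) (nbr G)) \<le> d\<^sup>2" for w
  proof -
    have "card (Sigma (nbr G w) (nbr G)) = (\<Sum>x\<in>nbr G w. card (nbr G x))"
      by (rule card_SigmaI) (auto simp: N)
    also have "\<dots> \<le> (\<Sum>x\<in>nbr G w. d)" by (rule sum_mono) (rule N)
    also have "\<dots> \<le> d\<^sup>2" using N(4)[of w] by (simp add: power2_eq_square)
    finally show ?thesis .
  qed
  have c1: "finite ?B1 \<and> card ?B1 \<le> 2 * card H"
  proof -
    have eq: "?B1 = (\<Union>e\<in>H \<inter> G. {(x, y). {x, y} = e})" by auto
    have "card {(x, y). {x, y} = e} \<le> 2 \<and> finite {(x, y). {x, y} = e}" if eG: "e \<in> G" for e
    proof -
      obtain a b where e: "e = {a, b}" using regular_graphsD(3)[OF G eG] unfolding card_2_iff by blast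
      have "{(x, y). {x, y} = e} \<subseteq> {(a, b), (b, a)}"
        unfolding e doubleton_eq_iff by blast
      moreover have "card {(a, b), (b, a)} \<le> 2" using card_length[of "[(a, b), (b, a)]"] by simp
      moreover have "finite {(a, b), (b, a)}" by simp
      ultimately show ?thesis
        using card_mono[of "{(a, b), (b, a)}" "{(x, y). {x, y} = e}"]
          finite_subset[of "{(x, y). {x, y} = e}" "{(a, b), (b, a)}"] by linarith
    qed
    note e2 = this
    have "card ?B1 \<le> (\<Sum>e\<in>H \<inter> G. card {(x, y). {x, y} = e})"
      unfolding eq by (rule card_UN_le) (use H in auto)
    also have "\<dots> \<le> (\<Sum>e\<in>H \<inter> G. 2)" by (rule sum_mono) (use e2 in auto)
    also have "\<dots> \<le> 2 * card H" using card_mono[OF H, of "H \<inter> G"] by simp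
    finally show ?thesis unfolding eq using H e2 by auto
  qed
  have sub: "?A \<subseteq> switchable H u v G \<union> (?B1 \<union> (?B2 \<union> (?B3 \<union> (?B4 \<union> ?B5))))"
    by (auto simp: switchable_def nbr_def insert_commute image_iff)
  have fin: "finite (switchable H u v G)"
    by (rule finite_subset[OF _ regular_card_arcs(2)[OF G]]) (auto simp: switchable_def)
  have finB: "finite (?B1 \<union> (?B2 \<union> (?B3 \<union> (?B4 \<union> ?B5))))"
    using c1 fs N by auto
  have "n * d \<le> card (switchable H u v G \<union> (?B1 \<union> (?B2 \<union> (?B3 \<union> (?B4 \<union> ?B5)))))"
    using card_mono[OF _ sub] fin finB regular_card_arcs(1)[OF G] by simp
  also have "\<dots> \<le> card (switchable H u v G) + card (?B1 \<union> (?B2 \<union> (?B3 \<union> (?B4 \<union> ?B5))))"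
    by (rule card_Un_le)
  also have "card (?B1 \<union> (?B2 \<union> (?B3 \<union> (?B4 \<union> ?B5)))) \<le> card ?B1 + (card ?B2 + (card ?B3 + (card ?B4 + card ?B5)))"
    by (intro order_trans[OF card_Un_le] add_left_mono order_refl)
  also have "\<dots> \<le> 2 * card H + (d + (d + (d\<^sup>2 + d\<^sup>2)))"
    using c1 N(4) c45 card_image_le[OF fs, of prod.swap v]
    by (intro add_mono) (auto simp: card_cartesian_product intro: order_trans)
  finally show ?thesis by simp
qed

definition supergraphs :: "nat \<Rightarrow> nat \<Rightarrow> nat set set \<Rightarrow> nat set set set" where
  "supergraphs n d H = {G \<in> regular_graphs n d. H \<subseteq> G}"

lemma finite_supergraphs [simp]: "finite (supergraphs n d H)"
  by (simp add: supergraphs_def finite_regular_graphs)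

text \<open>Double counting. By \<open>big\<close> at least half of the arcs are switchable, so a
  graph containing \<open>e\<close> and \<open>H\<close> has at least \<open>n * d / 2\<close>
  switchings that destroy \<open>e\<close>. A graph containing \<open>H\<close> is reached by at
  most \<open>d\<^sup>2\<close> of them, because \<open>x\<close> and \<open>y\<close> become
  neighbours of \<open>u\<close> and \<open>v\<close>. The quotient is
  \<open>2 * d / n\<close>.\<close>

lemma card_supergraphs_insert:
  assumes H: "finite H" and e: "e \<notin> H" and big: "2 * (2 * card H + 2 * d + 2 * d\<^sup>2) \<le> n * d"
    and "d > 0" "n > 0"
  shows "real (card (supergraphs n d (insert e H))) \<le> 2 * d / n * card (supergraphs n d H)"
proof (cases "supergraphs n d (insert e H) = {}")
  case False
  then obtain G0 where "G0 \<in> regular_graphs n d" "e \<in> G0" by (auto simp: supergraphs_def)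
  then obtain u v where e_uv: "e = {u, v}" and uv: "u < n" "v < n" "u \<noteq> v"
    using regular_graphsD[of G0 n d] by (metis card_2_iff)
  let ?X = "Sigma (supergraphs n d (insert e H)) (switchable H u v)"
  let ?Y = "Sigma (supergraphs n d H) (\<lambda>G. nbr G u \<times> nbr G v)"
  let ?f = "\<lambda>(G, x, y). (switch u v x y G, x, y)"
  have inj: "inj_on ?f ?X"
  proof (rule inj_on_inverseI[of _ "\<lambda>(G, x, y). (switch u x v y G, x, y)"])
    fix p assume "p \<in> ?X"
    then obtain G x y where "p = (G, x, y)" "{u, v} \<in> G" "(x, y) \<in> switchable H u v G"
      by (auto simp: supergraphs_def e_uv)
    then show "(case ?f p of (G, x, y) \<Rightarrow> (switch u x v y G, x, y)) = p"
      using switch_inverse by fastforce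
  qed
  have sub: "?f ` ?X \<subseteq> ?Y"
  proof
    fix p assume "p \<in> ?f ` ?X"
    then obtain G x y where p: "p = (switch u v x y G, x, y)" and G: "G \<in> regular_graphs n d"
      "insert e H \<subseteq> G" and xy: "(x, y) \<in> switchable H u v G"
      by (auto simp: supergraphs_def)
    have "switch u v x y G \<in> supergraphs n d H"
      using switch_regular[OF G(1) _ xy] G(2) e xy e_uv
      by (auto simp: supergraphs_def switch_def switchable_def)
    moreover have "x \<in> nbr (switch u v x y G) u" "y \<in> nbr (switch u v x y G) v"
      by (auto simp: nbr_def switch_def)
    ultimately show "p \<in> ?Y" using p by auto
  qed
  have finsw: "finite (switchable H u v G)" if "G \<in> regular_graphs n d" for G
    by (rule finite_subset[OF _ regular_card_arcs(2)[OF that]]) (auto simp: switchable_def)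
  have cY: "card ?Y \<le> card (supergraphs n d H) * d\<^sup>2"
  proof -
    have "card ?Y = (\<Sum>G\<in>supergraphs n d H. card (nbr G u \<times> nbr G v))"
      by (rule card_SigmaI[OF finite_supergraphs]) (auto simp: supergraphs_def regular_nbr)
    also have "\<dots> \<le> (\<Sum>G\<in>supergraphs n d H. d\<^sup>2)"
      by (rule sum_mono) (auto simp: supergraphs_def regular_nbr card_cartesian_product
          power2_eq_square intro!: mult_mono)
    finally show ?thesis by simp
  qed
  have finY: "finite ?Y" by (intro finite_SigmaI finite_supergraphs) (auto simp: supergraphs_def regular_nbr)
  have "card (supergraphs n d (insert e H)) * (n * d) \<le> 2 * card ?X"
  proof -
    have "card ?X = (\<Sum>G\<in>supergraphs n d (insert e H). card (switchable H u v G))"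
      by (rule card_SigmaI[OF finite_supergraphs]) (auto simp: supergraphs_def finsw)
    moreover have "n * d \<le> 2 * card (switchable H u v G)" if "G \<in> supergraphs n d (insert e H)" for G
      using card_switchable[of G n d H u v] that H uv big by (auto simp: supergraphs_def)
    then have "(\<Sum>G\<in>supergraphs n d (insert e H). n * d)
        \<le> (\<Sum>G\<in>supergraphs n d (insert e H). 2 * card (switchable H u v G))"
      by (intro sum_mono)
    ultimately show ?thesis by (simp add: sum_distrib_left)
  qed
  also have "card ?X = card (?f ` ?X)" using inj by (simp add: card_image)
  also have "\<dots> \<le> card ?Y" by (rule card_mono[OF finY sub])
  also have "\<dots> \<le> card (supergraphs n d H) * d\<^sup>2" by (rule cY)
  finally have "card (supergraphs n d (insert e H)) * n * d \<le> (2 * d * card (supergraphs n d H)) * d"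
    by (simp add: power2_eq_square algebra_simps)
  then have "card (supergraphs n d (insert e H)) * n \<le> 2 * d * card (supergraphs n d H)"
    using \<open>d > 0\<close> by simp
  then have "real (card (supergraphs n d (insert e H)) * n) \<le> real (2 * d * card (supergraphs n d H))"
    using of_nat_mono by blast
  then show ?thesis using \<open>n > 0\<close> by (simp add: field_simps)
qed simp

lemma card_supergraphs_Un:
  assumes "finite F" and H: "finite H" and "F \<inter> H = {}"
    and big: "2 * (2 * (card H + card F) + 2 * d + 2 * d\<^sup>2) \<le> n * d"
    and "d > 0" "n > 0"
  shows "real (card (supergraphs n d (F \<union> H))) \<le> (2 * d / n) ^ card F * card (supergraphs n d H)"
  using assms(1,3,4)
proof (induction F rule: finite_induct)
  case (insert e F)
  have "card (F \<union> H) \<le> card H + card F" using card_Un_le[of F H] by simp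
  then have "real (card (supergraphs n d (insert e (F \<union> H)))) \<le> 2 * real d / real n * card (supergraphs n d (F \<union> H))"
    using insert.hyps insert.prems H assms(5,6) by (intro card_supergraphs_insert) auto
  also have "\<dots> \<le> 2 * real d / real n * ((2 * real d / real n) ^ card F * card (supergraphs n d H))"
    using insert.IH insert.hyps insert.prems by (intro mult_left_mono) auto
  finally show ?case using insert.hyps by (simp add: mult.assoc)
qed simp

section \<open>First moment bound for dense pieces\<close>

lemma sum_card_swap:
  assumes "finite A" "finite B"
  shows "(\<Sum>x\<in>A. card {y \<in> B. R x y}) = (\<Sum>y\<in>B. card {x \<in> A. R x y})"
proof -
  have "(\<Sum>x\<in>A. \<Sum>y | y \<in> B \<and> R x y. 1::nat) = (\<Sum>y\<in>B. \<Sum>x | x \<in> A \<and> R x y. 1)"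
    by (rule sum.swap_restrict[OF assms])
  then show ?thesis by simp
qed

text \<open>Union bound over the spanning walk and its \<open>x\<close> surplus edges, which are
  chosen among at most \<open>(Suc L)\<^sup>2\<close> pairs of visited vertices. Only the surplus
  edges are paid for by switching.\<close>

lemma card_surplus_graphs:
  assumes big: "2 * (2 * (L + x) + 2 * d + 2 * d\<^sup>2) \<le> n * d" and "d > 0" "n > 0"
    and xpos: "x > 0"
  shows "real (card {G \<in> regular_graphs n d. surplus G L x})
    \<le> real (Suc L) * n * d ^ L * ((real (Suc L))\<^sup>2) ^ x * (2 * d / n) ^ x * card (regular_graphs n d)"
proof -
  define XS :: "nat list set" where "XS = {xs. set xs \<subseteq> {..<n} \<and> length xs \<le> Suc L \<and> xs \<noteq> []}"
  define FS :: "nat list \<Rightarrow> nat set set set"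
    where "FS xs = {F. F \<subseteq> (\<lambda>(a, b). {a, b}) ` (set xs \<times> set xs) \<and> F \<inter> set (edge_seq xs) = {} \<and> card F = x}" for xs
  have finXS: "finite XS"
    unfolding XS_def by (rule finite_subset[OF _ finite_lists_length_le[of "{..<n}" "Suc L"]]) auto
  have finFS: "finite (FS xs)" for xs
    unfolding FS_def by (rule finite_subset[of _ "Pow ((\<lambda>(a, b). {a, b}) ` (set xs \<times> set xs))"]) auto
  have cFS: "card (FS xs) \<le> ((Suc L)\<^sup>2) ^ x" if "xs \<in> XS" for xs
  proof -
    let ?P = "(\<lambda>(a, b). {a, b}) ` (set xs \<times> set xs)"
    have P: "card ?P \<le> (Suc L)\<^sup>2"
    proof -
      have "card ?P \<le> card (set xs \<times> set xs)" by (rule card_image_le) auto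
      also have "\<dots> \<le> (Suc L)\<^sup>2" unfolding card_cartesian_product power2_eq_square
        using that card_length[of xs] by (intro mult_mono) (auto simp: XS_def)
      finally show ?thesis .
    qed
    have "card (FS xs) \<le> card {F. F \<subseteq> ?P \<and> card F = x}"
      by (rule card_mono) (auto simp: FS_def intro!: finite_subset[of _ "Pow ?P"])
    also have "\<dots> = card ?P choose x" by (rule n_subsets) auto
    also have "\<dots> \<le> card ?P ^ x" by (cases "x \<le> card ?P") (auto simp: binomial_le_pow binomial_eq_0)
    also have "\<dots> \<le> ((Suc L)\<^sup>2) ^ x" by (rule power_mono[OF P]) auto
    finally show ?thesis .
  qed
  have sub: "{G \<in> regular_graphs n d. surplus G L x}
      \<subseteq> (\<Union>xs\<in>XS. \<Union>F\<in>FS xs. supergraphs n d (F \<union> set (edge_seq xs)))"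
  proof
    fix G assume G: "G \<in> {G \<in> regular_graphs n d. surplus G L x}"
    then obtain xs F where *: "xs \<noteq> []" "length xs \<le> Suc L" "set (edge_seq xs) \<subseteq> G"
      "F \<subseteq> G - set (edge_seq xs)" "finite F" "card F = x" "\<forall>e\<in>F. e \<subseteq> set xs"
      by (auto simp: surplus_def)
    have e2: "e \<subseteq> {..<n}" "card e = 2" if "e \<in> G" for e
      using G regular_graphsD(2,3)[of G n d e] that by blast+
    have "F \<subseteq> (\<lambda>(a, b). {a, b}) ` (set xs \<times> set xs)"
    proof
      fix e assume e: "e \<in> F"
      then obtain a b where ab: "e = {a, b}" using e2(2)[of e] * unfolding card_2_iff by blast
      then have "(a, b) \<in> set xs \<times> set xs" using e * by auto
      then show "e \<in> (\<lambda>(a, b). {a, b}) ` (set xs \<times> set xs)" using ab by force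
    qed
    then have F: "F \<in> FS xs" using * by (auto simp: FS_def)
    \<comment> \<open>A one-vertex walk has no edge that would place its vertex below
      \<open>n\<close>; but then \<open>F\<close>, nonempty because \<open>x > 0\<close>, would
      contain a two-element subset of a singleton.\<close>
    have "set xs \<subseteq> {..<n}"
    proof (cases "length xs = 1")
      case True
      then obtain a where a: "xs = [a]" by (auto simp: length_Suc_conv)
      obtain e where "e \<in> F" using * xpos by (metis card.empty all_not_in_conv less_irrefl)
      then have "e \<subseteq> {a}" "card e = 2" using * a e2 by auto
      then show ?thesis using card_mono[of "{a}" e] by auto
    next
      case False
      show ?thesis
      proof
        fix z assume "z \<in> set xs"
        then obtain i where i: "i < length xs" "z = xs ! i" by (auto simp: in_set_conv_nth)
        have "\<exists>e\<in>set (edge_seq xs). z \<in> e"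
        proof (cases "Suc i < length xs")
          case True
          then have "{xs ! i, xs ! Suc i} \<in> set (edge_seq xs)" unfolding set_edge_seq by blast
          then show ?thesis using i by blast
        next
          case F: False
          then obtain j where j: "i = Suc j" using i False * by (cases i) auto
          then have "{xs ! j, xs ! Suc j} \<in> set (edge_seq xs)" unfolding set_edge_seq using i by blast
          then show ?thesis using i j by blast
        qed
        then show "z \<in> {..<n}" using e2 * by blast
      qed
    qed
    then have "xs \<in> XS" using * by (simp add: XS_def)
    then show "G \<in> (\<Union>xs\<in>XS. \<Union>F\<in>FS xs. supergraphs n d (F \<union> set (edge_seq xs)))"
      using F G * by (auto simp: supergraphs_def)
  qed
  \<comment> \<open>The walk edges are handled by exchanging the sums: inside a fixed graph there
    are at most \<open>n * d ^ L\<close> walks of each length up to \<open>L\<close>, even if they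
    repeat edges.\<close>
  have swap: "(\<Sum>xs\<in>XS. real (card (supergraphs n d (set (edge_seq xs)))))
      \<le> real (Suc L) * n * d ^ L * card (regular_graphs n d)"
  proof -
    have "(\<Sum>xs\<in>XS. card (supergraphs n d (set (edge_seq xs))))
        = (\<Sum>G\<in>regular_graphs n d. card {xs\<in>XS. set (edge_seq xs) \<subseteq> G})"
      unfolding supergraphs_def
      by (rule sum_card_swap[OF finXS finite_regular_graphs])
    also have "\<dots> \<le> (\<Sum>G\<in>regular_graphs n d. Suc L * n * d ^ L)"
    proof (rule sum_mono)
      fix G assume G: "G \<in> regular_graphs n d"
      note W = walks_finite_card[of G d, OF regular_nbr(1)[OF G] regular_nbr(4)[OF G]]
      have "{xs\<in>XS. set (edge_seq xs) \<subseteq> G} \<subseteq> (\<Union>m\<in>{..L}. \<Union>a\<in>{..<n}. walks G m a)"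
      proof
        fix xs assume xs: "xs \<in> {xs\<in>XS. set (edge_seq xs) \<subseteq> G}"
        then have "xs \<in> walks G (length xs - 1) (hd xs)" "hd xs < n" "length xs - 1 \<le> L"
          by (cases xs; auto simp: walks_def XS_def)+
        then show "xs \<in> (\<Union>m\<in>{..L}. \<Union>a\<in>{..<n}. walks G m a)" by blast
      qed
      then have "card {xs\<in>XS. set (edge_seq xs) \<subseteq> G} \<le> card (\<Union>m\<in>{..L}. \<Union>a\<in>{..<n}. walks G m a)"
        using W by (intro card_mono) auto
      also have "\<dots> \<le> (\<Sum>m\<in>{..L}. card (\<Union>a\<in>{..<n}. walks G m a))" by (rule card_UN_le) auto
      also have "\<dots> \<le> (\<Sum>m\<in>{..L}. n * d ^ L)"
      proof (rule sum_mono)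
        fix m assume "m \<in> {..L}"
        have "card (\<Union>a\<in>{..<n}. walks G m a) \<le> (\<Sum>a\<in>{..<n}. card (walks G m a))" by (rule card_UN_le) auto
        also have "\<dots> \<le> (\<Sum>a\<in>{..<n}. d ^ m)" using W by (intro sum_mono) auto
        also have "\<dots> \<le> n * d ^ L" using \<open>m \<in> {..L}\<close> \<open>d > 0\<close> by (auto intro: power_increasing)
        finally show "card (\<Union>a\<in>{..<n}. walks G m a) \<le> n * d ^ L" .
      qed
      finally show "card {xs\<in>XS. set (edge_seq xs) \<subseteq> G} \<le> Suc L * n * d ^ L" by (simp add: algebra_simps)
    qed
    finally have "(\<Sum>xs\<in>XS. card (supergraphs n d (set (edge_seq xs)))) \<le> Suc L * n * d ^ L * card (regular_graphs n d)"
      by (simp add: mult.commute)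
    then have "real (\<Sum>xs\<in>XS. card (supergraphs n d (set (edge_seq xs)))) \<le> real (Suc L * n * d ^ L * card (regular_graphs n d))"
      using of_nat_mono by blast
    then show ?thesis by (simp add: algebra_simps)
  qed
  have "real (card {G \<in> regular_graphs n d. surplus G L x})
      \<le> real (card (\<Union>xs\<in>XS. \<Union>F\<in>FS xs. supergraphs n d (F \<union> set (edge_seq xs))))"
    using sub finXS finFS by (intro of_nat_mono card_mono finite_UN_I finite_supergraphs) auto
  also have "\<dots> \<le> real (\<Sum>xs\<in>XS. \<Sum>F\<in>FS xs. card (supergraphs n d (F \<union> set (edge_seq xs))))"
  proof (rule of_nat_mono)
    have "card (\<Union>xs\<in>XS. \<Union>F\<in>FS xs. supergraphs n d (F \<union> set (edge_seq xs)))
        \<le> (\<Sum>xs\<in>XS. card (\<Union>F\<in>FS xs. supergraphs n d (F \<union> set (edge_seq xs))))"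
      by (rule card_UN_le[OF finXS])
    also have "\<dots> \<le> (\<Sum>xs\<in>XS. \<Sum>F\<in>FS xs. card (supergraphs n d (F \<union> set (edge_seq xs))))"
      by (rule sum_mono) (rule card_UN_le[OF finFS])
    finally show "card (\<Union>xs\<in>XS. \<Union>F\<in>FS xs. supergraphs n d (F \<union> set (edge_seq xs)))
        \<le> (\<Sum>xs\<in>XS. \<Sum>F\<in>FS xs. card (supergraphs n d (F \<union> set (edge_seq xs))))" .
  qed
  also have "\<dots> = (\<Sum>xs\<in>XS. \<Sum>F\<in>FS xs. real (card (supergraphs n d (F \<union> set (edge_seq xs)))))"
    by simp
  also have "\<dots> \<le> (\<Sum>xs\<in>XS. \<Sum>F\<in>FS xs. (2 * real d / real n) ^ x * card (supergraphs n d (set (edge_seq xs))))"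
  proof (intro sum_mono)
    fix xs F assume xs: "xs \<in> XS" and F: "F \<in> FS xs"
    have "finite F" using F by (auto simp: FS_def intro: finite_subset)
    have cF: "card F = x" using F by (simp add: FS_def)
    have "card (set (edge_seq xs)) \<le> L"
      using card_length[of "edge_seq xs"] xs by (auto simp: XS_def)
    then have "real (card (supergraphs n d (F \<union> set (edge_seq xs))))
        \<le> (2 * real d / real n) ^ card F * card (supergraphs n d (set (edge_seq xs)))"
      using \<open>finite F\<close> F assms cF by (intro card_supergraphs_Un) (auto simp: FS_def)
    then show "real (card (supergraphs n d (F \<union> set (edge_seq xs))))
        \<le> (2 * real d / real n) ^ x * card (supergraphs n d (set (edge_seq xs)))" using cF by simp
  qed
  also have "\<dots> = (\<Sum>xs\<in>XS. real (card (FS xs)) * ((2 * real d / real n) ^ x * card (supergraphs n d (set (edge_seq xs)))))"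
    by simp
  also have "\<dots> \<le> (\<Sum>xs\<in>XS. ((real (Suc L))\<^sup>2) ^ x * ((2 * real d / real n) ^ x * card (supergraphs n d (set (edge_seq xs)))))"
  proof (intro sum_mono mult_right_mono)
    fix xs assume "xs \<in> XS"
    from of_nat_mono[OF cFS[OF this], where 'a = real]
    show "real (card (FS xs)) \<le> ((real (Suc L))\<^sup>2) ^ x" by simp
  qed auto
  also have "\<dots> = ((real (Suc L))\<^sup>2) ^ x * (2 * real d / real n) ^ x * (\<Sum>xs\<in>XS. real (card (supergraphs n d (set (edge_seq xs)))))"
    by (simp add: sum_distrib_left mult.assoc)
  also have "\<dots> \<le> ((real (Suc L))\<^sup>2) ^ x * (2 * real d / real n) ^ x * (real (Suc L) * n * d ^ L * card (regular_graphs n d))"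
    by (intro mult_left_mono swap) auto
  finally show ?thesis by (simp add: mult_ac)
qed

section \<open>Non-backtracking walks in pieces with one cycle\<close>

definition nonbacktracking :: "'a list \<Rightarrow> bool" where
  "nonbacktracking xs \<longleftrightarrow> (\<forall>i. Suc (Suc i) < length xs \<longrightarrow> xs ! i \<noteq> xs ! Suc (Suc i))"

definition follows :: "('a \<Rightarrow> 'a) \<Rightarrow> 'a list \<Rightarrow> bool" where
  "follows p xs \<longleftrightarrow>
     (\<forall>i. Suc i < length xs \<longrightarrow> xs ! Suc i = p (xs ! i) \<or> xs ! i = p (xs ! Suc i))"

text \<open>After a step against \<open>p\<close>, a step along \<open>p\<close> would backtrack.  Hence a non-backtracking walk
  first goes along \<open>p\<close> and then against it.\<close>

lemma nonbacktracking_follows_cases: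
  assumes "nonbacktracking xs" "follows p xs" "length xs = Suc l"
  obtains a where "a \<le> l" "\<And>i. i \<le> a \<Longrightarrow> xs ! i = (p ^^ i) (xs ! 0)"
    "\<And>i. a \<le> i \<Longrightarrow> i \<le> l \<Longrightarrow> xs ! i = (p ^^ (l - i)) (xs ! l)"
proof -
  define a where "a = (LEAST a. a = l \<or> xs ! Suc a \<noteq> p (xs ! a))"
  have a: "a = l \<or> xs ! Suc a \<noteq> p (xs ! a)" unfolding a_def by (rule LeastI[of _ l]) simp
  have al: "a \<le> l" unfolding a_def by (rule Least_le) simp
  have up: "xs ! Suc i = p (xs ! i)" if "i < a" for i
    using not_less_Least[of i "\<lambda>a. a = l \<or> xs ! Suc a \<noteq> p (xs ! a)"] that by (auto simp: a_def)
  have down: "xs ! i = p (xs ! Suc i)" if "a \<le> i" "i < l" for i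
    using that
  proof (induction i rule: dec_induct)
    case base
    then show ?case using a assms by (auto simp: follows_def)
  next
    case (step i)
    have "xs ! i \<noteq> xs ! Suc (Suc i)" using assms step by (auto simp: nonbacktracking_def)
    moreover have "xs ! i = p (xs ! Suc i)" using step by simp
    ultimately have "xs ! Suc (Suc i) \<noteq> p (xs ! Suc i)" by simp
    then show ?case using assms step by (auto simp: follows_def)
  qed
  show ?thesis
  proof (rule that[OF al])
    show "xs ! i = (p ^^ i) (xs ! 0)" if "i \<le> a" for i
      using that by (induction i) (auto simp: up)
    show "xs ! i = (p ^^ (l - i)) (xs ! l)" if "a \<le> i" "i \<le> l" for i
      using that(2,1)
    proof (induction i rule: inc_induct)
      case (step i)
      have "l - i = Suc (l - Suc i)" using step by simp
      then show ?case using step down[of i] by simp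
    qed simp
  qed
qed

lemma card_nb_follows:
  "finite {xs. length xs = Suc l \<and> xs ! 0 = x \<and> xs ! l = y \<and> nonbacktracking xs \<and> follows p xs} \<and>
   card {xs. length xs = Suc l \<and> xs ! 0 = x \<and> xs ! l = y \<and> nonbacktracking xs \<and> follows p xs} \<le> Suc l"
proof -
  let ?f = "\<lambda>a. map (\<lambda>i. if i \<le> a then (p ^^ i) x else (p ^^ (l - i)) y) [0..<Suc l]"
  let ?W = "{xs. length xs = Suc l \<and> xs ! 0 = x \<and> xs ! l = y \<and> nonbacktracking xs \<and> follows p xs}"
  have sub: "?W \<subseteq> ?f ` {..l}"
  proof
    fix xs assume "xs \<in> ?W"
    then have xs: "length xs = Suc l" "xs ! 0 = x" "xs ! l = y" "nonbacktracking xs" "follows p xs" by auto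
    obtain a where a: "a \<le> l" "\<And>i. i \<le> a \<Longrightarrow> xs ! i = (p ^^ i) (xs ! 0)"
      "\<And>i. a \<le> i \<Longrightarrow> i \<le> l \<Longrightarrow> xs ! i = (p ^^ (l - i)) (xs ! l)"
      using nonbacktracking_follows_cases[OF xs(4,5,1)] by metis
    have "xs = ?f a"
    proof (rule nth_equalityI)
      fix i assume "i < length xs"
      then have i: "i \<le> l" using xs by simp
      then have "?f a ! i = (if i \<le> a then (p ^^ i) x else (p ^^ (l - i)) y)" by (subst nth_map) (auto simp del: upt_Suc)
      then show "xs ! i = ?f a ! i" using a(2)[of i] a(3)[of i] i xs by (cases "i \<le> a") auto
    qed (use xs in simp)
    then show "xs \<in> ?f ` {..l}" using a(1) by blast
  qed
  have "card ?W \<le> card (?f ` {..l})" by (rule card_mono[OF _ sub]) auto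
  also have "\<dots> \<le> card {..l}" by (rule card_image_le) auto
  finally show ?thesis using finite_subset[OF sub] by auto
qed

section \<open>Breadth-first trees and pieces with one cycle\<close>

definition arcs :: "'a set set \<Rightarrow> ('a \<times> 'a) set" where
  "arcs E = {(x, y). {x, y} \<in> E}"

lemma walk_relpow:
  "xs \<noteq> [] \<Longrightarrow> set (edge_seq xs) \<subseteq> E \<Longrightarrow> (hd xs, last xs) \<in> arcs E ^^ (length xs - 1)"
proof (induction xs rule: edge_seq.induct)
  case (1 x y zs)
  then have "(y, last (y # zs)) \<in> arcs E ^^ length zs" "(x, y) \<in> arcs E" by (auto simp: arcs_def)
  then have "(x, last (y # zs)) \<in> arcs E ^^ Suc (length zs)" by (rule relpow_Suc_I2[rotated])
  then show ?case by simp
qed auto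

lemma walk_prefix_relpow:
  assumes "set (edge_seq xs) \<subseteq> E" "i < length xs"
  shows "(hd xs, xs ! i) \<in> arcs E ^^ i"
proof -
  have "set (edge_seq (take (Suc i) xs)) \<subseteq> E"
    using assms(1) set_take_subset[of i "edge_seq xs"] by (auto simp: edge_seq_take)
  moreover have "take (Suc i) xs \<noteq> []" using assms by auto
  ultimately have "(hd (take (Suc i) xs), last (take (Suc i) xs)) \<in> arcs E ^^ (length (take (Suc i) xs) - 1)"
    using walk_relpow by blast
  moreover have "hd (take (Suc i) xs) = hd xs" by (cases xs) auto
  moreover have "last (take (Suc i) xs) = xs ! i" using assms by (simp add: take_Suc_conv_app_nth)
  moreover have "length (take (Suc i) xs) - 1 = i" using assms by auto
  ultimately show ?thesis by metis
qed

lemma edge_seq_join: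
  assumes "xs \<noteq> []" "ys \<noteq> []" "last xs = hd ys"
  shows "edge_seq (xs @ tl ys) = edge_seq xs @ edge_seq ys"
proof -
  have "xs @ tl ys = butlast xs @ hd ys # tl ys"
    using assms by (metis append.assoc append_Cons append_Nil append_butlast_last_id)
  then have "edge_seq (xs @ tl ys) = edge_seq (butlast xs @ [hd ys]) @ edge_seq (hd ys # tl ys)"
    using edge_seq_append by metis
  then show ?thesis using assms by (metis append_butlast_last_id list.collapse)
qed

lemma bfs_tree:
  fixes E :: "'a set set" and x :: 'a
  obtains p where "\<And>v j. (x, v) \<in> arcs E ^^ j \<Longrightarrow>
    \<exists>xs. xs \<noteq> [] \<and> hd xs = v \<and> last xs = x \<and> length xs \<le> Suc j \<and> set (edge_seq xs) \<subseteq> E \<and>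
      (\<forall>e\<in>set (edge_seq xs). \<exists>w. w \<noteq> x \<and> e = {w, p w})"
proof -
  define lev where "lev v = (LEAST j. (x, v) \<in> arcs E ^^ j)" for v
  define p where "p v = (SOME u. (x, u) \<in> arcs E ^^ (lev v - 1) \<and> (u, v) \<in> arcs E)" for v
  have "\<exists>xs. xs \<noteq> [] \<and> hd xs = v \<and> last xs = x \<and> length xs \<le> Suc j \<and> set (edge_seq xs) \<subseteq> E \<and>
      (\<forall>e\<in>set (edge_seq xs). \<exists>w. w \<noteq> x \<and> e = {w, p w})" if "(x, v) \<in> arcs E ^^ j" for v j
    using that
  proof (induction j arbitrary: v rule: less_induct)
    case (less j)
    have le: "lev v \<le> j" unfolding lev_def by (rule Least_le) (rule less.prems)
    have lev: "(x, v) \<in> arcs E ^^ lev v" unfolding lev_def by (rule LeastI) (rule less.prems)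
    show ?case
    proof (cases "lev v")
      case 0
      then have "v = x" using lev by simp
      then show ?thesis by (intro exI[of _ "[x]"]) auto
    next
      case (Suc m)
      then have "\<exists>u. (x, u) \<in> arcs E ^^ (lev v - 1) \<and> (u, v) \<in> arcs E" using lev by auto
      then have pv: "(x, p v) \<in> arcs E ^^ (lev v - 1) \<and> (p v, v) \<in> arcs E"
        unfolding p_def by (rule someI_ex)
      have "v \<noteq> x"
      proof
        assume "v = x"
        then have "lev v \<le> 0" unfolding lev_def by (intro Least_le) simp
        then show False using Suc by simp
      qed
      obtain ys where ys: "ys \<noteq> []" "hd ys = p v" "last ys = x" "length ys \<le> Suc m"
        "set (edge_seq ys) \<subseteq> E" "\<forall>e\<in>set (edge_seq ys). \<exists>w. w \<noteq> x \<and> e = {w, p w}"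
        using less.IH[of m "p v"] le Suc pv by auto
      show ?thesis
        using ys le Suc pv \<open>v \<noteq> x\<close>
        by (intro exI[of _ "v # ys"]) (auto simp: edge_seq_Cons arcs_def insert_commute)
    qed
  qed
  then show ?thesis using that by blast
qed

text \<open>If every edge near \<open>x\<close> belongs to the tree rooted at \<open>x\<close>, its
  parent map serves. Otherwise an edge \<open>{a, b}\<close> outside the tree is removed and a
  second tree is grown from \<open>a\<close>: the root has no parent, so \<open>b\<close> can be
  made its value. Any further edge outside that tree would be a second surplus edge.\<close>

lemma pseudoforest_orientation:
  assumes ns: "\<not> surplus E (10 * r) 2"
  obtains p where "\<And>xs. xs \<noteq> [] \<Longrightarrow> hd xs = x \<Longrightarrow> length xs \<le> Suc r \<Longrightarrow> set (edge_seq xs) \<subseteq> E \<Longrightarrow> follows p xs"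
proof -
  obtain p1 where p1: "\<And>v j. (x, v) \<in> arcs E ^^ j \<Longrightarrow>
    \<exists>xs. xs \<noteq> [] \<and> hd xs = v \<and> last xs = x \<and> length xs \<le> Suc j \<and> set (edge_seq xs) \<subseteq> E \<and>
      (\<forall>e\<in>set (edge_seq xs). \<exists>w. w \<noteq> x \<and> e = {w, p1 w})"
    using bfs_tree[of x E] by blast
  define near where "near v \<longleftrightarrow> (\<exists>j\<le>r. (x, v) \<in> arcs E ^^ j)" for v
  have near: "near (xs ! i)" if "hd xs = x" "length xs \<le> Suc r" "set (edge_seq xs) \<subseteq> E" "i < length xs" for xs i
    using walk_prefix_relpow[OF that(3,4)] that unfolding near_def by (intro exI[of _ i]) auto
  have edge: "{xs ! i, xs ! Suc i} \<in> E" if "set (edge_seq xs) \<subseteq> E" "Suc i < length xs" for xs i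
    using that unfolding set_edge_seq by blast
  show ?thesis
  proof (cases "\<forall>a b. near a \<longrightarrow> near b \<longrightarrow> {a, b} \<in> E \<longrightarrow> (\<exists>w. {a, b} = {w, p1 w})")
    case True
    show ?thesis
    proof (rule that)
      fix xs assume xs: "hd xs = x" "length xs \<le> Suc r" "set (edge_seq xs) \<subseteq> E"
      show "follows p1 xs" unfolding follows_def
      proof (intro allI impI)
        fix i assume i: "Suc i < length xs"
        then obtain w where "{xs ! i, xs ! Suc i} = {w, p1 w}"
          using True near[OF xs, of i] near[OF xs, of "Suc i"] edge[OF xs(3) i] by (meson Suc_lessD)
        then show "xs ! Suc i = p1 (xs ! i) \<or> xs ! i = p1 (xs ! Suc i)" by (auto simp: doubleton_eq_iff)
      qed
    qed
  next
    case False
    then obtain a b where ab: "near a" "near b" "{a, b} \<in> E" "\<not> (\<exists>w. {a, b} = {w, p1 w})" by blast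
    define E1 where "E1 = E - {{a, b}}"
    \<comment> \<open>The first tree does not use \<open>{a, b}\<close>, so removing this edge does
      not take vertices out of reach.\<close>
    have to_x: "\<exists>j\<le>r. (v, x) \<in> arcs E1 ^^ j \<and> (x, v) \<in> arcs E1 ^^ j" if v: "near v" for v
    proof -
      from v obtain j where j: "j \<le> r" "(x, v) \<in> arcs E ^^ j" by (auto simp: near_def)
      obtain xs where xs: "xs \<noteq> []" "hd xs = v" "last xs = x" "length xs \<le> Suc j" "set (edge_seq xs) \<subseteq> E"
        "\<forall>e\<in>set (edge_seq xs). \<exists>w. w \<noteq> x \<and> e = {w, p1 w}" using p1[OF j(2)] by blast
      have sub: "set (edge_seq xs) \<subseteq> E1" using xs(5,6) ab(4) unfolding E1_def by blast
      have "(v, x) \<in> arcs E1 ^^ (length xs - 1)" using walk_relpow[OF xs(1) sub] xs by simp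
      moreover have "(x, v) \<in> arcs E1 ^^ (length (rev xs) - 1)"
        using walk_relpow[of "rev xs" E1] xs sub by (simp add: edge_seq_rev hd_rev last_rev)
      ultimately show ?thesis using xs(4) j(1) by (intro exI[of _ "length xs - 1"]) auto
    qed
    obtain p2 where p2: "\<And>v j. (a, v) \<in> arcs E1 ^^ j \<Longrightarrow>
      \<exists>xs. xs \<noteq> [] \<and> hd xs = v \<and> last xs = a \<and> length xs \<le> Suc j \<and> set (edge_seq xs) \<subseteq> E1 \<and>
        (\<forall>e\<in>set (edge_seq xs). \<exists>w. w \<noteq> a \<and> e = {w, p2 w})"
      using bfs_tree[of a E1] by blast
    define T where "T = {e \<in> E1. \<exists>w. w \<noteq> a \<and> e = {w, p2 w}}"
    have to_a: "\<exists>xs. xs \<noteq> [] \<and> hd xs = v \<and> last xs = a \<and> length xs \<le> Suc (2 * r) \<and> set (edge_seq xs) \<subseteq> T"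
      if v: "near v" for v
    proof -
      from to_x[OF ab(1)] obtain j1 where j1: "j1 \<le> r" "(a, x) \<in> arcs E1 ^^ j1" by blast
      from to_x[OF v] obtain j2 where j2: "j2 \<le> r" "(x, v) \<in> arcs E1 ^^ j2" by blast
      have "(a, v) \<in> arcs E1 ^^ (j1 + j2)" using j1 j2 by (auto simp: relpow_add)
      from p2[OF this] obtain xs where "xs \<noteq> []" "hd xs = v" "last xs = a" "length xs \<le> Suc (j1 + j2)"
        "set (edge_seq xs) \<subseteq> E1" "\<forall>e\<in>set (edge_seq xs). \<exists>w. w \<noteq> a \<and> e = {w, p2 w}" by blast
      then show ?thesis using j1 j2 by (intro exI[of _ xs]) (auto simp: T_def)
    qed
    \<comment> \<open>The root \<open>a\<close> is the one vertex whose value the second tree leaves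
      free, so it can carry the removed edge.\<close>
    define p where "p = p2(a := b)"
    have pe: "\<exists>w. {u, v} = {w, p w}" if uv: "near u" "near v" "{u, v} \<in> E" for u v
    proof (cases "{u, v} = {a, b}")
      case True
      then have "{u, v} = {a, p a}" by (simp add: p_def)
      then show ?thesis by blast
    next
      case ne: False
      show ?thesis
      proof (cases "{u, v} \<in> T")
        case True
        then obtain w where "w \<noteq> a" "{u, v} = {w, p2 w}" by (auto simp: T_def)
        then have "{u, v} = {w, p w}" by (simp add: p_def)
        then show ?thesis by blast
      next
        case False
        obtain B where B: "B \<noteq> []" "hd B = b" "last B = a" "length B \<le> Suc (2 * r)" "set (edge_seq B) \<subseteq> T"
          using to_a[OF ab(2)] by blast
        obtain U where U: "U \<noteq> []" "hd U = u" "last U = a" "length U \<le> Suc (2 * r)" "set (edge_seq U) \<subseteq> T"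
          using to_a[OF uv(1)] by blast
        obtain V where V: "V \<noteq> []" "hd V = v" "last V = a" "length V \<le> Suc (2 * r)" "set (edge_seq V) \<subseteq> T"
          using to_a[OF uv(2)] by blast
        define P where "P = B @ tl (rev U)"
        have P: "P \<noteq> []" "last P = u" "set (edge_seq P) \<subseteq> T" "length P \<le> Suc (4 * r)"
          "a \<in> set P" "b \<in> set P" "u \<in> set P"
        proof -
          have l: "last B = hd (rev U)" using B U by (simp add: hd_rev)
          have "edge_seq P = edge_seq B @ edge_seq (rev U)"
            unfolding P_def by (rule edge_seq_join) (use B U l in auto)
          then show "set (edge_seq P) \<subseteq> T" using B U by (simp add: edge_seq_rev)
          show "P \<noteq> []" using B by (simp add: P_def)
          show lu: "last P = u"
          proof (cases "tl (rev U)")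
            case Nil
            then have "length U = 1" using U by (cases U rule: rev_cases) (auto simp: tl_append split: list.splits)
            then obtain z where "U = [z]" by (auto simp: length_Suc_conv)
            then show ?thesis using U B Nil by (simp add: P_def)
          next
            case (Cons z zs)
            then have "last P = last (tl (rev U))" by (simp add: P_def)
            also have "\<dots> = last (rev U)" using Cons by (metis last_tl list.discI)
            finally show ?thesis using U by (simp add: last_rev)
          qed
          show "length P \<le> Suc (4 * r)" using B U by (simp add: P_def)
          have "last B \<in> set B" "hd B \<in> set B" using B by auto
          then show "a \<in> set P" "b \<in> set P" using B by (auto simp: P_def)
          show "u \<in> set P" using lu \<open>P \<noteq> []\<close> last_in_set by blast
        qed
        \<comment> \<open>\<open>Q\<close> runs through tree edges from \<open>b\<close> to
          \<open>a\<close>, to \<open>u\<close>, back to \<open>a\<close> and on to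
          \<open>v\<close>. Each leg has at most \<open>2 * r\<close> steps, so \<open>Q\<close> has
          at most \<open>8 * r\<close>, within the allowed \<open>10 * r\<close>; the edges
          \<open>{a, b}\<close> and \<open>{u, v}\<close> are surplus over it.\<close>
        define Q where "Q = P @ tl (U @ tl (rev V))"
        have l: "last U = hd (rev V)" using U V by (simp add: hd_rev)
        have ejUV: "edge_seq (U @ tl (rev V)) = edge_seq U @ edge_seq (rev V)"
          by (rule edge_seq_join) (use U V l in auto)
        have "edge_seq Q = edge_seq P @ edge_seq (U @ tl (rev V))"
          unfolding Q_def by (rule edge_seq_join) (use P U in auto)
        then have QT: "set (edge_seq Q) \<subseteq> T" using P U V ejUV by (simp add: edge_seq_rev)
        have lQ: "length Q \<le> Suc (10 * r)" using P U V by (simp add: Q_def)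
        have vQ: "v \<in> set Q"
        proof (cases "length V = 1")
          case True
          then have "v = a" using V by (auto simp: length_Suc_conv)
          then show ?thesis using P by (simp add: Q_def)
        next
          case False
          then have "2 \<le> length V" using V by (cases V) (auto simp: Suc_le_eq)
          then have "0 < length (tl (rev V))" by simp
          then have tne: "tl (rev V) \<noteq> []" using length_greater_0_conv by blast
          have "last (tl (rev V)) = v" using V(1,2) tne by (simp add: last_tl last_rev)
          with last_in_set[OF tne] have "v \<in> set (tl (rev V))" by metis
          then show ?thesis using U by (auto simp: Q_def)
        qed
        have "surplus E (10 * r) 2"
          unfolding surplus_def
        proof (intro exI[of _ Q] exI[of _ "{{a, b}, {u, v}}"] conjI)
          show "Q \<noteq> []" using P by (simp add: Q_def)
          show "set (edge_seq Q) \<subseteq> E" using QT by (auto simp: T_def E1_def)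
          have "{a, b} \<notin> T" by (simp add: T_def E1_def)
          then show "{{a, b}, {u, v}} \<subseteq> E - set (edge_seq Q)" using False QT ab uv by blast
          show "card {{a, b}, {u, v}} = 2" using ne by (simp add: eq_commute)
          show "\<forall>e\<in>{{a, b}, {u, v}}. e \<subseteq> set Q" using P vQ by (simp add: Q_def)
        qed (use lQ in auto)
        with ns show ?thesis by simp
      qed
    qed
    show ?thesis
    proof (rule that)
      fix xs assume xs: "hd xs = x" "length xs \<le> Suc r" "set (edge_seq xs) \<subseteq> E"
      show "follows p xs" unfolding follows_def
      proof (intro allI impI)
        fix i assume i: "Suc i < length xs"
        then obtain w where "{xs ! i, xs ! Suc i} = {w, p w}"
          using pe near[OF xs, of i] near[OF xs, of "Suc i"] edge[OF xs(3) i] by (meson Suc_lessD)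
        then show "xs ! Suc i = p (xs ! i) \<or> xs ! i = p (xs ! Suc i)" by (auto simp: doubleton_eq_iff)
      qed
    qed
  qed
qed

lemma card_nb_walks_le:
  fixes x y :: 'a
  assumes "\<not> surplus E (10 * r) 2" "l \<le> r"
  defines "W \<equiv> {xs. length xs = Suc l \<and> xs ! 0 = x \<and> xs ! l = y \<and> nonbacktracking xs \<and> set (edge_seq xs) \<subseteq> E}"
  shows "finite W \<and> card W \<le> Suc l"
proof -
  obtain p where p: "\<And>xs. xs \<noteq> [] \<Longrightarrow> hd xs = x \<Longrightarrow> length xs \<le> Suc r \<Longrightarrow> set (edge_seq xs) \<subseteq> E \<Longrightarrow> follows p xs"
    using pseudoforest_orientation[OF assms(1)] by blast
  have "W \<subseteq> {xs. length xs = Suc l \<and> xs ! 0 = x \<and> xs ! l = y \<and> nonbacktracking xs \<and> follows p xs}"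
  proof
    fix xs assume xs: "xs \<in> W"
    then have "xs \<noteq> []" by (auto simp: W_def)
    then show "xs \<in> {xs. length xs = Suc l \<and> xs ! 0 = x \<and> xs ! l = y \<and> nonbacktracking xs \<and> follows p xs}"
      using xs p[of xs] assms(2) by (auto simp: W_def hd_conv_nth)
  qed
  then show ?thesis using card_nb_follows[of l x y p] by (meson card_mono finite_subset order_trans)
qed

section \<open>New and stale steps\<close>

definition new_times :: "'a list \<Rightarrow> nat set" where
  "new_times xs = {t. Suc t < length xs \<and> edge_seq xs ! t \<notin> set (take t (edge_seq xs))}"

text \<open>Time \<open>t\<close> denotes the step from position \<open>t\<close> to position
  \<open>t + 1\<close>. The edges of fresh steps form a spanning tree of the visited vertices, and
  each step that is new but not fresh closes one more cycle.\<close>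

definition fresh_times :: "'a list \<Rightarrow> nat set" where
  "fresh_times xs = {t. Suc t < length xs \<and> xs ! Suc t \<notin> set (take (Suc t) xs)}"

lemma finite_new_times [simp]: "finite (new_times xs)"
  by (rule finite_subset[of _ "{..<length xs}"]) (auto simp: new_times_def)

lemma finite_fresh_times [simp]: "finite (fresh_times xs)"
  by (rule finite_subset[of _ "{..<length xs}"]) (auto simp: fresh_times_def)

lemma in_set_take_conv: "y \<in> set (take m xs) \<longleftrightarrow> (\<exists>i<m. i < length xs \<and> y = xs ! i)"
proof -
  have "y \<in> set (take m xs) \<longleftrightarrow> (\<exists>i<length (take m xs). take m xs ! i = y)" by (simp add: in_set_conv_nth)
  also have "\<dots> \<longleftrightarrow> (\<exists>i<m. i < length xs \<and> y = xs ! i)" by auto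
  finally show ?thesis .
qed

lemma stale_edgeE:
  assumes "Suc t < length xs" "t \<notin> new_times xs"
  obtains i where "i < t" "{xs ! t, xs ! Suc t} = {xs ! i, xs ! Suc i}"
proof -
  from assms have "edge_seq xs ! t \<in> set (take t (edge_seq xs))" by (auto simp: new_times_def)
  then obtain i where "i < t" "edge_seq xs ! t = edge_seq xs ! i" by (auto simp: in_set_take_conv)
  then show ?thesis using that[of i] assms by (simp add: edge_seq_nth)
qed

lemma stale_vertex:
  assumes "Suc t < length xs" "t \<notin> new_times xs"
  shows "xs ! Suc t \<in> set (take (Suc t) xs)"
proof -
  obtain i where i: "i < t" "{xs ! t, xs ! Suc t} = {xs ! i, xs ! Suc i}" using stale_edgeE[OF assms] by blast
  then have "xs ! Suc t = xs ! i \<or> xs ! Suc t = xs ! Suc i" by (auto simp: doubleton_eq_iff)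
  then show ?thesis
  proof
    assume "xs ! Suc t = xs ! i"
    then show ?thesis unfolding in_set_take_conv using i assms by (intro exI[of _ i]) auto
  next
    assume "xs ! Suc t = xs ! Suc i"
    then show ?thesis unfolding in_set_take_conv using i assms by (intro exI[of _ "Suc i"]) auto
  qed
qed

lemma fresh_subset_new: "fresh_times xs \<subseteq> new_times xs"
  using stale_vertex by (auto simp: fresh_times_def)

lemma inj_on_new_times: "inj_on ((!) (edge_seq xs)) (new_times xs)"
proof (rule linorder_inj_onI)
  fix s t assume "s < t" "s \<in> new_times xs" "t \<in> new_times xs"
  then have "edge_seq xs ! s \<in> set (take t (edge_seq xs))"
    unfolding in_set_take_conv by (auto simp: new_times_def)
  then show "edge_seq xs ! s \<noteq> edge_seq xs ! t" using \<open>t \<in> new_times xs\<close> by (auto simp: new_times_def)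
qed auto

lemma card_new_times: "card (new_times xs) \<le> card (set (edge_seq xs))"
proof -
  have "card (new_times xs) = card ((!) (edge_seq xs) ` new_times xs)"
    by (simp add: card_image[OF inj_on_new_times])
  also have "\<dots> \<le> card (set (edge_seq xs))"
    by (rule card_mono) (auto simp: new_times_def)
  finally show ?thesis .
qed

text \<open>The witness is a depth-first traversal of the tree formed by the fresh steps.\<close>

lemma spanning_walk:
  assumes "xs \<noteq> []"
  shows "\<exists>ys. ys \<noteq> [] \<and> set ys = set xs \<and> set (edge_seq ys) = (!) (edge_seq xs) ` fresh_times xs \<and>
    length ys = Suc (2 * card (fresh_times xs))"
  using assms
proof (induction xs rule: rev_nonempty_induct)
  case (single x)
  have "fresh_times [x] = {}" by (auto simp: fresh_times_def)
  then show ?case by (intro exI[of _ "[x]"]) auto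
next
  case (snoc y xs)
  then obtain ys where ys: "ys \<noteq> []" "set ys = set xs" "set (edge_seq ys) = (!) (edge_seq xs) ` fresh_times xs"
    "length ys = Suc (2 * card (fresh_times xs))" by blast
  define m where "m = length xs - 1"
  have m: "length xs = Suc m" using snoc by (simp add: m_def)
  have es: "edge_seq (xs @ [y]) = edge_seq xs @ [{last xs, y}]"
    using edge_seq_join[of xs "[last xs, y]"] snoc(1) by simp
  have fr: "fresh_times (xs @ [y]) = fresh_times xs \<union> (if y \<in> set xs then {} else {m})"
  proof (rule Set.set_eqI)
    fix t
    show "t \<in> fresh_times (xs @ [y]) \<longleftrightarrow> t \<in> fresh_times xs \<union> (if y \<in> set xs then {} else {m})"
    proof (cases "t < m")
      case True
      then show ?thesis using m by (auto simp: fresh_times_def nth_append)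
    next
      case False
      then show ?thesis using m by (cases "t = m") (auto simp: fresh_times_def nth_append)
    qed
  qed
  have img: "(!) (edge_seq (xs @ [y])) ` fresh_times xs = (!) (edge_seq xs) ` fresh_times xs"
    by (rule image_cong) (auto simp: fresh_times_def es nth_append)
  have mnot: "m \<notin> fresh_times xs" using m by (auto simp: fresh_times_def)
  show ?case
  proof (cases "y \<in> set xs")
    case True
    then show ?thesis using ys fr img by (intro exI[of _ ys]) auto
  next
    case False
    have "last xs \<in> set ys" using ys snoc by auto
    then obtain as bs where ab: "ys = as @ last xs # bs" by (meson split_list)
    let ?u = "last xs" let ?zs = "as @ ?u # y # ?u # bs"
    have "edge_seq ?zs = edge_seq (as @ [?u]) @ {?u, y} # {y, ?u} # edge_seq (?u # bs)"
      using edge_seq_append[of as ?u "y # ?u # bs"] by simp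
    then have "set (edge_seq ?zs) = insert {?u, y} (set (edge_seq ys))"
      using edge_seq_append[of as ?u bs] ab by (auto simp: insert_commute)
    moreover have "edge_seq (xs @ [y]) ! m = {?u, y}" using m by (simp add: es nth_append)
    ultimately have "set (edge_seq ?zs) = (!) (edge_seq (xs @ [y])) ` fresh_times (xs @ [y])"
      using ys(3) fr False img by simp
    moreover have "set ?zs = set (xs @ [y])" using ys(2) ab by auto
    moreover have "length ?zs = Suc (2 * card (fresh_times (xs @ [y])))"
      using ys(4) ab fr False mnot by simp
    ultimately show ?thesis by (intro exI[of _ ?zs]) simp
  qed
qed

text \<open>New edges that are not fresh have both ends on the tree of fresh edges and lie outside
  it, so \<open>x\<close> of them would be surplus over a traversal of that tree. The factor 2 is
  the traversal of each tree edge in both directions.\<close>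

lemma card_boundary_times:
  assumes ns: "\<not> surplus E L x" and "set (edge_seq xs) \<subseteq> E" "xs \<noteq> []" "2 * card (fresh_times xs) \<le> L"
  shows "card (new_times xs - fresh_times xs) < x"
proof (rule ccontr)
  assume "\<not> ?thesis"
  then obtain B where B: "B \<subseteq> new_times xs - fresh_times xs" "card B = x"
    by (meson linorder_not_less obtain_subset_with_card_n)
  obtain ys where ys: "ys \<noteq> []" "set ys = set xs" "set (edge_seq ys) = (!) (edge_seq xs) ` fresh_times xs"
    "length ys = Suc (2 * card (fresh_times xs))" using spanning_walk[OF assms(3)] by blast
  have nE: "edge_seq xs ! t \<in> set (edge_seq xs)" if "t \<in> new_times xs" for t
    using that by (auto simp: new_times_def)
  let ?F = "(!) (edge_seq xs) ` B"
  have finB: "finite B" using B finite_subset by (metis finite_Diff finite_new_times)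
  have "surplus E L x" unfolding surplus_def
  proof (intro exI[of _ ys] exI[of _ ?F] conjI)
    show "set (edge_seq ys) \<subseteq> E" 
      unfolding ys(3) using assms(2) nE fresh_subset_new[of xs] by blast
    have "?F \<inter> set (edge_seq ys) = {}"
      unfolding ys(3) using B(1) fresh_subset_new[of xs]
      by (subst inj_on_image_Int[OF inj_on_new_times, symmetric]) auto
    moreover have "?F \<subseteq> E" using B(1) nE assms(2) by blast
    ultimately show "?F \<subseteq> E - set (edge_seq ys)" by blast
    show "card ?F = x" using inj_on_subset[OF inj_on_new_times] B by (subst card_image) auto
    show "\<forall>e\<in>?F. e \<subseteq> set ys"
    proof
      fix e assume "e \<in> ?F"
      then have "e \<in> set (edge_seq xs)" using B(1) nE by blast
      then show "e \<subseteq> set ys" unfolding ys(2) by (rule edge_seq_subset)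
    qed
  qed (use ys assms finB in auto)
  with ns show False by simp
qed

text \<open>At a vertex just reached for the first time, the only old edge is the one used to reach
  it. Continuing on an old edge without backtracking is therefore possible only if the vertex had
  been visited before.\<close>

lemma new_to_stale_boundary:
  assumes "Suc (Suc t) < length xs" "t \<in> new_times xs" "Suc t \<notin> new_times xs" "xs ! t \<noteq> xs ! Suc (Suc t)"
  shows "t \<in> new_times xs - fresh_times xs"
proof -
  obtain i where i: "i < Suc t" "{xs ! Suc t, xs ! Suc (Suc t)} = {xs ! i, xs ! Suc i}"
    using stale_edgeE[OF assms(1,3)] by blast
  have "xs ! Suc t \<in> set (take (Suc t) xs)"
  proof (cases "i = t")
    case True
    then have "xs ! Suc t = xs ! t" using i assms(4) by (auto simp: doubleton_eq_iff)
    then show ?thesis unfolding in_set_take_conv using assms by (intro exI[of _ t]) auto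
  next
    case False
    from i(2) have "xs ! Suc t = xs ! i \<or> xs ! Suc t = xs ! Suc i" by (auto simp: doubleton_eq_iff)
    then show ?thesis
    proof
      assume "xs ! Suc t = xs ! i"
      then show ?thesis unfolding in_set_take_conv using i(1) assms(1) by (intro exI[of _ i]) auto
    next
      assume "xs ! Suc t = xs ! Suc i"
      then show ?thesis unfolding in_set_take_conv using i(1) False assms(1) by (intro exI[of _ "Suc i"]) auto
    qed
  qed
  then show ?thesis using assms by (auto simp: fresh_times_def)
qed

section \<open>Encoding a set of times by its alternations\<close>

definition changes :: "nat \<Rightarrow> nat set \<Rightarrow> nat set" where
  "changes N T = {t. Suc t < N \<and> (t \<in> T) \<noteq> (Suc t \<in> T)}"

lemma finite_less_Collect: "finite {t::nat. Suc t < N \<and> P t}"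
  by (rule finite_subset[of _ "{..<N}"]) auto

text \<open>Exits from \<open>T\<close> and entries into \<open>T\<close> alternate, and
  \<open>0 \<in> T\<close> makes an exit come first.\<close>

lemma card_ups_le_downs:
  assumes "0 \<in> T"
  shows "card {t. Suc t < Suc N \<and> t \<in> T \<and> Suc t \<notin> T}
    = card {t. Suc t < Suc N \<and> t \<notin> T \<and> Suc t \<in> T} + (if N \<in> T then 0 else 1)"
proof (induction N)
  case 0
  then show ?case using assms by simp
next
  case (Suc N)
  have s1: "{t. Suc t < Suc (Suc N) \<and> t \<in> T \<and> Suc t \<notin> T} =
      {t. Suc t < Suc N \<and> t \<in> T \<and> Suc t \<notin> T} \<union> (if N \<in> T \<and> Suc N \<notin> T then {N} else {})"
    by (auto simp: less_Suc_eq)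
  have s2: "{t. Suc t < Suc (Suc N) \<and> t \<notin> T \<and> Suc t \<in> T} =
      {t. Suc t < Suc N \<and> t \<notin> T \<and> Suc t \<in> T} \<union> (if N \<notin> T \<and> Suc N \<in> T then {N} else {})"
    by (auto simp: less_Suc_eq)
  have f: "finite {t. Suc t < Suc N \<and> t \<in> T \<and> Suc t \<notin> T}" "finite {t. Suc t < Suc N \<and> t \<notin> T \<and> Suc t \<in> T}"
    by (rule finite_less_Collect)+
  show ?case unfolding s1 s2 using Suc f by (auto split: if_splits)
qed

lemma card_changes_le:
  assumes "0 \<in> T"
  shows "card (changes N T) \<le> 2 * card {t. Suc t < N \<and> t \<in> T \<and> Suc t \<notin> T}"
proof (cases N)
  case (Suc M)
  have ch: "changes N T = {t. Suc t < N \<and> t \<in> T \<and> Suc t \<notin> T} \<union> {t. Suc t < N \<and> t \<notin> T \<and> Suc t \<in> T}"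
    by (auto simp: changes_def)
  have "card (changes N T) \<le> card {t. Suc t < N \<and> t \<in> T \<and> Suc t \<notin> T} + card {t. Suc t < N \<and> t \<notin> T \<and> Suc t \<in> T}"
    unfolding ch by (rule card_Un_le)
  then show ?thesis using card_ups_le_downs[OF assms, of M] Suc by (simp split: if_splits)
qed (simp add: changes_def)

text \<open>Membership is known at 0 and flips exactly at the changes. Sets with few changes are
  therefore few.\<close>

lemma changes_inj:
  assumes "0 \<in> S" "0 \<in> T" "S \<subseteq> {..<N}" "T \<subseteq> {..<N}" "changes N S = changes N T"
  shows "S = T"
proof -
  have "t \<in> S \<longleftrightarrow> t \<in> T" if "t < N" for t
    using that
  proof (induction t)
    case (Suc t)
    have "t \<in> changes N S \<longleftrightarrow> t \<in> changes N T" using assms(5) by simp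
    then show ?case using Suc by (auto simp: changes_def)
  qed (use assms in simp)
  then show ?thesis using assms(3,4) by blast
qed

lemma card_small_subsets:
  assumes "finite A"
  shows "finite {D. D \<subseteq> A \<and> card D \<le> c} \<and> card {D. D \<subseteq> A \<and> card D \<le> c} \<le> Suc (card A) ^ c"
proof -
  \<comment> \<open>Padding with \<open>None\<close> turns a subset of at most \<open>c\<close>
    elements into a list of length exactly \<open>c\<close>, which avoids a sum over the
    sizes.\<close>
  let ?L = "{xs. set xs \<subseteq> insert None (Some ` A) \<and> length xs = c}"
  have sub: "{D. D \<subseteq> A \<and> card D \<le> c} \<subseteq> (\<lambda>xs. {a. Some a \<in> set xs}) ` ?L"
  proof
    fix D assume D: "D \<in> {D. D \<subseteq> A \<and> card D \<le> c}"
    then have "finite D" using assms finite_subset by blast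
    then obtain l where l: "set l = D" "distinct l" using finite_distinct_list by blast
    then have "length l \<le> c" using D distinct_card by fastforce
    then have "map Some l @ replicate (c - length l) None \<in> ?L" using D l by auto
    moreover have "D = {a. Some a \<in> set (map Some l @ replicate (c - length l) None)}" using l by auto
    ultimately show "D \<in> (\<lambda>xs. {a. Some a \<in> set xs}) ` ?L" by blast
  qed
  have fL: "finite ?L" by (rule finite_lists_length_eq) (use assms in auto)
  have "card {D. D \<subseteq> A \<and> card D \<le> c} \<le> card ((\<lambda>xs. {a. Some a \<in> set xs}) ` ?L)"
    by (rule card_mono[OF _ sub]) (use fL in auto)
  also have "\<dots> \<le> card ?L" by (rule card_image_le[OF fL])
  also have "\<dots> = card (insert None (Some ` A)) ^ c" by (rule card_lists_length_eq) (use assms in auto)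
  also have "card (insert None (Some ` A)) = Suc (card A)" using assms by (simp add: card_image)
  finally have "card {D. D \<subseteq> A \<and> card D \<le> c} \<le> Suc (card A) ^ c" .
  moreover have "finite {D. D \<subseteq> A \<and> card D \<le> c}" by (rule finite_subset[OF sub]) (use fL in simp)
  ultimately show ?thesis by simp
qed

lemma card_le_fibres:
  assumes "finite S" "f ` S' \<subseteq> S" "\<And>y. y \<in> S \<Longrightarrow> finite {z \<in> S'. f z = y} \<and> card {z \<in> S'. f z = y} \<le> m"
  shows "finite S' \<and> card S' \<le> card S * m"
proof -
  have eq: "S' = (\<Union>y\<in>S. {z \<in> S'. f z = y})" using assms(2) by auto
  have "finite (\<Union>y\<in>S. {z \<in> S'. f z = y})" using assms by (intro finite_UN_I) auto
  moreover have "card (\<Union>y\<in>S. {z \<in> S'. f z = y}) \<le> (\<Sum>y\<in>S. card {z \<in> S'. f z = y})"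
    by (rule card_UN_le[OF assms(1)])
  moreover have "\<dots> \<le> (\<Sum>y\<in>S. m)" by (rule sum_mono) (use assms in auto)
  ultimately show ?thesis unfolding eq[symmetric] by simp
qed

section \<open>Counting hikes\<close>

text \<open>The bound on the number of edges is what remains of the condition that no edge is traversed
  exactly once; position \<open>k\<close> is the turning point.\<close>

definition hikes :: "nat set set \<Rightarrow> nat \<Rightarrow> nat \<Rightarrow> nat list set" where
  "hikes E n k = {xs. length xs = Suc (2 * k) \<and> hd xs < n \<and> set (edge_seq xs) \<subseteq> E \<and>
     (\<forall>i. Suc (Suc i) < length xs \<longrightarrow> Suc i \<noteq> k \<longrightarrow> xs ! i \<noteq> xs ! Suc (Suc i)) \<and>
     card (set (edge_seq xs)) \<le> k}"

lemma take_stale_const: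
  assumes "j < length xs" "b \<le> j" "\<And>i. b \<le> i \<Longrightarrow> i < j \<Longrightarrow> i \<notin> new_times xs"
  shows "set (take (Suc j) xs) = set (take (Suc b) xs)"
  using assms(2,1,3)
proof (induction j rule: dec_induct)
  case (step j)
  have "set (take (Suc (Suc j)) xs) = insert (xs ! Suc j) (set (take (Suc j) xs))"
    using step by (subst take_Suc_conv_app_nth) auto
  also have "\<dots> = set (take (Suc j) xs)" using stale_vertex[of j xs] step by (simp add: insert_absorb)
  also have "\<dots> = set (take (Suc b) xs)" using step by simp
  finally show ?case .
qed simp

text \<open>The product pays for a chunk of stale steps: at most \<open>2 * k + 1\<close> old
  vertices as its end and at most \<open>r + 1\<close> walks to that end. The summand
  \<open>Suc q\<close> lets the same constant pay for a new step at the start or at the turning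
  point, where no neighbour is excluded.\<close>

definition chunk_bound :: "nat \<Rightarrow> nat \<Rightarrow> nat \<Rightarrow> nat" where
  "chunk_bound k r q = Suc (2 * k) * Suc r + Suc q"

locale hike_count =
  fixes E :: "nat set set" and n k r q :: nat
  assumes nbr_fin: "\<And>x. finite (nbr E x)" and nbr_card: "\<And>x. card (nbr E x) \<le> Suc q"
    and tangle_free: "\<not> surplus E (10 * r) 2" and r_pos: "0 < r" and k_pos: "0 < k" and q_pos: "0 < q"
begin

definition hikes_at :: "nat set \<Rightarrow> nat \<Rightarrow> nat list set" where
  "hikes_at T t = take (Suc t) ` {xs \<in> hikes E n k. new_times xs = T}"

text \<open>From one break to the next, the steps are all new or all stale, there are at most \<open>r\<close> of them,
  and the turning point is not crossed.\<close>

definition breaks :: "nat set \<Rightarrow> nat set" where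
  "breaks T = {b. b < 2 * k \<and> (b = k \<or> r dvd b \<or> b \<in> Suc ` changes (2 * k) T)}"

abbreviation M :: nat where "M \<equiv> chunk_bound k r q"

lemma finite_breaks [simp]: "finite (breaks T)"
  by (rule finite_subset[of _ "{..<2 * k}"]) (auto simp: breaks_def)

lemma hikes_atE:
  assumes "zs \<in> hikes_at T t" "t \<le> 2 * k"
  obtains xs where "xs \<in> hikes E n k" "new_times xs = T" "zs = take (Suc t) xs" "length xs = Suc (2 * k)"
    "length zs = Suc t" "\<And>i. i \<le> t \<Longrightarrow> zs ! i = xs ! i"
proof -
  from assms obtain xs where xs: "xs \<in> hikes E n k" "new_times xs = T" "zs = take (Suc t) xs"
    by (auto simp: hikes_at_def)
  then show ?thesis using assms by (intro that[of xs]) (auto simp: hikes_def)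
qed

lemma hikes_at_0: "finite (hikes_at T 0) \<and> card (hikes_at T 0) \<le> n"
proof -
  have sub: "hikes_at T 0 \<subseteq> (\<lambda>a. [a]) ` {..<n}"
  proof
    fix zs assume "zs \<in> hikes_at T 0"
    then obtain xs where xs: "xs \<in> hikes E n k" "zs = take (Suc 0) xs" by (auto simp: hikes_at_def)
    then have "zs = [hd xs]" "hd xs < n" by (cases xs; auto simp: hikes_def)+
    then show "zs \<in> (\<lambda>a. [a]) ` {..<n}" by auto
  qed
  have "card (hikes_at T 0) \<le> card ((\<lambda>a. [a]) ` {..<n})" by (rule card_mono[OF _ sub]) simp
  also have "\<dots> \<le> card {..<n}" by (rule card_image_le) simp
  finally show ?thesis using finite_subset[OF sub] by auto
qed

lemma hikes_at_take:
  assumes "b \<le> t"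
  shows "take (Suc b) ` hikes_at T t \<subseteq> hikes_at T b"
  using assms by (auto simp: hikes_at_def min_def)

text \<open>Not backtracking excludes one of the at most \<open>q + 1\<close> neighbours. Nothing is
  excluded at time 0, which has no predecessor, and at time \<open>k\<close>, where hikes may turn
  back.\<close>

lemma hikes_at_step:
  assumes t: "t < 2 * k" and fin: "finite (hikes_at T t)"
  shows "finite (hikes_at T (Suc t)) \<and>
    card (hikes_at T (Suc t)) \<le> card (hikes_at T t) * (if t = 0 \<or> t = k then Suc q else q)"
proof (rule card_le_fibres[OF fin, of "take (Suc t)"])
  show "take (Suc t) ` hikes_at T (Suc t) \<subseteq> hikes_at T t" by (rule hikes_at_take) simp
  fix ys assume ys: "ys \<in> hikes_at T t"
  let ?F = "{z \<in> hikes_at T (Suc t). take (Suc t) z = ys}"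
  let ?N = "nbr E (ys ! t) - (if t = 0 \<or> t = k then {} else {ys ! (t - 1)})"
  obtain ws where ws: "ws \<in> hikes E n k" "length ws = Suc (2 * k)" "length ys = Suc t" "\<And>i. i \<le> t \<Longrightarrow> ys ! i = ws ! i"
    using hikes_atE[OF ys] t by (metis less_imp_le)
  have sub: "?F \<subseteq> (\<lambda>y. ys @ [y]) ` ?N"
  proof
    fix zs assume "zs \<in> ?F"
    then have zs: "zs \<in> hikes_at T (Suc t)" "take (Suc t) zs = ys" by auto
    have "Suc t \<le> 2 * k" using t by simp
    from hikes_atE[OF zs(1) this] obtain xs where xs: "xs \<in> hikes E n k" "length xs = Suc (2 * k)"
      "length zs = Suc (Suc t)" "\<And>i. i \<le> Suc t \<Longrightarrow> zs ! i = xs ! i" by metis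
    have eq: "zs = ys @ [zs ! Suc t]" using zs(2) xs(3) take_Suc_conv_app_nth[of "Suc t" zs] by simp
    have yx: "ys ! i = xs ! i" if "i \<le> t" for i
      using that zs(2) xs(4)[of i] by (metis le_SucI le_imp_less_Suc nth_take)
    have "{xs ! t, xs ! Suc t} \<in> set (edge_seq xs)" unfolding set_edge_seq using t xs(2) by auto
    then have "{xs ! t, xs ! Suc t} \<in> E" using xs(1) by (auto simp: hikes_def)
    then have "zs ! Suc t \<in> nbr E (ys ! t)" using yx[of t] xs(4)[of "Suc t"] by (simp add: nbr_def)
    moreover have "zs ! Suc t \<noteq> ys ! (t - 1)" if "t \<noteq> 0" "t \<noteq> k"
    proof -
      from that obtain s where s: "t = Suc s" by (cases t) auto
      then have "xs ! s \<noteq> xs ! Suc (Suc s)" using xs(1,2) that t by (auto simp: hikes_def)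
      then show ?thesis using s yx[of s] xs(4)[of "Suc t"] by auto
    qed
    ultimately have "zs ! Suc t \<in> ?N" by auto
    then show "zs \<in> (\<lambda>y. ys @ [y]) ` ?N" using eq by blast
  qed
  have cN: "card ?N \<le> (if t = 0 \<or> t = k then Suc q else q)"
  proof (cases "t = 0 \<or> t = k")
    case False
    then obtain s where s: "t = Suc s" by (cases t) auto
    have "{ws ! s, ws ! Suc s} \<in> set (edge_seq ws)" unfolding set_edge_seq using t ws(2) s by auto
    then have "{ws ! s, ws ! Suc s} \<in> E" using ws(1) by (auto simp: hikes_def)
    then have "ys ! (t - 1) \<in> nbr E (ys ! t)" using ws(4)[of s] ws(4)[of t] s by (simp add: nbr_def insert_commute)
    then have "card (nbr E (ys ! t) - {ys ! (t - 1)}) \<le> q"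
      using nbr_card[of "ys ! t"] nbr_fin by (simp add: card_Diff_singleton)
    then show ?thesis using False by simp
  qed (use nbr_card in auto)
  have finN: "finite ?N" using nbr_fin by auto
  have "card ?F \<le> card ((\<lambda>y. ys @ [y]) ` ?N)" by (rule card_mono[OF _ sub]) (use finN in simp)
  also have "\<dots> \<le> card ?N" by (rule card_image_le[OF finN])
  finally show "finite ?F \<and> card ?F \<le> (if t = 0 \<or> t = k then Suc q else q)"
    using cN finite_subset[OF sub] finN by auto
qed

text \<open>Stale steps visit no new vertex, so the chunk ends at a vertex of the prefix. The chunk
  is non-backtracking, as it does not cross the turning point, and has at most \<open>r\<close>
  steps, so \<open>tangle_free\<close> leaves at most \<open>r + 1\<close> walks between its
  ends.\<close>

lemma hikes_at_chunk:
  assumes t: "b \<le> t" "t < 2 * k" and stale: "\<And>i. b \<le> i \<Longrightarrow> i \<le> t \<Longrightarrow> i \<notin> T"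
    and turn: "\<And>i. b < i \<Longrightarrow> i \<le> t \<Longrightarrow> i \<noteq> k" and short: "Suc t - b \<le> r" and fin: "finite (hikes_at T b)"
  shows "finite (hikes_at T (Suc t)) \<and> card (hikes_at T (Suc t)) \<le> card (hikes_at T b) * M"
proof (rule card_le_fibres[OF fin, of "take (Suc b)"])
  show "take (Suc b) ` hikes_at T (Suc t) \<subseteq> hikes_at T b" by (rule hikes_at_take) (use t in simp)
  fix ys assume ys: "ys \<in> hikes_at T b"
  let ?F = "{z \<in> hikes_at T (Suc t). take (Suc b) z = ys}"
  define l where "l = Suc t - b"
  let ?W = "\<lambda>y. {xs. length xs = Suc l \<and> xs ! 0 = ys ! b \<and> xs ! l = y \<and> nonbacktracking xs \<and> set (edge_seq xs) \<subseteq> E}"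
  have lr: "l \<le> r" using short by (simp add: l_def)
  note W = card_nb_walks_le[OF tangle_free lr]
  have ly: "length ys = Suc b" using hikes_atE[OF ys] t by (metis less_imp_le order_trans)
  have sub: "?F \<subseteq> (\<Union>y\<in>set ys. (\<lambda>w. take b ys @ w) ` ?W y)"
  proof
    fix zs assume "zs \<in> ?F"
    then have zs: "zs \<in> hikes_at T (Suc t)" "take (Suc b) zs = ys" by auto
    have "Suc t \<le> 2 * k" using t by simp
    from hikes_atE[OF zs(1) this] obtain xs where xs: "xs \<in> hikes E n k" "new_times xs = T" "zs = take (Suc (Suc t)) xs"
      "length xs = Suc (2 * k)" "length zs = Suc (Suc t)" "\<And>i. i \<le> Suc t \<Longrightarrow> zs ! i = xs ! i" by metis
    have yx: "ys = take (Suc b) xs" using zs(2) xs(3) t by (simp add: min_def)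
    let ?w = "drop b zs"
    have "zs ! Suc t \<in> set (take (Suc (Suc t)) xs)"
      using xs(6)[of "Suc t"] xs(4) t by (subst in_set_take_conv) auto
    also have "set (take (Suc (Suc t)) xs) = set ys"
      unfolding yx by (rule take_stale_const) (use t xs stale in auto)
    finally have end_in: "zs ! Suc t \<in> set ys" .
    have "take b ys = take b zs" using zs(2) by (metis min.absorb1 le_SucI order_refl take_take)
    then have eq: "zs = take b ys @ ?w" by simp
    have wn: "?w ! i = xs ! (b + i)" if "i \<le> l" for i
      using that xs(5) xs(6)[of "b + i"] t by (simp add: l_def)
    have lw: "length ?w = Suc l" using xs(5) t by (simp add: l_def)
    have ys_b: "ys ! b = xs ! b" unfolding yx by simp
    have "?w ! 0 = ys ! b" using wn[of 0] ys_b by simp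
    moreover have "?w ! l = zs ! Suc t" using wn[of l] xs(6)[of "Suc t"] t by (simp add: l_def)
    moreover have "nonbacktracking ?w" unfolding nonbacktracking_def
    proof (intro allI impI)
      fix i assume i: "Suc (Suc i) < length ?w"
      then have il: "Suc (Suc i) \<le> l" using lw by simp
      have "Suc (b + i) \<noteq> k" using turn[of "Suc (b + i)"] il by (simp add: l_def)
      moreover have "Suc (Suc (b + i)) < length xs" using il t xs(4) by (simp add: l_def)
      ultimately have "xs ! (b + i) \<noteq> xs ! Suc (Suc (b + i))" using xs(1) by (simp add: hikes_def)
      then show "?w ! i \<noteq> ?w ! Suc (Suc i)" using wn[of i] wn[of "Suc (Suc i)"] il by simp
    qed
    moreover have "set (edge_seq ?w) \<subseteq> E"
    proof
      fix e assume "e \<in> set (edge_seq ?w)"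
      then obtain i where i: "Suc i < length ?w" "e = {?w ! i, ?w ! Suc i}" unfolding set_edge_seq by blast
      then have il: "Suc i \<le> l" using lw by simp
      then have e: "e = {xs ! (b + i), xs ! Suc (b + i)}" using i(2) wn[of i] wn[of "Suc i"] by simp
      have "Suc (b + i) < length xs" using il t xs(4) by (simp add: l_def)
      then have "e \<in> set (edge_seq xs)" unfolding set_edge_seq e by blast
      then show "e \<in> E" using xs(1) by (auto simp: hikes_def)
    qed
    ultimately have "?w \<in> ?W (zs ! Suc t)" using lw by simp
    then have "zs \<in> (\<lambda>w. take b ys @ w) ` ?W (zs ! Suc t)" using eq by (metis (no_types, lifting) image_eqI)
    then show "zs \<in> (\<Union>y\<in>set ys. (\<lambda>w. take b ys @ w) ` ?W y)" using end_in by blast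
  qed
  have finU: "finite (\<Union>y\<in>set ys. (\<lambda>w. take b ys @ w) ` ?W y)"
    by (intro finite_UN_I finite_set finite_imageI conjunct1[OF W])
  have "card ?F \<le> card (\<Union>y\<in>set ys. (\<lambda>w. take b ys @ w) ` ?W y)" by (rule card_mono[OF finU sub])
  also have "\<dots> \<le> (\<Sum>y\<in>set ys. card ((\<lambda>w. take b ys @ w) ` ?W y))" by (rule card_UN_le) simp
  also have "\<dots> \<le> (\<Sum>y\<in>set ys. Suc r)"
  proof (rule sum_mono)
    fix y
    have "card ((\<lambda>w. take b ys @ w) ` ?W y) \<le> card (?W y)" by (rule card_image_le) (rule conjunct1[OF W])
    also have "\<dots> \<le> Suc l" by (rule conjunct2[OF W])
    also have "\<dots> \<le> Suc r" using lr by simp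
    finally show "card ((\<lambda>w. take b ys @ w) ` ?W y) \<le> Suc r" .
  qed
  also have "\<dots> = card (set ys) * Suc r" by simp
  also have "\<dots> \<le> Suc (2 * k) * Suc r"
    using card_length[of ys] ly t by (intro mult_right_mono) auto
  also have "\<dots> \<le> M" by (simp add: chunk_bound_def)
  finally show "finite ?F \<and> card ?F \<le> M" using finite_subset[OF sub finU] by simp
qed

text \<open>A new step away from the start and the turning point costs \<open>q\<close>; a new step
  at one of those two times costs \<open>M\<close>, charged to that break. For a stale step the
  estimate goes back to the beginning of its chunk rather than by one step, so that a whole chunk
  costs \<open>M\<close> once, charged to the break where it begins.\<close>

lemma card_hikes_at:
  assumes "t \<le> 2 * k"
  shows "finite (hikes_at T t) \<and>
    card (hikes_at T t) \<le> n * q ^ card (T \<inter> {..<t}) * M ^ card (breaks T \<inter> {..<t})"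
  using assms
proof (induction t rule: less_induct)
  case (less t)
  show ?case
  proof (cases t)
    case 0
    then show ?thesis using hikes_at_0 by simp
  next
    case (Suc s)
    have s: "s < 2 * k" using less.prems Suc by simp
    have IH: "finite (hikes_at T b)" "card (hikes_at T b) \<le> n * q ^ card (T \<inter> {..<b}) * M ^ card (breaks T \<inter> {..<b})"
      if "b \<le> s" for b using less.IH[of b] that s Suc by auto
    have M1: "1 \<le> M" "Suc q \<le> M" by (auto simp: chunk_bound_def)
    have step: "M * M ^ card (breaks T \<inter> {..<b}) \<le> M ^ card (breaks T \<inter> {..<Suc s})"
      if "b \<le> s" "b \<in> breaks T" for b
    proof -
      have "insert b (breaks T \<inter> {..<b}) \<subseteq> breaks T \<inter> {..<Suc s}" using that by auto
      then have "card (insert b (breaks T \<inter> {..<b})) \<le> card (breaks T \<inter> {..<Suc s})" by (intro card_mono) auto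
      then have "Suc (card (breaks T \<inter> {..<b})) \<le> card (breaks T \<inter> {..<Suc s})" by simp
      then have "M ^ Suc (card (breaks T \<inter> {..<b})) \<le> M ^ card (breaks T \<inter> {..<Suc s})"
        using M1 by (intro power_increasing) auto
      then show ?thesis by simp
    qed
    have monoM: "M ^ card (breaks T \<inter> {..<s}) \<le> M ^ card (breaks T \<inter> {..<Suc s})"
      using M1 by (intro power_increasing card_mono) auto
    consider (br) "s \<in> T" "s = 0 \<or> s = k" | (new) "s \<in> T" "s \<noteq> 0" "s \<noteq> k" | (stale) "s \<notin> T" by blast
    then show ?thesis
    proof cases
      case br
      have sb: "s \<in> breaks T" using br s by (auto simp: breaks_def)
      have Tc: "card (T \<inter> {..<s}) \<le> card (T \<inter> {..<Suc s})" by (intro card_mono) auto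
      have qle: "q ^ card (T \<inter> {..<s}) \<le> q ^ card (T \<inter> {..<Suc s})"
        using Tc q_pos by (intro power_increasing) auto
      have "card (hikes_at T (Suc s)) \<le> card (hikes_at T s) * Suc q"
        using hikes_at_step[OF s IH(1)[of s]] br by simp
      also have "\<dots> \<le> (n * q ^ card (T \<inter> {..<s}) * M ^ card (breaks T \<inter> {..<s})) * M"
        by (rule mult_mono[OF IH(2)[of s] M1(2)]) auto
      also have "\<dots> = (n * q ^ card (T \<inter> {..<s})) * (M * M ^ card (breaks T \<inter> {..<s}))" by simp
      also have "\<dots> \<le> (n * q ^ card (T \<inter> {..<Suc s})) * M ^ card (breaks T \<inter> {..<Suc s})"
        by (intro mult_mono mult_left_mono qle step[OF _ sb]) auto
      finally show ?thesis using hikes_at_step[OF s IH(1)[of s]] Suc by simp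
    next
      case new
      have "card (hikes_at T (Suc s)) \<le> card (hikes_at T s) * q"
        using hikes_at_step[OF s IH(1)[of s]] new by simp
      also have "\<dots> \<le> n * q ^ card (T \<inter> {..<s}) * M ^ card (breaks T \<inter> {..<s}) * q"
        using IH(2)[of s] by simp
      also have "\<dots> = n * q ^ Suc (card (T \<inter> {..<s})) * M ^ card (breaks T \<inter> {..<s})" by simp
      also have "\<dots> \<le> n * q ^ Suc (card (T \<inter> {..<s})) * M ^ card (breaks T \<inter> {..<Suc s})"
        using monoM by (rule mult_left_mono) simp
      also have "Suc (card (T \<inter> {..<s})) = card (T \<inter> {..<Suc s})"
        using new(1) by (simp add: lessThan_Suc)
      finally show ?thesis using hikes_at_step[OF s IH(1)[of s]] Suc by simp
    next
      case stale
      \<comment> \<open>The start of the chunk containing time \<open>s\<close>. Inserting 0 only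
        ensures that the maximum exists; 0 is a break anyway, since \<open>r dvd 0\<close>.\<close>
      define b where "b = Max {b \<in> insert 0 (breaks T). b \<le> s}"
      have fin: "finite {b \<in> insert 0 (breaks T). b \<le> s}" and ne: "0 \<in> {b \<in> insert 0 (breaks T). b \<le> s}" by auto
      have "b \<in> {b \<in> insert 0 (breaks T). b \<le> s}" unfolding b_def using fin ne by (intro Max_in) auto
      then have bs: "b \<le> s" "b \<in> insert 0 (breaks T)" by auto
      have bb: "b \<in> breaks T" using bs k_pos by (auto simp: breaks_def)
      have nobreak: "i \<notin> breaks T" if "b < i" "i \<le> s" for i
        using Max_ge[OF fin, of i] that unfolding b_def[symmetric] by auto
      \<comment> \<open>Changes are breaks, so staleness at \<open>s\<close> propagates back to
        \<open>b\<close>.\<close>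
      have st: "i \<notin> T" if "b \<le> i" "i \<le> s" for i
        using that(2,1)
      proof (induction i rule: inc_induct)
        case base
        then show ?case using stale by simp
      next
        case (step i)
        have "Suc i \<notin> breaks T" using nobreak[of "Suc i"] step by simp
        then have "i \<notin> changes (2 * k) T" using step s by (auto simp: breaks_def)
        then show ?case using step s by (auto simp: changes_def)
      qed
      have short: "Suc s - b \<le> r"
      proof (rule ccontr)
        assume "\<not> ?thesis"
        then have "b + r \<le> s" by simp
        \<comment> \<open>The last multiple of \<open>r\<close> up to \<open>s\<close> would be a
          break after \<open>b\<close>.\<close>
        define c where "c = r * (s div r)"
        have "c + s mod r = s" unfolding c_def by simp
        then have "c \<le> s" "s < c + r" using mod_less_divisor[OF r_pos, of s] by linarith+
        have "r dvd c" by (simp add: c_def)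
        then have "c \<in> breaks T" using s \<open>c \<le> s\<close> by (auto simp: breaks_def)
        then show False using nobreak[of c] \<open>c \<le> s\<close> \<open>s < c + r\<close> \<open>b + r \<le> s\<close> by simp
      qed
      have turn: "i \<noteq> k" if "b < i" "i \<le> s" for i
        using nobreak[OF that] that s by (auto simp: breaks_def)
      note ch = hikes_at_chunk[OF bs(1) s st turn short IH(1)[OF bs(1)]]
      have "x < b" if "x \<in> T" "x < Suc s" for x using st[of x] that by (cases "b \<le> x") auto
      then have Teq: "T \<inter> {..<Suc s} = T \<inter> {..<b}" using bs(1) by auto
      have "card (hikes_at T (Suc s)) \<le> card (hikes_at T b) * M" using ch by blast
      also have "\<dots> \<le> n * q ^ card (T \<inter> {..<b}) * M ^ card (breaks T \<inter> {..<b}) * M"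
        using IH(2)[OF bs(1)] by simp
      also have "\<dots> = n * q ^ card (T \<inter> {..<b}) * (M * M ^ card (breaks T \<inter> {..<b}))" by simp
      also have "\<dots> \<le> n * q ^ card (T \<inter> {..<b}) * M ^ card (breaks T \<inter> {..<Suc s})"
        using step[OF bs(1) bb] by (rule mult_left_mono) simp
      finally show ?thesis using ch Suc Teq by simp
    qed
  qed
qed

lemma card_breaks: "card (breaks T) \<le> 2 * k div r + 2 + card (changes (2 * k) T)"
proof -
  have fc: "finite (changes (2 * k) T)" by (rule finite_subset[of _ "{..<2 * k}"]) (auto simp: changes_def)
  have sub: "breaks T \<subseteq> insert k ((*) r ` {..2 * k div r}) \<union> Suc ` changes (2 * k) T"
  proof
    fix b assume b: "b \<in> breaks T"
    show "b \<in> insert k ((*) r ` {..2 * k div r}) \<union> Suc ` changes (2 * k) T"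
    proof (cases "r dvd b")
      case True
      then obtain m where m: "b = r * m" by auto
      then have "m = b div r" using r_pos by simp
      also have "\<dots> \<le> 2 * k div r" using b by (intro div_le_mono) (auto simp: breaks_def)
      finally show ?thesis using m by auto
    qed (use b in \<open>auto simp: breaks_def\<close>)
  qed
  have "card (breaks T) \<le> card (insert k ((*) r ` {..2 * k div r}) \<union> Suc ` changes (2 * k) T)"
    by (rule card_mono[OF _ sub]) (use fc in simp)
  also have "\<dots> \<le> card (insert k ((*) r ` {..2 * k div r})) + card (Suc ` changes (2 * k) T)" by (rule card_Un_le)
  also have "\<dots> \<le> Suc (card ((*) r ` {..2 * k div r})) + card (changes (2 * k) T)"
    by (intro add_mono card_insert_le_m1 card_image_le fc) (auto simp: card_insert_if)
  also have "card ((*) r ` {..2 * k div r}) \<le> card {..2 * k div r}" by (rule card_image_le) simp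
  finally show ?thesis by simp
qed

text \<open>A hike leaves the new edges only after a step that is new but not fresh, or at the
  turning point. There are fewer than \<open>x\<close> times of the first kind and one of the
  second, hence at most \<open>x\<close> exits and at most \<open>2 * x\<close> changes. The surplus
  is measured at scale \<open>2 * k\<close> because a hike has at most \<open>k\<close> distinct
  edges.\<close>

lemma card_changes_hike:
  assumes xs: "xs \<in> hikes E n k" and ns: "\<not> surplus E (2 * k) x"
  shows "card (changes (2 * k) (new_times xs)) \<le> 2 * x" and "0 \<in> new_times xs"
    and "new_times xs \<subseteq> {..<2 * k}" and "card (new_times xs) \<le> k"
proof -
  have len: "length xs = Suc (2 * k)" and E: "set (edge_seq xs) \<subseteq> E" and c: "card (set (edge_seq xs)) \<le> k"
    and nonbacktracking: "\<And>i. Suc (Suc i) < length xs \<Longrightarrow> Suc i \<noteq> k \<Longrightarrow> xs ! i \<noteq> xs ! Suc (Suc i)"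
    using xs by (auto simp: hikes_def)
  show z: "0 \<in> new_times xs" using len k_pos by (simp add: new_times_def)
  show "new_times xs \<subseteq> {..<2 * k}" using len by (auto simp: new_times_def)
  show ck: "card (new_times xs) \<le> k" using card_new_times c order_trans by blast
  have "card (fresh_times xs) \<le> card (new_times xs)" by (rule card_mono) (auto intro: fresh_subset_new[THEN subsetD])
  then have bd: "card (new_times xs - fresh_times xs) < x"
    using ck len by (intro card_boundary_times[OF ns E]) auto
  have "{t. Suc t < 2 * k \<and> t \<in> new_times xs \<and> Suc t \<notin> new_times xs} \<subseteq> insert (k - 1) (new_times xs - fresh_times xs)"
  proof
    fix t assume t: "t \<in> {t. Suc t < 2 * k \<and> t \<in> new_times xs \<and> Suc t \<notin> new_times xs}"
    show "t \<in> insert (k - 1) (new_times xs - fresh_times xs)"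
    proof (cases "Suc t = k")
      case False
      then have "t \<in> new_times xs - fresh_times xs"
        using new_to_stale_boundary[of t xs] t len nonbacktracking[of t] by simp
      then show ?thesis by blast
    qed auto
  qed
  then have "card {t. Suc t < 2 * k \<and> t \<in> new_times xs \<and> Suc t \<notin> new_times xs}
      \<le> card (insert (k - 1) (new_times xs - fresh_times xs))" by (intro card_mono) auto
  also have "\<dots> \<le> x" using bd by (simp add: card_insert_if)
  finally show "card (changes (2 * k) (new_times xs)) \<le> 2 * x" using card_changes_le[OF z, of "2 * k"] by simp
qed

text \<open>The set of new times is encoded by its at most \<open>2 * x\<close> changes, which gives
  the first factor. It has at most \<open>k\<close> elements, and so the steps along new edges
  contribute at most \<open>q ^ k\<close>.\<close>

lemma card_hikes:
  assumes ns: "\<not> surplus E (2 * k) x"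
  shows "finite (hikes E n k) \<and>
    card (hikes E n k) \<le> Suc (2 * k) ^ (2 * x) * (n * q ^ k * M ^ (2 * k div r + 2 + 2 * x))"
proof (rule conjI)
  define TS where "TS = {T. 0 \<in> T \<and> T \<subseteq> {..<2 * k} \<and> card T \<le> k \<and> card (changes (2 * k) T) \<le> 2 * x}"
  have finTS: "finite TS" by (rule finite_subset[of _ "Pow {..<2 * k}"]) (auto simp: TS_def)
  have sub: "hikes E n k \<subseteq> (\<Union>T\<in>TS. hikes_at T (2 * k))"
  proof
    fix xs assume xs: "xs \<in> hikes E n k"
    then have "take (Suc (2 * k)) xs = xs" by (simp add: hikes_def)
    then have "xs \<in> hikes_at (new_times xs) (2 * k)" using xs unfolding hikes_at_def by force
    moreover have "new_times xs \<in> TS" using card_changes_hike[OF xs ns] by (simp add: TS_def)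
    ultimately show "xs \<in> (\<Union>T\<in>TS. hikes_at T (2 * k))" by blast
  qed
  note H = card_hikes_at[OF order_refl]
  have fU: "finite (\<Union>T\<in>TS. hikes_at T (2 * k))" using finTS H by blast
  then show "finite (hikes E n k)" by (rule finite_subset[OF sub])
  have "card TS \<le> Suc (2 * k) ^ (2 * x)"
  proof -
    let ?D = "{D. D \<subseteq> {..<2 * k} \<and> card D \<le> 2 * x}"
    note D = card_small_subsets[of "{..<2 * k}" "2 * x"]
    have "card TS \<le> card ?D"
    proof (rule card_inj_on_le[of "changes (2 * k)"])
      show "inj_on (changes (2 * k)) TS"
        by (rule inj_onI) (rule changes_inj[of _ _ "2 * k"], auto simp: TS_def)
      show "changes (2 * k) ` TS \<subseteq> ?D" by (auto simp: TS_def changes_def)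
      show "finite ?D" using D by simp
    qed
    also have "\<dots> \<le> Suc (2 * k) ^ (2 * x)" using D by simp
    finally show ?thesis .
  qed
  note cTS = this
  have cT: "card (hikes_at T (2 * k)) \<le> n * q ^ k * M ^ (2 * k div r + 2 + 2 * x)" if T: "T \<in> TS" for T
  proof -
    have "T \<inter> {..<2 * k} = T" "card T \<le> k" using T by (auto simp: TS_def)
    then have "q ^ card (T \<inter> {..<2 * k}) \<le> q ^ k" using q_pos by (intro power_increasing) auto
    moreover have "card (breaks T \<inter> {..<2 * k}) \<le> 2 * k div r + 2 + 2 * x"
    proof -
      have "card (breaks T \<inter> {..<2 * k}) \<le> card (breaks T)" by (intro card_mono) auto
      also have "\<dots> \<le> 2 * k div r + 2 + card (changes (2 * k) T)" by (rule card_breaks)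
      also have "\<dots> \<le> 2 * k div r + 2 + 2 * x" using T by (simp add: TS_def)
      finally show ?thesis .
    qed
    then have "M ^ card (breaks T \<inter> {..<2 * k}) \<le> M ^ (2 * k div r + 2 + 2 * x)"
      by (intro power_increasing) (auto simp: chunk_bound_def)
    ultimately have "n * q ^ card (T \<inter> {..<2 * k}) * M ^ card (breaks T \<inter> {..<2 * k})
        \<le> n * q ^ k * M ^ (2 * k div r + 2 + 2 * x)" by (intro mult_mono mult_left_mono) auto
    then show ?thesis using H[of T] by (meson order_trans)
  qed
  have "card (hikes E n k) \<le> card (\<Union>T\<in>TS. hikes_at T (2 * k))" by (rule card_mono[OF fU sub])
  also have "\<dots> \<le> (\<Sum>T\<in>TS. card (hikes_at T (2 * k)))" by (rule card_UN_le[OF finTS])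
  also have "\<dots> \<le> (\<Sum>T\<in>TS. n * q ^ k * M ^ (2 * k div r + 2 + 2 * x))" by (rule sum_mono) (rule cT)
  also have "\<dots> = card TS * (n * q ^ k * M ^ (2 * k div r + 2 + 2 * x))" by simp
  also have "\<dots> \<le> Suc (2 * k) ^ (2 * x) * (n * q ^ k * M ^ (2 * k div r + 2 + 2 * x))"
    by (rule mult_right_mono[OF cTS]) simp
  finally show "card (hikes E n k) \<le> Suc (2 * k) ^ (2 * x) * (n * q ^ k * M ^ (2 * k div r + 2 + 2 * x))" .
qed

end

section \<open>Signed sums over non-backtracking walks\<close>

definition nb_walks :: "nat set set \<Rightarrow> nat \<Rightarrow> nat \<Rightarrow> nat list set" where
  "nb_walks E k u = {xs \<in> walks E k u. nonbacktracking xs}"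

definition walk_sign :: "('a set \<Rightarrow> int) \<Rightarrow> 'a list \<Rightarrow> int" where
  "walk_sign w xs = prod_list (map w (edge_seq xs))"

lemma nonbacktracking_Cons: "nonbacktracking (x # xs) \<longleftrightarrow> (2 \<le> length xs \<longrightarrow> x \<noteq> xs ! 1) \<and> nonbacktracking xs"
proof
  assume L: "nonbacktracking (x # xs)"
  have "x \<noteq> xs ! 1" if "2 \<le> length xs" using L that unfolding nonbacktracking_def by (auto dest!: spec[of _ 0])
  moreover have "nonbacktracking xs" unfolding nonbacktracking_def
  proof (intro allI impI)
    fix i assume "Suc (Suc i) < length xs"
    then show "xs ! i \<noteq> xs ! Suc (Suc i)" using L unfolding nonbacktracking_def by (auto dest!: spec[of _ "Suc i"])
  qed
  ultimately show "(2 \<le> length xs \<longrightarrow> x \<noteq> xs ! 1) \<and> nonbacktracking xs" by blast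
next
  assume R: "(2 \<le> length xs \<longrightarrow> x \<noteq> xs ! 1) \<and> nonbacktracking xs"
  show "nonbacktracking (x # xs)" unfolding nonbacktracking_def
  proof (intro allI impI)
    fix i assume "Suc (Suc i) < length (x # xs)"
    then show "(x # xs) ! i \<noteq> (x # xs) ! Suc (Suc i)" using R by (cases i) (auto simp: nonbacktracking_def)
  qed
qed

lemma nb_walks_0: "nb_walks E 0 u = {[u]}"
  by (auto simp: nb_walks_def walks_0 nonbacktracking_def)

lemma nb_walksD:
  assumes "xs \<in> nb_walks E k u"
  shows "length xs = Suc k" "xs ! 0 = u" "hd xs = u" "xs \<noteq> []" "set (edge_seq xs) \<subseteq> E" "nonbacktracking xs"
  using assms by (cases xs; auto simp: nb_walks_def walks_def)+

text \<open>The guard \<open>0 < k\<close> is there because a walk with no steps has no second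
  vertex to compare with \<open>u\<close>.\<close>

lemma nb_walks_Suc:
  "nb_walks E (Suc k) u = (\<lambda>(y, ys). u # ys) ` {(y, ys). y \<in> nbr E u \<and> ys \<in> nb_walks E k y \<and> (0 < k \<longrightarrow> ys ! 1 \<noteq> u)}"
  (is "?L = ?f ` ?P")
proof (intro equalityI subsetI)
  fix xs assume "xs \<in> ?L"
  then obtain y ys where *: "y \<in> nbr E u" "ys \<in> walks E k y" "xs = u # ys" "nonbacktracking xs"
    by (auto simp: nb_walks_def walks_Suc)
  then have "(y, ys) \<in> ?P" by (auto simp: nb_walks_def nonbacktracking_Cons walks_def)
  then show "xs \<in> ?f ` ?P" using * by (intro image_eqI[of _ _ "(y, ys)"]) auto
next
  fix xs assume "xs \<in> ?f ` ?P"
  then obtain y ys where *: "y \<in> nbr E u" "ys \<in> nb_walks E k y" "0 < k \<longrightarrow> ys ! 1 \<noteq> u" "xs = u # ys" by auto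
  then have "nonbacktracking xs" using nb_walksD[OF *(2)] by (auto simp: nonbacktracking_Cons)
  then show "xs \<in> ?L" using * by (auto simp: nb_walks_def walks_Suc)
qed

lemma walk_sign_Cons: "ys \<noteq> [] \<Longrightarrow> walk_sign w (u # ys) = w {u, hd ys} * walk_sign w ys"
  by (cases ys) (auto simp: walk_sign_def)

text \<open>Prepending an edge to a non-backtracking walk either gives a longer one, or cancels its
  first edge.\<close>

lemma nb_walks_sum_recurrence:
  fixes E :: "nat set set" and w :: "nat set \<Rightarrow> int" and g :: "nat \<Rightarrow> real"
  assumes fin: "\<And>x. finite (nbr E x)" and finW: "\<And>m x. finite (nb_walks E m x)"
    and card: "card (nbr E u) = d" and w: "\<And>e. e \<in> E \<Longrightarrow> w e * w e = 1"
  defines "S \<equiv> \<lambda>k u. \<Sum>xs\<in>nb_walks E k u. real_of_int (walk_sign w xs) * g (last xs)"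
  shows "(\<Sum>y\<in>nbr E u. real_of_int (w {u, y}) * S (Suc k) y)
    = S (Suc (Suc k)) u + (if k = 0 then real d else real d - 1) * S k u"
proof -
  let ?h = "\<lambda>(y, ys). real_of_int (w {u, y}) * (real_of_int (walk_sign w ys) * g (last ys))"
  let ?P = "Sigma (nbr E u) (nb_walks E (Suc k))"
  let ?A = "{(y, ys) \<in> ?P. ys ! 1 \<noteq> u}" let ?B = "{(y, ys) \<in> ?P. ys ! 1 = u}"
  have finP: "finite ?P" using fin finW by auto
  have "(\<Sum>y\<in>nbr E u. real_of_int (w {u, y}) * S (Suc k) y) = (\<Sum>p\<in>?P. ?h p)"
    unfolding S_def sum_distrib_left by (rule sum.Sigma) (use fin finW in auto)
  also have "?P = ?A \<union> ?B" by blast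
  also have "(\<Sum>p\<in>?A \<union> ?B. ?h p) = (\<Sum>p\<in>?A. ?h p) + (\<Sum>p\<in>?B. ?h p)"
  proof (rule sum.union_disjoint)
    show "finite ?A" "finite ?B" by (rule finite_subset[OF _ finP], blast)+
  qed blast
  also have "(\<Sum>p\<in>?A. ?h p) = S (Suc (Suc k)) u"
  proof -
    have Aeq: "{(y, ys). y \<in> nbr E u \<and> ys \<in> nb_walks E (Suc k) y \<and> (0 < Suc k \<longrightarrow> ys ! 1 \<noteq> u)} = ?A" by auto
    have inj: "inj_on (\<lambda>(y, ys). u # ys) ?A"
    proof (rule inj_onI)
      fix p p' assume "p \<in> ?A" "p' \<in> ?A" and eq: "(case p of (y, ys) \<Rightarrow> u # ys) = (case p' of (y, ys) \<Rightarrow> u # ys)"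
      then have "fst p = hd (snd p)" "fst p' = hd (snd p')" using nb_walksD(3) by fastforce+
      moreover have "snd p = snd p'" using eq by (auto split: prod.splits)
      ultimately show "p = p'" by (metis prod.collapse)
    qed
    have "S (Suc (Suc k)) u = (\<Sum>p\<in>?A. case p of (y, ys) \<Rightarrow> real_of_int (walk_sign w (u # ys)) * g (last (u # ys)))"
      unfolding S_def nb_walks_Suc[of E "Suc k" u] Aeq
      by (subst sum.reindex[OF inj]) (auto intro!: sum.cong)
    also have "\<dots> = (\<Sum>p\<in>?A. ?h p)"
    proof (rule sum.cong[OF refl])
      fix p assume "p \<in> ?A"
      then obtain y ys where p: "p = (y, ys)" "ys \<in> nb_walks E (Suc k) y" by auto
      from nb_walksD[OF p(2)] show "(case p of (y, ys) \<Rightarrow> real_of_int (walk_sign w (u # ys)) * g (last (u # ys))) = ?h p"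
        using p(1) by (simp add: walk_sign_Cons)
    qed
    finally show ?thesis by simp
  qed
  also have "(\<Sum>p\<in>?B. ?h p) = (if k = 0 then real d else real d - 1) * S k u"
  proof -
    \<comment> \<open>The pairs that cancel are \<open>y\<close> followed by \<open>y # zs\<close>,
      where \<open>zs\<close> is a walk from \<open>u\<close>. The edge \<open>{u, y}\<close> occurs
      twice and its sign squares to 1, so \<open>y\<close> only contributes a count: all
      \<open>d\<close> neighbours if \<open>k = 0\<close>, otherwise all except the second vertex of
      \<open>zs\<close>.\<close>
    let ?N = "\<lambda>zs. {y \<in> nbr E u. 0 < k \<longrightarrow> y \<noteq> zs ! 1}"
    let ?Q = "Sigma (nb_walks E k u) ?N"
    have Beq: "?B = (\<lambda>(zs, y). (y, y # zs)) ` ?Q"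
    proof (intro equalityI subsetI)
      fix p assume "p \<in> ?B"
      then obtain y ys where p: "p = (y, ys)" "y \<in> nbr E u" "ys \<in> nb_walks E (Suc k) y" "ys ! 1 = u" by auto
      from p(3) obtain z zs where z: "z \<in> nbr E y" "zs \<in> nb_walks E k z" "0 < k \<longrightarrow> zs ! 1 \<noteq> y" "ys = y # zs"
        unfolding nb_walks_Suc by auto
      have "z = u" using z(4) p(4) nb_walksD(2)[OF z(2)] by simp
      then have "(zs, y) \<in> ?Q" using z p by auto
      then show "p \<in> (\<lambda>(zs, y). (y, y # zs)) ` ?Q" using p z by (intro image_eqI[of _ _ "(zs, y)"]) auto
    next
      fix p assume "p \<in> (\<lambda>(zs, y). (y, y # zs)) ` ?Q"
      then obtain zs y where p: "p = (y, y # zs)" "zs \<in> nb_walks E k u" "y \<in> nbr E u" "0 < k \<longrightarrow> y \<noteq> zs ! 1" by auto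
      have "u \<in> nbr E y" using p(3) by (simp add: nbr_def insert_commute)
      then have "(u, zs) \<in> {(z, zs). z \<in> nbr E y \<and> zs \<in> nb_walks E k z \<and> (0 < k \<longrightarrow> zs ! 1 \<noteq> y)}" using p by auto
      then have "y # zs \<in> nb_walks E (Suc k) y" unfolding nb_walks_Suc by (intro image_eqI[of _ _ "(u, zs)"]) auto
      then show "p \<in> ?B" using p nb_walksD(2)[OF p(2)] by simp
    qed
    have inj: "inj_on (\<lambda>(zs, y). (y, y # zs)) ?Q" by (rule inj_onI) auto
    have "(\<Sum>p\<in>?B. ?h p) = (\<Sum>q\<in>?Q. case q of (zs, y) \<Rightarrow> real_of_int (w {u, y}) * (real_of_int (walk_sign w (y # zs)) * g (last (y # zs))))"
      unfolding Beq by (subst sum.reindex[OF inj]) (auto intro!: sum.cong)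
    also have "\<dots> = (\<Sum>q\<in>?Q. case q of (zs, y) \<Rightarrow> real_of_int (walk_sign w zs) * g (last zs))"
    proof (rule sum.cong[OF refl])
      fix q assume "q \<in> ?Q"
      then obtain zs y where q: "q = (zs, y)" "zs \<in> nb_walks E k u" "y \<in> nbr E u" by auto
      note z = nb_walksD[OF q(2)]
      have "w {u, y} * w {y, u} = 1" using w[of "{u, y}"] q(3) by (simp add: nbr_def insert_commute)
      then have "real_of_int (w {u, y}) * real_of_int (w {y, u}) = 1" by (metis of_int_1 of_int_mult)
      then show "(case q of (zs, y) \<Rightarrow> real_of_int (w {u, y}) * (real_of_int (walk_sign w (y # zs)) * g (last (y # zs))))
          = (case q of (zs, y) \<Rightarrow> real_of_int (walk_sign w zs) * g (last zs))"
        using q(1) z by (simp add: walk_sign_Cons)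
    qed
    also have "\<dots> = (\<Sum>zs\<in>nb_walks E k u. \<Sum>y\<in>?N zs. real_of_int (walk_sign w zs) * g (last zs))"
      by (rule sum.Sigma[symmetric]) (use finW fin in auto)
    also have "\<dots> = (\<Sum>zs\<in>nb_walks E k u. (if k = 0 then real d else real d - 1) * (real_of_int (walk_sign w zs) * g (last zs)))"
    proof (rule sum.cong[OF refl])
      fix zs assume zs: "zs \<in> nb_walks E k u"
      have "real (card (?N zs)) = (if k = 0 then real d else real d - 1)"
      proof (cases k)
        case 0
        then show ?thesis using card by simp
      next
        case (Suc m)
        have "{zs ! 0, zs ! Suc 0} \<in> set (edge_seq zs)" unfolding set_edge_seq using nb_walksD(1)[OF zs] Suc by auto
        then have mem: "zs ! 1 \<in> nbr E u" using nb_walksD(2,5)[OF zs] by (auto simp: nbr_def)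
        have "?N zs = nbr E u - {zs ! 1}" using Suc by auto
        then have "card (?N zs) = d - 1" using mem fin[of u] card by (simp add: card_Diff_singleton)
        moreover have "0 < d" using mem fin[of u] card card_gt_0_iff by blast
        ultimately show ?thesis using Suc by simp
      qed
      then show "(\<Sum>y\<in>?N zs. real_of_int (walk_sign w zs) * g (last zs))
          = (if k = 0 then real d else real d - 1) * (real_of_int (walk_sign w zs) * g (last zs))" by simp
    qed
    also have "\<dots> = (if k = 0 then real d else real d - 1) * S k u" by (simp add: S_def sum_distrib_left)
    finally show ?thesis .
  qed
  finally show ?thesis .
qed

text \<open>\<open>nb_poly q l k\<close> is the eigenvalue of the matrix of signed sums over non-backtracking walks of
  length \<open>k\<close> on an eigenvector of a signed \<open>(q + 1)\<close>-regular graph with eigenvalue \<open>l\<close>.\<close>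

fun nb_poly :: "real \<Rightarrow> real \<Rightarrow> nat \<Rightarrow> real" where
  "nb_poly q l 0 = 1"
| "nb_poly q l (Suc 0) = l"
| "nb_poly q l (Suc (Suc k)) = l * nb_poly q l (Suc k) - (if k = 0 then q + 1 else q) * nb_poly q l k"

text \<open>At \<open>\<bar>l\<bar> = sqrt q * (s + 1 / s)\<close> the polynomial
  \<open>z * z - \<bar>l\<bar> * z + q\<close> has the roots \<open>s * sqrt q\<close> and
  \<open>sqrt q / s\<close>. A ratio of consecutive values that is at least the larger root stays
  so, since the subtracted term is then at most \<open>sqrt q / s\<close> times the current
  value.\<close>

lemma nb_poly_growth:
  assumes q: "1 \<le> q" and s: "1 < s" "s\<^sup>2 \<le> q" and l: "sqrt q * (s + 1 / s) \<le> \<bar>l\<bar>"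
  shows "s * sqrt q * \<bar>nb_poly q l k\<bar> \<le> \<bar>nb_poly q l (Suc k)\<bar>"
proof -
  have sq: "0 < sqrt q" "sqrt q * sqrt q = q" using q by auto
  have l': "s * sqrt q + sqrt q / s \<le> \<bar>l\<bar>" using l by (simp add: algebra_simps)
  show ?thesis
  proof (induction k rule: nat_less_induct)
    case (1 k)
    consider "k = 0" | "k = 1" | m where "k = Suc (Suc m)" by (metis One_nat_def not0_implies_Suc)
    then show ?case
    proof cases
      case 1
      have "0 \<le> sqrt q / s" using sq s by simp
      then show ?thesis using 1 l' by simp
    next
      case 2
      \<comment> \<open>The coefficient is \<open>q + 1\<close> instead of \<open>q\<close> only
        here; \<open>s\<^sup>2 \<le> q\<close> absorbs the extra 1.\<close>
      have "q + 1 \<le> q + q / s\<^sup>2" using s by (simp add: field_simps)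
      also have "\<dots> = (s * sqrt q + sqrt q / s) * (sqrt q / s)"
        using s sq by (simp add: field_simps power2_eq_square)
      also have "\<dots> \<le> \<bar>l\<bar> * (\<bar>l\<bar> - s * sqrt q)"
        using l' sq s by (intro mult_mono) auto
      finally have "s * sqrt q * \<bar>l\<bar> \<le> l * l - (q + 1)" by (simp add: algebra_simps)
      also have "\<dots> \<le> \<bar>l * l - (q + 1)\<bar>" by simp
      finally show ?thesis using 2 by simp
    next
      case (3 m)
      define a b where "a = nb_poly q l (Suc m)" and "b = nb_poly q l (Suc (Suc m))"
      have IH: "s * sqrt q * \<bar>a\<bar> \<le> \<bar>b\<bar>" unfolding a_def b_def using 1 3 by blast
      have "q * \<bar>a\<bar> = sqrt q / s * (s * sqrt q * \<bar>a\<bar>)"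
        using s sq by (simp add: field_simps)
      also have "\<dots> \<le> sqrt q / s * \<bar>b\<bar>" using IH sq s by (intro mult_left_mono) auto
      finally have qa: "q * \<bar>a\<bar> \<le> sqrt q / s * \<bar>b\<bar>" .
      have "(s * sqrt q + sqrt q / s) * \<bar>b\<bar> \<le> \<bar>l\<bar> * \<bar>b\<bar>"
        using l' by (intro mult_right_mono) auto
      then have "s * sqrt q * \<bar>b\<bar> \<le> \<bar>l * b\<bar> - \<bar>q * a\<bar>"
        using qa q by (simp add: abs_mult algebra_simps)
      also have "\<dots> \<le> \<bar>l * b - q * a\<bar>" by (rule abs_triangle_ineq2)
      also have "l * b - q * a = nb_poly q l (Suc k)" unfolding 3 a_def b_def by simp
      finally show ?thesis unfolding b_def 3 .
    qed
  qed
qed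

lemma nb_poly_lower:
  assumes "1 \<le> q" "1 < s" "s\<^sup>2 \<le> q" "sqrt q * (s + 1 / s) \<le> \<bar>l\<bar>"
  shows "(s * sqrt q) ^ k \<le> \<bar>nb_poly q l k\<bar>"
proof (induction k)
  case (Suc k)
  have "(s * sqrt q) ^ Suc k \<le> s * sqrt q * \<bar>nb_poly q l k\<bar>"
    using Suc assms by (auto intro: mult_left_mono)
  also have "\<dots> \<le> \<bar>nb_poly q l (Suc k)\<bar>" by (rule nb_poly_growth[OF assms])
  finally show ?case .
qed simp

section \<open>Random signings\<close>

text \<open>The squared Frobenius norm of the matrix of signed sums.\<close>

definition frob :: "nat set set \<Rightarrow> nat \<Rightarrow> nat \<Rightarrow> (nat set \<Rightarrow> int) \<Rightarrow> real" where
  "frob E n k w = (\<Sum>u<n. \<Sum>y<n. (\<Sum>xs | xs \<in> nb_walks E k u \<and> last xs = y. real_of_int (walk_sign w xs))\<^sup>2)"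

lemma regular_finite_nb_walks:
  assumes "E \<in> regular_graphs n d"
  shows "finite (nb_walks E k u)"
proof -
  have "finite (walks E k u)"
    using walks_finite_card[of E d k u] regular_nbr[OF assms] by blast
  then show ?thesis by (simp add: nb_walks_def)
qed

lemma regular_walk_last:
  assumes "E \<in> regular_graphs n d" "xs \<in> nb_walks E k u" "u < n"
  shows "last xs < n"
proof (cases k)
  case 0
  then show ?thesis using assms by (simp add: nb_walks_0)
next
  case (Suc m)
  note D = nb_walksD[OF assms(2)]
  have "{xs ! m, xs ! Suc m} \<in> set (edge_seq xs)" unfolding set_edge_seq using D(1) Suc by auto
  then have "xs ! Suc m < n" using D(5) regular_graphsD(4)[OF assms(1)] by blast
  then show ?thesis using D(1,4) Suc by (simp add: last_conv_nth)
qed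

text \<open>Applied to an eigenvector, the recurrence for walk sums becomes that of
  \<open>nb_poly\<close>: the signed sum over neighbours turns into a factor
  \<open>l\<close>.\<close>

lemma nb_walks_sum_eigen:
  fixes v :: "nat \<Rightarrow> real" and w :: "nat set \<Rightarrow> int"
  assumes E: "E \<in> regular_graphs n d" and w: "\<And>e. e \<in> E \<Longrightarrow> w e * w e = 1"
    and ev: "\<And>u. u < n \<Longrightarrow> (\<Sum>y\<in>nbr E u. real_of_int (w {u, y}) * v y) = l * v u" and u: "u < n"
  shows "(\<Sum>xs\<in>nb_walks E k u. real_of_int (walk_sign w xs) * v (last xs)) = nb_poly (real d - 1) l k * v u"
  using u
proof (induction k arbitrary: u rule: less_induct)
  case (less k)
  let ?S = "\<lambda>k u. \<Sum>xs\<in>nb_walks E k u. real_of_int (walk_sign w xs) * v (last xs)"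
  consider "k = 0" | "k = Suc 0" | m where "k = Suc (Suc m)" by (metis not0_implies_Suc)
  then show ?case
  proof cases
    case 1
    then show ?thesis by (simp add: nb_walks_0 walk_sign_def)
  next
    case 2
    have eq: "nb_walks E (Suc 0) u = (\<lambda>y. [u, y]) ` nbr E u"
      unfolding nb_walks_Suc nb_walks_0 by (auto simp: image_iff)
    have inj: "inj_on (\<lambda>y. [u, y]) (nbr E u)" by (rule inj_onI) simp
    show ?thesis unfolding 2 eq using ev[OF less.prems] by (subst sum.reindex[OF inj]) (simp add: walk_sign_def)
  next
    case (3 m)
    let ?p = "nb_poly (real d - 1) l"
    have "?S (Suc (Suc m)) u + (if m = 0 then real d else real d - 1) * ?S m u
        = (\<Sum>y\<in>nbr E u. real_of_int (w {u, y}) * ?S (Suc m) y)"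
      by (rule nb_walks_sum_recurrence[symmetric])
        (use regular_nbr[OF E] regular_finite_nb_walks[OF E] less.prems w in auto)
    also have "\<dots> = (\<Sum>y\<in>nbr E u. real_of_int (w {u, y}) * (?p (Suc m) * v y))"
    proof (rule sum.cong[OF refl])
      fix y assume "y \<in> nbr E u"
      then have "y < n" using regular_nbr(2)[OF E] by blast
      then show "real_of_int (w {u, y}) * ?S (Suc m) y = real_of_int (w {u, y}) * (?p (Suc m) * v y)"
        using less.IH[of "Suc m" y] 3 by simp
    qed
    also have "\<dots> = ?p (Suc m) * (\<Sum>y\<in>nbr E u. real_of_int (w {u, y}) * v y)"
      by (simp add: sum_distrib_left mult_ac)
    also have "\<dots> = ?p (Suc m) * (l * v u)" using ev[OF less.prems] by simp
    finally have "?S (Suc (Suc m)) u = ?p (Suc m) * (l * v u) - (if m = 0 then real d else real d - 1) * ?S m u"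
      by simp
    moreover have "?S m u = ?p m * v u" using less.IH[of m u] less.prems 3 by simp
    ultimately show ?thesis unfolding 3 by (cases "m = 0") (simp_all add: algebra_simps)
  qed
qed

text \<open>An eigenvalue is bounded by the Frobenius norm: Cauchy-Schwarz in each row, then
  division by the squared norm of the eigenvector.\<close>

lemma nb_poly_le_frob:
  fixes v :: "nat \<Rightarrow> real" and w :: "nat set \<Rightarrow> int"
  assumes E: "E \<in> regular_graphs n d" and w: "\<And>e. e \<in> E \<Longrightarrow> w e * w e = 1"
    and ev: "\<And>u. u < n \<Longrightarrow> (\<Sum>y\<in>nbr E u. real_of_int (w {u, y}) * v y) = l * v u"
    and nz: "i < n" "v i \<noteq> 0"
  shows "(nb_poly (real d - 1) l k)\<^sup>2 \<le> frob E n k w"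
proof -
  define a where "a u y = (\<Sum>xs | xs \<in> nb_walks E k u \<and> last xs = y. real_of_int (walk_sign w xs))" for u y
  let ?p = "nb_poly (real d - 1) l k"
  have S: "?p * v u = (\<Sum>y<n. a u y * v y)" if u: "u < n" for u
  proof -
    have "?p * v u = (\<Sum>xs\<in>nb_walks E k u. real_of_int (walk_sign w xs) * v (last xs))"
      by (rule nb_walks_sum_eigen[OF E w ev u, symmetric])
    also have "\<dots> = (\<Sum>y<n. \<Sum>xs | xs \<in> nb_walks E k u \<and> last xs = y. real_of_int (walk_sign w xs) * v (last xs))"
      by (rule sum.group[symmetric]) (use regular_finite_nb_walks[OF E] regular_walk_last[OF E _ u] in auto)
    also have "\<dots> = (\<Sum>y<n. a u y * v y)"
      unfolding a_def sum_distrib_right by (intro sum.cong) auto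
    finally show ?thesis .
  qed
  let ?V = "\<Sum>y<n. (v y)\<^sup>2"
  have V: "0 < ?V" using nz by (intro sum_pos2[of _ i]) auto
  have "?p\<^sup>2 * ?V = (\<Sum>u<n. (?p * v u)\<^sup>2)" by (simp add: sum_distrib_left power_mult_distrib)
  also have "\<dots> = (\<Sum>u<n. (\<Sum>y<n. a u y * v y)\<^sup>2)" by (intro sum.cong) (auto simp: S)
  also have "\<dots> \<le> (\<Sum>u<n. (\<Sum>y<n. (a u y)\<^sup>2) * ?V)"
    by (intro sum_mono Cauchy_Schwarz_ineq_sum)
  also have "\<dots> = frob E n k w * ?V" unfolding frob_def a_def by (simp add: sum_distrib_right)
  finally show ?thesis using V by simp
qed

lemma frob_nonneg: "0 \<le> frob E n k w"
  unfolding frob_def by (intro sum_nonneg) auto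

section \<open>Averages over all signings\<close>

definition signings :: "'a set \<Rightarrow> ('a \<Rightarrow> int) set" where
  "signings E = PiE_dflt E 1 (\<lambda>_. {-1, 1})"

lemma signings_finite: "finite E \<Longrightarrow> finite (signings E)"
  unfolding signings_def by auto

lemma signings_nonempty: "signings E \<noteq> {}"
  unfolding signings_def by simp

lemma signings_sq: "w \<in> signings E \<Longrightarrow> e \<in> E \<Longrightarrow> w e * w e = 1"
  unfolding signings_def PiE_dflt_def by force

lemma prod_list_flip:
  fixes w :: "'a \<Rightarrow> int"
  shows "prod_list (map (w(e := - w e)) L) = (- 1) ^ count_list L e * prod_list (map w L)"
  by (induction L) auto

text \<open>Flipping the sign of \<open>e\<close> is an involution of the signings that negates the
  product.\<close>

lemma sum_signings_odd:
  assumes "e \<in> E" "odd (count_list L e)"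
  shows "(\<Sum>w\<in>signings E. prod_list (map w L)) = 0"
proof -
  let ?f = "\<lambda>w. w(e := - w e)"
  have inv: "?f (?f w) = w" for w :: "'a \<Rightarrow> int" by auto
  have mem: "?f w \<in> signings E" if "w \<in> signings E" for w
    using that assms(1) by (auto simp: signings_def PiE_dflt_def)
  have "(\<Sum>w\<in>signings E. prod_list (map w L)) = (\<Sum>w\<in>signings E. prod_list (map (?f w) L))"
    by (rule sum.reindex_bij_witness[of _ ?f ?f]) (use inv mem in auto)
  also have "\<dots> = (\<Sum>w\<in>signings E. - prod_list (map w L))"
    using assms(2) by (simp add: prod_list_flip)
  also have "\<dots> = - (\<Sum>w\<in>signings E. prod_list (map w L))" by (rule sum_negf)
  finally show ?thesis by simp
qed

lemma prod_list_signing_le: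
  assumes "w \<in> signings E" "set L \<subseteq> E"
  shows "prod_list (map w L) \<in> {-1, 1}"
  using assms(2)
proof (induction L)
  case (Cons a L)
  then have "w a \<in> {-1, 1}" using assms(1) by (auto simp: signings_def PiE_dflt_def)
  then show ?case using Cons by auto
qed simp

text \<open>Of the parity cancellation only multiplicity one is kept: in its absence a list has at
  most half as many distinct edges as entries, which is the bound that hikes require.\<close>

lemma sum_signings_le:
  assumes "set L \<subseteq> E" "finite E"
  shows "(\<Sum>w\<in>signings E. prod_list (map w L)) \<le> (if \<exists>e\<in>set L. count_list L e = 1 then 0 else int (card (signings E)))"
proof (cases "\<exists>e\<in>set L. count_list L e = 1")
  case True
  then obtain e where e: "e \<in> set L" "count_list L e = 1" by blast
  then have "(\<Sum>w\<in>signings E. prod_list (map w L)) = 0" using assms by (intro sum_signings_odd[of e]) auto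
  then show ?thesis using True by simp
next
  case False
  have "(\<Sum>w\<in>signings E. prod_list (map w L)) \<le> (\<Sum>w\<in>signings E. 1)"
    using prod_list_signing_le[OF _ assms(1)] by (intro sum_mono) fastforce
  then show ?thesis using False by simp
qed

lemma card_set_le_half:
  assumes "\<not> (\<exists>e\<in>set L. count_list L e = 1)"
  shows "2 * card (set L) \<le> length L"
proof -
  have "2 \<le> count_list L e" if "e \<in> set L" for e
  proof -
    have "count_list L e \<noteq> 0" using that by (simp add: count_list_0_iff)
    moreover have "count_list L e \<noteq> 1" using that assms by blast
    ultimately show ?thesis by linarith
  qed
  then have "(\<Sum>e\<in>set L. 2) \<le> (\<Sum>e\<in>set L. count_list L e)" by (intro sum_mono) auto
  then show ?thesis using sum_count_set[of L "set L"] by simp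
qed

text \<open>The second walk is read backwards from the common end. The join lies at position
  \<open>k\<close>, the only place where the concatenation may backtrack; this is why hikes are
  exempt there.\<close>

lemma pair_hike:
  assumes xs: "xs \<in> nb_walks E k u" and ys: "ys \<in> nb_walks E k u" and eq: "last xs = last ys" and u: "u < n"
    and good: "\<not> (\<exists>e\<in>set (edge_seq xs @ edge_seq ys). count_list (edge_seq xs @ edge_seq ys) e = 1)"
  shows "xs @ tl (rev ys) \<in> hikes E n k"
proof -
  note X = nb_walksD[OF xs] and Y = nb_walksD[OF ys]
  let ?h = "xs @ tl (rev ys)"
  have es: "edge_seq ?h = edge_seq xs @ rev (edge_seq ys)"
    using edge_seq_join[of xs "rev ys"] X Y eq by (simp add: hd_rev edge_seq_rev)
  have len: "length ?h = Suc (2 * k)" using X Y by simp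
  have low: "?h ! i = xs ! i" if "i \<le> k" for i using that X by (simp add: nth_append)
  have high: "?h ! i = ys ! (2 * k - i)" if "k \<le> i" "i \<le> 2 * k" for i
  proof (cases "i = k")
    case True
    have "xs ! k = ys ! k" using eq X Y by (simp add: last_conv_nth)
    then show ?thesis using True low[of k] by simp
  next
    case False
    then have ik: "Suc k \<le> i" using that by simp
    have "?h ! i = tl (rev ys) ! (i - Suc k)" using ik X by (simp add: nth_append)
    also have "\<dots> = rev ys ! Suc (i - Suc k)" using ik that Y by (intro nth_tl) simp
    also have "Suc (i - Suc k) = i - k" using ik by simp
    also have "rev ys ! (i - k) = ys ! (length ys - Suc (i - k))" using that Y by (intro rev_nth) simp
    also have "length ys - Suc (i - k) = 2 * k - i" using Y that by simp
    finally show ?thesis .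
  qed
  have nbt: "?h ! i \<noteq> ?h ! Suc (Suc i)" if i: "Suc (Suc i) < length ?h" "Suc i \<noteq> k" for i
  proof (cases "Suc (Suc i) \<le> k")
    case True
    then show ?thesis using low[of i] low[of "Suc (Suc i)"] X by (simp add: nonbacktracking_def)
  next
    case False
    then have ki: "k \<le> i" using i by simp
    \<comment> \<open>The second half runs through \<open>ys\<close> in reverse, so positions
      \<open>i\<close> and \<open>i + 2\<close> correspond to \<open>j + 2\<close> and
      \<open>j\<close>.\<close>
    define j where "j = 2 * k - Suc (Suc i)"
    have j: "2 * k - i = Suc (Suc j)" "2 * k - Suc (Suc i) = j" "Suc (Suc j) \<le> k"
      using i len ki by (auto simp: j_def)
    have "ys ! j \<noteq> ys ! Suc (Suc j)" using Y j by (simp add: nonbacktracking_def)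
    then show ?thesis using high[of i] high[of "Suc (Suc i)"] i len ki j by simp
  qed
  have "2 * card (set (edge_seq xs @ edge_seq ys)) \<le> length (edge_seq xs @ edge_seq ys)"
    by (rule card_set_le_half[OF good])
  then have "card (set (edge_seq ?h)) \<le> k" using X Y by (simp add: es)
  moreover have "hd ?h < n" using X u by simp
  moreover have "set (edge_seq ?h) \<subseteq> E" using X Y by (simp add: es)
  ultimately show ?thesis using len nbt unfolding hikes_def by blast
qed

text \<open>Expanding the square gives pairs of walks with common ends. A pair with an edge
  traversed exactly once averages to 0, every other pair to at most 1, and the latter pairs embed
  into the hikes.\<close>

lemma sum_frob_le:
  assumes E: "E \<in> regular_graphs n d" and finH: "finite (hikes E n k)"
  shows "(\<Sum>w\<in>signings E. frob E n k w) \<le> real (card (signings E)) * real (card (hikes E n k))"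
proof -
  define X where "X u y = {xs. xs \<in> nb_walks E k u \<and> last xs = y}" for u y
  define good where "good xs ys \<longleftrightarrow> \<not> (\<exists>e\<in>set (edge_seq xs @ edge_seq ys). count_list (edge_seq xs @ edge_seq ys) e = 1)"
    for xs ys :: "nat list"
  define Z where "Z u y = {(xs, ys). xs \<in> X u y \<and> ys \<in> X u y \<and> good xs ys}" for u y
  have finE: "finite E" using regular_graphsD(1)[OF E] .
  have finX: "finite (X u y)" for u y using regular_finite_nb_walks[OF E] by (simp add: X_def)
  have finZ: "finite (Z u y)" for u y
    by (rule finite_subset[of _ "X u y \<times> X u y"]) (auto simp: Z_def finX)
  have one: "(\<Sum>w\<in>signings E. (\<Sum>xs\<in>X u y. real_of_int (walk_sign w xs))\<^sup>2) \<le> real (card (signings E)) * real (card (Z u y))" for u y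
  proof -
    have "(\<Sum>w\<in>signings E. (\<Sum>xs\<in>X u y. real_of_int (walk_sign w xs))\<^sup>2)
        = (\<Sum>w\<in>signings E. \<Sum>p\<in>X u y \<times> X u y. real_of_int (walk_sign w (fst p)) * real_of_int (walk_sign w (snd p)))"
      unfolding power2_eq_square sum_product by (simp add: sum.cartesian_product split_def)
    also have "\<dots> = (\<Sum>p\<in>X u y \<times> X u y. \<Sum>w\<in>signings E. real_of_int (walk_sign w (fst p)) * real_of_int (walk_sign w (snd p)))"
      by (rule sum.swap)
    also have "\<dots> \<le> (\<Sum>p\<in>X u y \<times> X u y. if good (fst p) (snd p) then real (card (signings E)) else 0)"
    proof (rule sum_mono)
      fix p assume "p \<in> X u y \<times> X u y"
      then obtain xs ys where p: "p = (xs, ys)" "xs \<in> nb_walks E k u" "ys \<in> nb_walks E k u" by (auto simp: X_def)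
      let ?L = "edge_seq xs @ edge_seq ys"
      have L: "set ?L \<subseteq> E" using nb_walksD(5)[OF p(2)] nb_walksD(5)[OF p(3)] by simp
      have "(\<Sum>w\<in>signings E. real_of_int (walk_sign w xs) * real_of_int (walk_sign w ys))
          = real_of_int (\<Sum>w\<in>signings E. prod_list (map w ?L))"
        by (simp add: walk_sign_def)
      also have "\<dots> \<le> real_of_int (if \<exists>e\<in>set ?L. count_list ?L e = 1 then 0 else int (card (signings E)))"
        using sum_signings_le[OF L finE] by (simp only: of_int_le_iff)
      also have "\<dots> = (if good xs ys then real (card (signings E)) else 0)" unfolding good_def by (simp only: if_not_P if_P split: if_split) auto
      finally show "(\<Sum>w\<in>signings E. real_of_int (walk_sign w (fst p)) * real_of_int (walk_sign w (snd p)))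
          \<le> (if good (fst p) (snd p) then real (card (signings E)) else 0)" using p(1) by simp
    qed
    also have "\<dots> = (\<Sum>p\<in>Z u y. real (card (signings E)))"
      by (rule sum.mono_neutral_cong_right) (auto simp: Z_def finX)
    finally show ?thesis by (simp add: mult.commute)
  qed
  have cZ: "(\<Sum>u<n. \<Sum>y<n. card (Z u y)) \<le> card (hikes E n k)"
  proof -
    let ?Q = "SIGMA u:{..<n}. SIGMA y:{..<n}. Z u y"
    have fQ: "finite (SIGMA y:{..<n}. Z u y)" for u using finZ by auto
    have "(\<Sum>u<n. \<Sum>y<n. card (Z u y)) = card ?Q"
      using finZ fQ by (simp add: card_SigmaI)
    also have "\<dots> \<le> card (hikes E n k)"
    proof (rule card_inj_on_le[OF _ _ finH, of "\<lambda>(u, y, xs, ys). xs @ tl (rev ys)"])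
      \<comment> \<open>The halves can be separated because the first walk always has
        \<open>k + 1\<close> vertices; its last vertex restores the vertex that \<open>tl\<close>
        dropped from the second.\<close>
      show "inj_on (\<lambda>(u, y, xs, ys). xs @ tl (rev ys)) ?Q"
      proof (rule inj_onI)
        fix p p' assume "p \<in> ?Q" "p' \<in> ?Q"
          and pp: "(case p of (u, y, xs, ys) \<Rightarrow> xs @ tl (rev ys)) = (case p' of (u, y, xs, ys) \<Rightarrow> xs @ tl (rev ys))"
        then obtain u y xs ys u' y' xs' ys' where p: "p = (u, y, xs, ys)" "p' = (u', y', xs', ys')"
          and Z: "(xs, ys) \<in> Z u y" "(xs', ys') \<in> Z u' y'" by auto
        have eq: "xs @ tl (rev ys) = xs' @ tl (rev ys')" using pp p by simp
        from Z have m: "xs \<in> nb_walks E k u" "ys \<in> nb_walks E k u" "last xs = y" "last ys = y"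
          and m': "xs' \<in> nb_walks E k u'" "ys' \<in> nb_walks E k u'" "last xs' = y'" "last ys' = y'"
          by (auto simp: Z_def X_def)
        have "length xs = length xs'" using nb_walksD(1)[OF m(1)] nb_walksD(1)[OF m'(1)] by simp
        then have xx: "xs = xs'" and tt: "tl (rev ys) = tl (rev ys')" using eq by auto
        have "hd (rev ys) = hd (rev ys')" using m m' xx by (simp add: hd_rev)
        moreover have "rev ys \<noteq> []" "rev ys' \<noteq> []" using nb_walksD(4)[OF m(2)] nb_walksD(4)[OF m'(2)] by auto
        ultimately have "rev ys = rev ys'" using tt by (metis list.collapse)
        then show "p = p'"
          using p xx m(3) m'(3) nb_walksD(3)[OF m(1)] nb_walksD(3)[OF m'(1)] by simp
      qed
      show "(\<lambda>(u, y, xs, ys). xs @ tl (rev ys)) ` ?Q \<subseteq> hikes E n k"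
      proof (rule image_subsetI)
        fix p assume "p \<in> ?Q"
        then obtain u y xs ys where p: "p = (u, y, xs, ys)" "u < n" "(xs, ys) \<in> Z u y" by auto
        then have "xs @ tl (rev ys) \<in> hikes E n k"
          unfolding Z_def X_def good_def by (intro pair_hike) auto
        then show "(case p of (u, y, xs, ys) \<Rightarrow> xs @ tl (rev ys)) \<in> hikes E n k" using p by simp
      qed
    qed
    finally show ?thesis .
  qed
  have "(\<Sum>w\<in>signings E. frob E n k w)
      = (\<Sum>u<n. \<Sum>y<n. \<Sum>w\<in>signings E. (\<Sum>xs\<in>X u y. real_of_int (walk_sign w xs))\<^sup>2)"
    unfolding frob_def X_def by (subst sum.swap) (intro sum.cong refl, rule sum.swap)
  also have "\<dots> \<le> (\<Sum>u<n. \<Sum>y<n. real (card (signings E)) * real (card (Z u y)))"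
    by (intro sum_mono one)
  also have "\<dots> = real (card (signings E)) * real (\<Sum>u<n. \<Sum>y<n. card (Z u y))"
    by (simp add: sum_distrib_left)
  also have "\<dots> \<le> real (card (signings E)) * real (card (hikes E n k))"
    using cZ by (intro mult_left_mono of_nat_mono) auto
  finally show ?thesis .
qed

section \<open>From eigenvalues to hikes\<close>

text \<open>\<open>c\<close> times the squared norm of \<open>x\<close> is the value of the
  quadratic form at \<open>x\<close>, which by symmetry equals its own conjugate.\<close>

lemma symmetric_eigenvalue_real:
  fixes a :: "nat \<Rightarrow> nat \<Rightarrow> real" and x :: "nat \<Rightarrow> complex"
  assumes sym: "\<And>i j. a i j = a j i"
    and ev: "\<And>i. i < n \<Longrightarrow> (\<Sum>j<n. complex_of_real (a i j) * x j) = c * x i"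
    and nz: "i < n" "x i \<noteq> 0"
  shows "cnj c = c"
proof -
  let ?N = "\<Sum>i<n. cnj (x i) * x i"
  have N: "?N = complex_of_real (\<Sum>i<n. (norm (x i))\<^sup>2)"
    by (simp add: complex_norm_square[symmetric] mult.commute)
  have "0 < (\<Sum>i<n. (norm (x i))\<^sup>2)" using nz by (intro sum_pos2[of _ i]) auto
  then have N0: "?N \<noteq> 0" unfolding N by (metis of_real_eq_0_iff less_irrefl)
  have e1: "c * ?N = (\<Sum>i<n. \<Sum>j<n. cnj (x i) * (complex_of_real (a i j) * x j))"
  proof -
    have "c * ?N = (\<Sum>i<n. cnj (x i) * (c * x i))" by (simp add: sum_distrib_left mult_ac)
    also have "\<dots> = (\<Sum>i<n. cnj (x i) * (\<Sum>j<n. complex_of_real (a i j) * x j))"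
      by (intro sum.cong) (auto simp: ev)
    finally show ?thesis by (simp add: sum_distrib_left)
  qed
  have "cnj (c * ?N) = (\<Sum>i<n. \<Sum>j<n. x i * (complex_of_real (a i j) * cnj (x j)))"
    unfolding e1 by simp
  also have "\<dots> = (\<Sum>j<n. \<Sum>i<n. x i * (complex_of_real (a i j) * cnj (x j)))" by (rule sum.swap)
  also have "\<dots> = (\<Sum>j<n. \<Sum>i<n. cnj (x j) * (complex_of_real (a j i) * x i))"
    by (intro sum.cong refl) (subst sym, simp add: mult_ac)
  also have "\<dots> = c * ?N" by (rule e1[symmetric])
  finally have "cnj c * cnj ?N = c * ?N" by simp
  moreover have "cnj ?N = ?N" unfolding N by (rule complex_cnj_complex_of_real)
  ultimately show ?thesis using N0 by simp
qed

text \<open>The spectral radius is attained at an eigenvalue, which is real by symmetry. The real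
  and imaginary parts of a complex eigenvector then satisfy the same equation, and one of them is
  nonzero.\<close>

lemma signed_adjacency_real_eigenvector:
  assumes E: "E \<in> regular_graphs n d" and n: "0 < n"
  obtains l :: real and v :: "nat \<Rightarrow> real" and i
  where "\<bar>l\<bar> = spectral_radius (signed_adjacency_matrix n E w)" "i < n" "v i \<noteq> 0"
    "\<And>u. u < n \<Longrightarrow> (\<Sum>y\<in>nbr E u. real_of_int (w {u, y}) * v y) = l * v u"
proof -
  let ?A = "signed_adjacency_matrix n E w"
  define a where "a i j = (if {i, j} \<in> E then real_of_int (w {i, j}) else 0)" for i j
  have A: "?A \<in> carrier_mat n n" by (simp add: signed_adjacency_matrix_def)
  have Aij: "?A $$ (i, j) = complex_of_real (a i j)" if "i < n" "j < n" for i j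
    using that by (simp add: signed_adjacency_matrix_def a_def)
  obtain c where c: "c \<in> spectrum ?A" "norm c = spectral_radius ?A"
    using spectral_radius_mem_max(1)[OF A n] by auto
  then obtain x where x: "eigenvector ?A x c" by (auto simp: spectrum_def eigenvalue_def)
  then have xc: "x \<in> carrier_vec n" "x \<noteq> 0\<^sub>v n" "?A *\<^sub>v x = c \<cdot>\<^sub>v x" using A by (auto simp: eigenvector_def)
  have ev: "(\<Sum>j<n. complex_of_real (a i j) * x $ j) = c * x $ i" if i: "i < n" for i
  proof -
    have "(?A *\<^sub>v x) $ i = (\<Sum>j<n. ?A $$ (i, j) * x $ j)"
      using i A xc(1) by (auto simp: scalar_prod_def lessThan_atLeast0 intro!: sum.cong)
    also have "\<dots> = (\<Sum>j<n. complex_of_real (a i j) * x $ j)" using i by (intro sum.cong) (auto simp: Aij)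
    finally show ?thesis using xc i by simp
  qed
  obtain i where i: "i < n" "x $ i \<noteq> 0"
  proof -
    have "\<exists>i<n. x $ i \<noteq> 0"
    proof (rule ccontr)
      assume "\<not> ?thesis"
      then have "x = 0\<^sub>v n" using xc(1) by (intro eq_vecI) auto
      then show False using xc(2) by simp
    qed
    then show ?thesis using that by blast
  qed
  have sym: "a i j = a j i" for i j by (simp add: a_def insert_commute)
  have "cnj c = c" by (rule symmetric_eigenvalue_real[of a n "\<lambda>i. x $ i" c i, OF sym ev i])
  then have cR: "c = complex_of_real (Re c)" by (simp add: complex_eq_iff)
  have nbrsum: "(\<Sum>y\<in>nbr E u. real_of_int (w {u, y}) * v y) = (\<Sum>j<n. a u j * v j)" for u and v :: "nat \<Rightarrow> real"
    by (rule sum.mono_neutral_cong_left) (use regular_nbr(2)[OF E] in \<open>auto simp: a_def nbr_def\<close>)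
  have re: "(\<Sum>j<n. a u j * Re (x $ j)) = Re c * Re (x $ u)" if "u < n" for u
  proof -
    have "Re (\<Sum>j<n. complex_of_real (a u j) * x $ j) = Re (complex_of_real (Re c) * x $ u)"
      using ev[OF that] cR by simp
    then show ?thesis by simp
  qed
  have im: "(\<Sum>j<n. a u j * Im (x $ j)) = Re c * Im (x $ u)" if "u < n" for u
  proof -
    have "Im (\<Sum>j<n. complex_of_real (a u j) * x $ j) = Im (complex_of_real (Re c) * x $ u)"
      using ev[OF that] cR by simp
    then show ?thesis by simp
  qed
  have nc: "\<bar>Re c\<bar> = spectral_radius ?A" using c(2) cR by (metis norm_of_real)
  show ?thesis
  proof (cases "Re (x $ i) = 0")
    case True
    then have "Im (x $ i) \<noteq> 0" using i(2) by (simp add: complex_eq_iff)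
    then show ?thesis using that[OF nc i(1), of "\<lambda>j. Im (x $ j)"] nbrsum im by simp
  next
    case False
    then show ?thesis using that[OF nc i(1), of "\<lambda>j. Re (x $ j)"] nbrsum re by simp
  qed
qed

text \<open>Markov's inequality: an eigenvalue beyond \<open>c\<close> forces the squared Frobenius
  norm to be at least \<open>(s\<^sup>2 * (d - 1)) ^ k\<close>, whereas its average is at most the
  number of hikes.\<close>

lemma random_signing_tail:
  assumes E: "E \<in> regular_graphs n d" and n: "0 < n" and d: "2 \<le> d"
    and s: "1 < s" "s\<^sup>2 \<le> real d - 1" and c: "sqrt (real d - 1) * (s + 1 / s) \<le> c"
    and finH: "finite (hikes E n k)"
  shows "measure_pmf.prob (Pi_pmf E 1 (\<lambda>_. pmf_of_set {-1, 1}))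
      {w. \<not> spectral_radius (signed_adjacency_matrix n E w) \<le> c}
    \<le> real (card (hikes E n k)) / (s\<^sup>2 * (real d - 1)) ^ k"
proof -
  have finE: "finite E" using regular_graphsD(1)[OF E] .
  let ?bad = "{w. \<not> spectral_radius (signed_adjacency_matrix n E w) \<le> c}"
  let ?R = "(s\<^sup>2 * (real d - 1)) ^ k"
  have pmf: "Pi_pmf E 1 (\<lambda>_. pmf_of_set {-1, 1 :: int}) = pmf_of_set (signings E)"
    unfolding signings_def by (rule Pi_pmf_of_set[OF finE]) auto
  have R: "?R \<le> frob E n k w" if w: "w \<in> signings E \<inter> ?bad" for w
  proof -
    obtain l v i where lv: "\<bar>l\<bar> = spectral_radius (signed_adjacency_matrix n E w)" "i < n" "v i \<noteq> (0::real)"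
      "\<And>u. u < n \<Longrightarrow> (\<Sum>y\<in>nbr E u. real_of_int (w {u, y}) * v y) = l * v u"
      using signed_adjacency_real_eigenvector[OF E n, of w] by metis
    have wsq: "w e * w e = 1" if "e \<in> E" for e using signings_sq[of w E e] w that by simp
    have l: "sqrt (real d - 1) * (s + 1 / s) \<le> \<bar>l\<bar>" using lv(1) w c by auto
    have "(s * sqrt (real d - 1)) ^ k \<le> \<bar>nb_poly (real d - 1) l k\<bar>"
      using nb_poly_lower[OF _ s l] d by simp
    then have "((s * sqrt (real d - 1)) ^ k)\<^sup>2 \<le> \<bar>nb_poly (real d - 1) l k\<bar>\<^sup>2"
      using s d by (intro power_mono) auto
    also have "\<dots> = (nb_poly (real d - 1) l k)\<^sup>2" by simp
    also have "\<dots> \<le> frob E n k w"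
      by (rule nb_poly_le_frob[OF E wsq lv(4) lv(2,3)])
    also have "((s * sqrt (real d - 1)) ^ k)\<^sup>2 = ?R"
    proof -
      have "((s * sqrt (real d - 1)) ^ k)\<^sup>2 = ((s * sqrt (real d - 1))\<^sup>2) ^ k"
        by (simp add: power_mult[symmetric] mult.commute)
      then show ?thesis using d by (simp add: power_mult_distrib)
    qed
    finally show ?thesis .
  qed
  have Rpos: "0 < ?R" using s d by (intro zero_less_power mult_pos_pos) auto
  have cpos: "0 < card (signings E)" using signings_finite[OF finE] signings_nonempty by (simp add: card_gt_0_iff)
  have "real (card (signings E \<inter> ?bad)) * ?R = (\<Sum>w\<in>signings E \<inter> ?bad. ?R)" by simp
  also have "\<dots> \<le> (\<Sum>w\<in>signings E \<inter> ?bad. frob E n k w)" by (intro sum_mono R)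
  also have "\<dots> \<le> (\<Sum>w\<in>signings E. frob E n k w)"
    using signings_finite[OF finE] frob_nonneg by (intro sum_mono2) auto
  also have "\<dots> \<le> real (card (signings E)) * real (card (hikes E n k))" by (rule sum_frob_le[OF E finH])
  finally have "real (card (signings E \<inter> ?bad)) / real (card (signings E)) \<le> real (card (hikes E n k)) / ?R"
    using Rpos cpos by (simp add: field_simps)
  then show ?thesis
    unfolding pmf measure_pmf_of_set[OF signings_nonempty signings_finite[OF finE]] .
qed

section \<open>Random regular graphs\<close>

text \<open>Offsets of a circulant graph have to be closed under negation modulo \<open>n\<close>.
  They are taken from both ends in equal number; an odd \<open>d\<close> forces \<open>n\<close> to
  be even, and \<open>n / 2\<close>, its own negative, is added.\<close>

lemma exists_symmetric_offsets:
  assumes "d < n" "even (n * d)"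
  obtains J where "J \<subseteq> {1..<n}" "card J = d" "\<And>j. j \<in> J \<Longrightarrow> n - j \<in> J"
proof (cases "even d")
  case True
  then obtain m where m: "d = 2 * m" by (elim evenE)
  have "card ({1..m} \<union> {n - m..<n}) = card {1..m} + card {n - m..<n}"
    using assms m by (intro card_Un_disjoint) auto
  then have "card ({1..m} \<union> {n - m..<n}) = d" using assms m by simp
  moreover have "{1..m} \<union> {n - m..<n} \<subseteq> {1..<n}" using assms m by auto
  moreover have "n - j \<in> {1..m} \<union> {n - m..<n}" if "j \<in> {1..m} \<union> {n - m..<n}" for j
    using that assms m by auto
  ultimately show ?thesis using that by blast
next
  case False
  then obtain m where m: "d = 2 * m + 1" by (elim oddE)
  from False assms have "even n" by simp
  then obtain h where h: "n = 2 * h" by (elim evenE)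
  have mh: "m < h" using assms m h by simp
  let ?J = "{1..m} \<union> {n - m..<n}"
  have "card ?J = card {1..m} + card {n - m..<n}"
    using mh h by (intro card_Un_disjoint) auto
  moreover have "h \<notin> ?J" using mh h by auto
  ultimately have "card (insert h ?J) = d" using mh h m by simp
  moreover have "insert h ?J \<subseteq> {1..<n}" using mh h by auto
  moreover have "n - j \<in> insert h ?J" if "j \<in> insert h ?J" for j
    using that mh h by auto
  ultimately show ?thesis using that by blast
qed

text \<open>The witness is a circulant graph.\<close>

lemma regular_graphs_nonempty:
  assumes "d < n" "even (n * d)"
  shows "regular_graphs n d \<noteq> {}"
proof -
  obtain J where J: "J \<subseteq> {1..<n}" "card J = d" "\<And>j. j \<in> J \<Longrightarrow> n - j \<in> J"
    using exists_symmetric_offsets[OF assms] by metis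
  \<comment> \<open>Addition modulo \<open>n\<close>, with one subtraction since both arguments are
    below \<open>n\<close>.\<close>
  define rot where "rot v j = (if v + j < n then v + j else v + j - n)" for v j
  define E where "E = {{v, rot v j} | v j. v < n \<and> j \<in> J}"
  have rot: "rot v j < n" "rot v j \<noteq> v" "rot (rot v j) (n - j) = v" if "v < n" "j \<in> J" for v j
  proof -
    have "1 \<le> j" "j < n" using J(1) that(2) by auto
    then show "rot v j < n" "rot v j \<noteq> v" "rot (rot v j) (n - j) = v" using that by (auto simp: rot_def)
  qed
  have sub: "E \<subseteq> {e. e \<subseteq> {..<n} \<and> card e = 2}"
  proof
    fix e assume "e \<in> E"
    then obtain v j where e: "e = {v, rot v j}" "v < n" "j \<in> J" by (auto simp: E_def)
    then show "e \<in> {e. e \<subseteq> {..<n} \<and> card e = 2}" using rot[OF e(2,3)] by simp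
  qed
  have nbr: "nbr E v = rot v ` J" if v: "v < n" for v
  proof (intro equalityI subsetI)
    fix y assume "y \<in> nbr E v"
    then obtain u j where uj: "{v, y} = {u, rot u j}" "u < n" "j \<in> J" by (auto simp: nbr_def E_def)
    from uj(1) have "(v = u \<and> y = rot u j) \<or> (v = rot u j \<and> y = u)" by (simp add: doubleton_eq_iff)
    then show "y \<in> rot v ` J"
    proof
      assume "v = u \<and> y = rot u j"
      then show ?thesis using uj(3) by simp
    next
      assume "v = rot u j \<and> y = u"
      then have "y = rot v (n - j)" using rot(3)[OF uj(2,3)] by simp
      then show ?thesis using J(3)[OF uj(3)] by simp
    qed
  next
    fix y assume "y \<in> rot v ` J"
    then show "y \<in> nbr E v" using v by (auto simp: nbr_def E_def)
  qed
  have inj: "inj_on (rot v) J" if v: "v < n" for v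
  proof (rule inj_onI)
    fix i j assume ij: "i \<in> J" "j \<in> J" "rot v i = rot v j"
    then have "i < n" "j < n" using J(1) by auto
    then show "i = j" using ij(3) v by (auto simp: rot_def split: if_splits)
  qed
  have "card {e \<in> E. v \<in> e} = d" if v: "v < n" for v
  proof -
    have "card {e \<in> E. v \<in> e} = card (nbr E v)" using sub by (intro card_nbr_eq[symmetric]) blast
    also have "\<dots> = d" using nbr[OF v] card_image[OF inj[OF v]] J(2) by simp
    finally show ?thesis .
  qed
  then have "E \<in> regular_graphs n d" using sub by (simp add: regular_graphs_def)
  then show ?thesis by blast
qed

section \<open>Averaging over the graph\<close>

lemma prob_bind_pmf:
  "measure_pmf.prob (bind_pmf M f) B = (\<integral>x. measure_pmf.prob (f x) B \<partial>measure_pmf M)"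
proof -
  have int: "integrable (measure_pmf M) (\<lambda>x. measure_pmf.prob (f x) B)"
    by (rule measure_pmf.integrable_const_bound[where B = 1]) auto
  have "ennreal (measure_pmf.prob (bind_pmf M f) B) = (\<integral>\<^sup>+x. ennreal (measure_pmf.prob (f x) B) \<partial>measure_pmf M)"
    by (simp flip: measure_pmf.emeasure_eq_measure)
  also have "\<dots> = ennreal (\<integral>x. measure_pmf.prob (f x) B \<partial>measure_pmf M)"
    by (rule nn_integral_eq_integral[OF int]) simp
  finally show ?thesis by (simp add: integral_nonneg_AE)
qed

text \<open>Conditioning on the graph: graphs in \<open>X\<close> are charged probability 1, all
  others at most \<open>t\<close>.\<close>

lemma signed_graph_prob_le:
  assumes ne: "regular_graphs n d \<noteq> {}"
    and Gb: "\<And>E. E \<in> regular_graphs n d \<Longrightarrow> E \<notin> X \<Longrightarrow>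
      measure_pmf.prob (Pi_pmf E 1 (\<lambda>_. pmf_of_set {-1, 1})) {w. (E, w) \<in> B} \<le> t"
    and Xb: "real (card (regular_graphs n d \<inter> X)) \<le> b * real (card (regular_graphs n d))" and t: "0 \<le> t"
  shows "measure_pmf.prob (random_signed_regular_graph n d) B \<le> t + b"
proof -
  let ?R = "regular_graphs n d"
  let ?p = "\<lambda>E. measure_pmf.prob (Pi_pmf E 1 (\<lambda>_. pmf_of_set {-1, 1 :: int})) {w. (E, w) \<in> B}"
  have fin: "finite ?R" by (rule finite_regular_graphs)
  have c0: "0 < real (card ?R)" using ne fin by (simp add: card_gt_0_iff)
  have eq: "random_signed_regular_graph n d
      = bind_pmf (pmf_of_set ?R) (\<lambda>E. map_pmf (Pair E) (Pi_pmf E 1 (\<lambda>_. pmf_of_set {-1, 1})))"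
    by (simp add: random_signed_regular_graph_def map_pmf_def)
  have "measure_pmf.prob (random_signed_regular_graph n d) B
      = (\<integral>E. measure_pmf.prob (map_pmf (Pair E) (Pi_pmf E 1 (\<lambda>_. pmf_of_set {-1, 1}))) B \<partial>measure_pmf (pmf_of_set ?R))"
    unfolding eq by (rule prob_bind_pmf)
  also have "\<dots> = (\<integral>E. ?p E \<partial>measure_pmf (pmf_of_set ?R))"
    by (simp add: vimage_def)
  also have "\<dots> = (\<Sum>E\<in>?R. ?p E) / card ?R" by (rule integral_pmf_of_set[OF ne fin])
  also have "(\<Sum>E\<in>?R. ?p E) \<le> (\<Sum>E\<in>?R. t + indicator X E)"
  proof (rule sum_mono)
    fix E assume E: "E \<in> ?R"
    show "?p E \<le> t + indicator X E"
    proof (cases "E \<in> X")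
      case True
      then have "indicator X E = (1 :: real)" by simp
      moreover have "?p E \<le> 1" by (rule measure_pmf.prob_le_1)
      ultimately show ?thesis using t by linarith
    qed (use Gb[OF E] in simp)
  qed
  also have "(\<Sum>E\<in>?R. t + indicator X E) = t * card ?R + real (card (?R \<inter> X))"
  proof -
    have "(\<Sum>E\<in>?R. indicator X E :: real) = real (card (?R \<inter> X))"
      using sum_mult_indicator[OF fin, of "\<lambda>_. 1 :: real" "\<lambda>_. X" id]
      by (simp add: Int_def)
    then show ?thesis by (simp add: sum.distrib)
  qed
  also have "\<dots> \<le> (t + b) * card ?R" using Xb by (simp add: algebra_simps)
  finally show ?thesis using c0 by (simp add: divide_right_mono)
qed

section \<open>The tail bound and its limit\<close>

text \<open>The first summand bounds the probability that the random signs fail on a sparse graph, the other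
  two the probability that the graph is not sparse at scale \<open>k\<close> or at scale \<open>r\<close>.\<close>

definition tail_bound :: "nat \<Rightarrow> real \<Rightarrow> nat \<Rightarrow> nat \<Rightarrow> nat \<Rightarrow> nat \<Rightarrow> real" where
  "tail_bound d s x k r n =
     real (Suc (2 * k)) ^ (2 * x) * n * real (chunk_bound k r (d - 1)) ^ (2 * k div r + 2 + 2 * x) / s ^ (2 * k)
     + (real (Suc (2 * k)) * n * real d ^ (2 * k) * ((real (Suc (2 * k)))\<^sup>2) ^ x * (2 * real d / real n) ^ x
     + real (Suc (10 * r)) * n * real d ^ (10 * r) * ((real (Suc (10 * r)))\<^sup>2) ^ 2 * (2 * real d / real n) ^ 2)"

text \<open>The two inequalities are the size conditions of the first moment bound, with
  \<open>x\<close> surplus edges at scale \<open>2 * k\<close> and two at scale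
  \<open>10 * r\<close>.\<close>

definition admissible :: "nat \<Rightarrow> nat \<Rightarrow> nat \<Rightarrow> nat \<Rightarrow> nat \<Rightarrow> bool" where
  "admissible d x k r n \<longleftrightarrow> 0 < k \<and> 0 < r \<and>
     2 * (2 * (2 * k + x) + 2 * d + 2 * d\<^sup>2) \<le> n * d \<and> 2 * (2 * (10 * r + 2) + 2 * d + 2 * d\<^sup>2) \<le> n * d"

lemma spectral_tail_bound:
  fixes d n k r x :: nat and s c :: real
  assumes ne: "regular_graphs n d \<noteq> {}" and d: "3 \<le> d" and n: "0 < n"
    and s: "1 < s" "s\<^sup>2 \<le> real d - 1" and c: "sqrt (real d - 1) * (s + 1 / s) \<le> c"
    and x: "0 < x" and adm: "admissible d x k r n"
  shows "measure_pmf.prob (random_signed_regular_graph n d)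
      {(E, w). \<not> spectral_radius (signed_adjacency_matrix n E w) \<le> c} \<le> tail_bound d s x k r n"
  unfolding tail_bound_def
proof (rule signed_graph_prob_le[OF ne])
  let ?T = "real (Suc (2 * k)) ^ (2 * x) * real n * real (chunk_bound k r (d - 1)) ^ (2 * k div r + 2 + 2 * x) / s ^ (2 * k)"
  let ?B1 = "real (Suc (2 * k)) * real n * real d ^ (2 * k) * ((real (Suc (2 * k)))\<^sup>2) ^ x * (2 * real d / real n) ^ x"
  let ?B2 = "real (Suc (10 * r)) * real n * real d ^ (10 * r) * ((real (Suc (10 * r)))\<^sup>2) ^ 2 * (2 * real d / real n) ^ 2"
  let ?R = "regular_graphs n d"
  let ?X1 = "{E \<in> ?R. surplus E (2 * k) x}" and ?X2 = "{E \<in> ?R. surplus E (10 * r) 2}"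
  have pos: "0 < k" "0 < r" and big1: "2 * (2 * (2 * k + x) + 2 * d + 2 * d\<^sup>2) \<le> n * d"
    and big2: "2 * (2 * (10 * r + 2) + 2 * d + 2 * d\<^sup>2) \<le> n * d"
    using adm by (auto simp: admissible_def)
  define q where "q = d - 1"
  have q: "d = Suc q" "real d - 1 = real q" "0 < q" using d by (auto simp: q_def)
  show "real (card (?R \<inter> {E. surplus E (2 * k) x \<or> surplus E (10 * r) 2})) \<le> (?B1 + ?B2) * real (card ?R)"
  proof -
    have "?R \<inter> {E. surplus E (2 * k) x \<or> surplus E (10 * r) 2} = ?X1 \<union> ?X2" by blast
    then have "card (?R \<inter> {E. surplus E (2 * k) x \<or> surplus E (10 * r) 2}) \<le> card ?X1 + card ?X2"
      by (simp only: card_Un_le)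
    then have le: "real (card (?R \<inter> {E. surplus E (2 * k) x \<or> surplus E (10 * r) 2})) \<le> real (card ?X1 + card ?X2)"
      by (rule of_nat_mono)
    have "real (card ?X1) \<le> ?B1 * real (card ?R)"
      by (rule card_surplus_graphs[OF big1]) (use d n x in auto)
    moreover have "real (card ?X2) \<le> ?B2 * real (card ?R)"
      by (rule card_surplus_graphs[OF big2]) (use d n in auto)
    ultimately show ?thesis using le unfolding of_nat_add distrib_right by linarith
  qed
  show "0 \<le> ?T" using s by simp
  fix E assume E: "E \<in> ?R" "E \<notin> {E. surplus E (2 * k) x \<or> surplus E (10 * r) 2}"
  interpret hike_count E n k r q
    by unfold_locales (use regular_nbr[OF E(1)] E(2) pos q in auto)
  have ns: "\<not> surplus E (2 * k) x" using E(2) by simp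
  note H = card_hikes[OF ns]
  have "measure_pmf.prob (Pi_pmf E 1 (\<lambda>_. pmf_of_set {-1, 1})) {w. \<not> spectral_radius (signed_adjacency_matrix n E w) \<le> c}
      \<le> real (card (hikes E n k)) / (s\<^sup>2 * (real d - 1)) ^ k"
    by (rule random_signing_tail[OF E(1) n _ s c]) (use H d in auto)
  also have "\<dots> \<le> real (Suc (2 * k) ^ (2 * x) * (n * q ^ k * chunk_bound k r q ^ (2 * k div r + 2 + 2 * x))) / (s\<^sup>2 * (real d - 1)) ^ k"
    using H s q by (intro divide_right_mono of_nat_mono) auto
  \<comment> \<open>The factor \<open>q ^ k\<close> from the new edges of hikes cancels against the
    eigenvalue bound, leaving only \<open>s ^ (2 * k)\<close> in the denominator.\<close>
  also have "\<dots> = ?T"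
  proof -
    have e: "(s\<^sup>2 * (real d - 1)) ^ k = s ^ (2 * k) * real q ^ k"
      unfolding q(2) by (simp add: power_mult_distrib power_mult)
    show ?thesis unfolding e q_def[symmetric] using q(3) s by (simp add: field_simps)
  qed
  finally show "measure_pmf.prob (Pi_pmf E 1 (\<lambda>_. pmf_of_set {-1, 1}))
      {w. (E, w) \<in> {(E, w). \<not> spectral_radius (signed_adjacency_matrix n E w) \<le> c}} \<le> ?T" by simp
qed

lemma exists_growth_rate:
  fixes q \<epsilon> :: real
  assumes "2 \<le> q" "0 < \<epsilon>"
  obtains s where "1 < s" "s\<^sup>2 \<le> q" "sqrt q * (s + 1 / s) \<le> 2 * sqrt q + \<epsilon>"
proof -
  \<comment> \<open>With \<open>s = 1 + t\<close>, the excess of \<open>s + 1 / s\<close> over 2 is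
    \<open>t\<^sup>2 / (1 + t) \<le> t\<close>. The cap \<open>2 / 5\<close> ensures
    \<open>s\<^sup>2 \<le> 49 / 25 < 2 \<le> q\<close>.\<close>
  define t where "t = min (2 / 5) (\<epsilon> / sqrt q)"
  have sq: "0 < sqrt q" using assms by simp
  have "0 < \<epsilon> / sqrt q" using assms sq by simp
  then have t: "0 < t" "t \<le> 2 / 5" "t \<le> \<epsilon> / sqrt q" unfolding t_def by linarith+
  have "(1 + t)\<^sup>2 \<le> (7 / 5)\<^sup>2" using t by (intro power_mono) auto
  also have "\<dots> \<le> q" using assms by (simp add: power2_eq_square)
  finally have 1: "(1 + t)\<^sup>2 \<le> q" .
  have "(1 + t) + 1 / (1 + t) = 2 + t\<^sup>2 / (1 + t)" using t by (simp add: field_simps power2_eq_square)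
  also have "t\<^sup>2 / (1 + t) \<le> t"
  proof -
    have "t * t \<le> t * (1 + t)" using t by (intro mult_left_mono) auto
    then show ?thesis using t by (simp add: field_simps power2_eq_square)
  qed
  also have "t \<le> \<epsilon> / sqrt q" by (rule t)
  finally have "sqrt q * ((1 + t) + 1 / (1 + t)) \<le> sqrt q * (2 + \<epsilon> / sqrt q)" using sq by simp
  also have "\<dots> = 2 * sqrt q + \<epsilon>" using sq by (simp add: field_simps)
  finally show ?thesis using that[of "1 + t"] t 1 by simp
qed

lemma tail_bound_tendsto_0:
  fixes d :: nat and s :: real
  assumes d: "3 \<le> d" and s: "1 < s"
  obtains k r :: "nat \<Rightarrow> nat" and x :: nat and g :: "nat \<Rightarrow> real"
  where "0 < x" "g \<longlonglongrightarrow> 0"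
    "eventually (\<lambda>n. admissible d x (k n) (r n) n \<and> tail_bound d s x (k n) (r n) n \<le> g n) sequentially"
proof -
  \<comment> \<open>Chosen so that \<open>s ^ k n \<ge> n\<close>.\<close>
  define \<alpha> where "\<alpha> = 1 / ln s"
  \<comment> \<open>Chosen so that \<open>d ^ (10 * r n) \<le> sqrt n\<close>.\<close>
  define \<beta> where "\<beta> = 1 / (20 * ln (real d))"
  have ls: "0 < ln s" and ld: "0 < ln (real d)" using s d by auto
  have ab: "0 < \<alpha>" "0 < \<beta>" using ls ld by (auto simp: \<alpha>_def \<beta>_def)
  define k where "k n = nat \<lceil>\<alpha> * ln (real n)\<rceil>" for n
  define r where "r n = nat \<lfloor>\<beta> * ln (real n)\<rfloor>" for n
  \<comment> \<open>\<open>d ^ (2 * k n)\<close> is at most \<open>n ^ (x - 3)\<close> up to a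
    constant. Of the three spare factors \<open>2 * d / n\<close>, one cancels the starting points
    and two remain.\<close>
  define x where "x = nat \<lceil>2 * \<alpha> * ln (real d)\<rceil> + 3"
  \<comment> \<open>Bounds the number of chunks: eventually \<open>2 * k n\<close> is at most
    \<open>4 * \<alpha> * ln n\<close> and \<open>r n\<close> at least
    \<open>\<beta> * ln n / 2\<close>.\<close>
  define C where "C = nat \<lceil>8 * \<alpha> / \<beta>\<rceil>"
  \<comment> \<open>The exponents in \<open>p1\<close>, \<open>p2\<close> and the 10 in
    \<open>g\<close> result from estimating the lengths by \<open>(ln n)\<^sup>2\<close> and
    \<open>chunk_bound\<close> by \<open>(ln n) ^ 4\<close>.\<close>
  define p1 where "p1 = 2 * (2 * x) + 4 * (C + 2 + 2 * x)"
  define p2 where "p2 = 2 + 4 * x"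
  define c2 where "c2 = (real d)\<^sup>2 * (2 * real d) ^ x"
  \<comment> \<open>The scale \<open>r\<close> contributes a term of order \<open>1 / sqrt n\<close>
    up to logarithms; the other two are smaller and are weakened to the same denominator.\<close>
  define g where "g n = ln (real n) ^ p1 / sqrt (real n) + (c2 * (ln (real n) ^ p2 / sqrt (real n))
      + 4 * (real d)\<^sup>2 * (ln (real n) ^ 10 / sqrt (real n)))" for n :: nat
  have lim: "(\<lambda>n::nat. ln (real n) ^ p / sqrt (real n)) \<longlonglongrightarrow> 0" for p by real_asymp
  have "g \<longlonglongrightarrow> 0 + (c2 * 0 + 4 * (real d)\<^sup>2 * 0)"
    unfolding g_def by (intro tendsto_add tendsto_mult tendsto_const lim)
  then have g0: "g \<longlonglongrightarrow> 0" by simp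
  have ev: "eventually (\<lambda>n::nat. 2 * (\<alpha> * ln (real n) + 1) + 1 \<le> ln (real n) ^ 2) sequentially"
    "eventually (\<lambda>n::nat. 10 * (\<beta> * ln (real n)) + 1 \<le> ln (real n) ^ 2) sequentially"
    "eventually (\<lambda>n::nat. (ln (real n))\<^sup>2 * (\<beta> * ln (real n) + 1) + real d \<le> ln (real n) ^ 4) sequentially"
    "eventually (\<lambda>n::nat. 2 \<le> \<beta> * ln (real n)) sequentially"
    "eventually (\<lambda>n::nat. 1 \<le> \<alpha> * ln (real n)) sequentially"
    "eventually (\<lambda>n::nat. 4 * (ln (real n))\<^sup>2 + (4 * real x + 8 + 4 * real d + 4 * (real d)\<^sup>2) \<le> real n) sequentially"
    "eventually (\<lambda>n::nat. 1 \<le> ln (real n)) sequentially"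
    "eventually (\<lambda>n::nat. 1 \<le> real n) sequentially"
    using ab by real_asymp+
  have "eventually (\<lambda>n. admissible d x (k n) (r n) n \<and> tail_bound d s x (k n) (r n) n \<le> g n) sequentially"
    using ev
  proof eventually_elim
    case (elim n)
    define L where "L = ln (real n)"
    have n: "1 \<le> real n" "0 < real n" using elim(8) by auto
    have eL: "exp L = real n" using n by (simp add: L_def)
    have L1: "1 \<le> L" using elim(7) by (simp add: L_def)
    have kle: "real (k n) \<le> \<alpha> * L + 1" and kge: "\<alpha> * L \<le> real (k n)"
      using ab L1 unfolding k_def L_def[symmetric] by (simp_all add: of_nat_ceiling)
    have rle: "real (r n) \<le> \<beta> * L" and rge: "\<beta> * L - 1 \<le> real (r n)"
      using ab L1 unfolding r_def L_def[symmetric] by simp_all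
    have K: "real (Suc (2 * k n)) \<le> L\<^sup>2" using kle elim(1) unfolding L_def[symmetric] by simp
    have R: "real (Suc (10 * r n)) \<le> L\<^sup>2" using rle elim(2) unfolding L_def[symmetric] by simp
    have k0: "0 < k n" using kge elim(5) unfolding L_def[symmetric] by linarith
    have r0: "0 < r n" using rge elim(4) unfolding L_def[symmetric] by linarith
    have M: "real (chunk_bound (k n) (r n) (d - 1)) \<le> L ^ 4"
    proof -
      have "real (chunk_bound (k n) (r n) (d - 1)) = real (Suc (2 * k n)) * (real (r n) + 1) + real d"
        using d by (simp add: chunk_bound_def algebra_simps)
      also have "\<dots> \<le> L\<^sup>2 * (\<beta> * L + 1) + real d"
        using K rle by (intro add_right_mono mult_mono) auto
      also have "\<dots> \<le> L ^ 4" using elim(3) by (simp add: L_def)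
      finally show ?thesis .
    qed
    have M1: "1 \<le> real (chunk_bound (k n) (r n) (d - 1))" by (simp add: chunk_bound_def)
    have divC: "2 * k n div r n \<le> C"
    proof -
      have "real (2 * k n div r n) \<le> real (2 * k n) / real (r n)" by (rule of_nat_div_le_of_nat)
      also have "\<dots> \<le> (4 * (\<alpha> * L)) / (\<beta> * L / 2)"
      proof (rule frac_le)
        show "real (2 * k n) \<le> 4 * (\<alpha> * L)" using kle elim(5) by (simp add: L_def)
        show "\<beta> * L / 2 \<le> real (r n)" using rge elim(4) by (simp add: L_def)
      qed (use ab L1 in auto)
      also have "\<dots> = 8 * \<alpha> / \<beta>" using L1 ab by (simp add: field_simps)
      also have "\<dots> \<le> real C" unfolding C_def by (rule real_nat_ceiling_ge)
      finally show ?thesis by simp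
    qed
    have sqn: "1 \<le> sqrt (real n)" using n by simp
    have sqle: "sqrt (real n) \<le> real n" using mult_left_mono[OF sqn, of "sqrt (real n)"] n by simp
    have T: "real (Suc (2 * k n)) ^ (2 * x) * n * real (chunk_bound (k n) (r n) (d - 1)) ^ (2 * k n div r n + 2 + 2 * x) / s ^ (2 * k n)
        \<le> L ^ p1 / sqrt (real n)"
    proof -
      have sk: "real n \<le> s ^ k n"
      proof -
        have "real n = exp L" by (simp add: eL)
        also have "\<dots> \<le> exp (real (k n) * ln s)"
          using kge ls by (simp add: \<alpha>_def field_simps)
        also have "\<dots> = s ^ k n" using s by (simp add: exp_of_nat_mult)
        finally show ?thesis .
      qed
      have "real n * real n \<le> s ^ k n * s ^ k n" using sk n by (intro mult_mono) auto
      also have "\<dots> = s ^ (2 * k n)" by (simp add: mult_2 power_add)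
      finally have s2: "real n * real n \<le> s ^ (2 * k n)" .
      have "real (chunk_bound (k n) (r n) (d - 1)) ^ (2 * k n div r n + 2 + 2 * x)
          \<le> real (chunk_bound (k n) (r n) (d - 1)) ^ (C + 2 + 2 * x)"
        using M1 divC by (intro power_increasing) auto
      also have "\<dots> \<le> (L ^ 4) ^ (C + 2 + 2 * x)" using M by (intro power_mono) auto
      finally have m: "real (chunk_bound (k n) (r n) (d - 1)) ^ (2 * k n div r n + 2 + 2 * x) \<le> (L ^ 4) ^ (C + 2 + 2 * x)" .
      have a: "real (Suc (2 * k n)) ^ (2 * x) \<le> (L\<^sup>2) ^ (2 * x)" using K by (intro power_mono) auto
      have "real (Suc (2 * k n)) ^ (2 * x) * n * real (chunk_bound (k n) (r n) (d - 1)) ^ (2 * k n div r n + 2 + 2 * x)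
          \<le> (L\<^sup>2) ^ (2 * x) * n * (L ^ 4) ^ (C + 2 + 2 * x)"
        using a m by (intro mult_mono) auto
      also have "\<dots> = L ^ p1 * n" unfolding p1_def power_add power_mult by simp
      finally have "real (Suc (2 * k n)) ^ (2 * x) * n * real (chunk_bound (k n) (r n) (d - 1)) ^ (2 * k n div r n + 2 + 2 * x) / s ^ (2 * k n)
          \<le> (L ^ p1 * n) / (real n * real n)" using s2 n L1 by (intro frac_le) auto
      also have "\<dots> = L ^ p1 / real n" using n by simp
      also have "\<dots> \<le> L ^ p1 / sqrt (real n)"
        using L1 n sqle by (intro divide_left_mono) auto
      finally show ?thesis .
    qed
    have B1: "real (Suc (2 * k n)) * n * real d ^ (2 * k n) * ((real (Suc (2 * k n)))\<^sup>2) ^ x * (2 * real d / real n) ^ x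
        \<le> c2 * (L ^ p2 / sqrt (real n))"
    proof -
      have x3: "3 \<le> x" by (simp add: x_def)
      have "2 * \<alpha> * ln (real d) \<le> real (x - 3)" by (simp add: x_def real_nat_ceiling_ge)
      have "real d ^ (2 * k n) = exp (real (2 * k n) * ln (real d))"
        by (subst exp_of_nat_mult) (use d in simp)
      also have "\<dots> \<le> exp (2 * (\<alpha> * L + 1) * ln (real d))" using kle ld by (simp add: mult_right_mono)
      also have "\<dots> = exp (2 * \<alpha> * ln (real d) * L) * exp (2 * ln (real d))" by (simp add: exp_add[symmetric] algebra_simps)
      also have "\<dots> \<le> exp (real (x - 3) * L) * exp (2 * ln (real d))"
        using L1 \<open>2 * \<alpha> * ln (real d) \<le> real (x - 3)\<close> by (intro mult_right_mono) (auto intro!: mult_right_mono)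
      also have "\<dots> = real n ^ (x - 3) * (real d)\<^sup>2"
        using d eL exp_of_nat_mult[of "x - 3" L] exp_of_nat_mult[of 2 "ln (real d)"] by simp
      finally have dk: "real d ^ (2 * k n) \<le> real n ^ (x - 3) * (real d)\<^sup>2" .
      have a: "((real (Suc (2 * k n)))\<^sup>2) ^ x \<le> ((L\<^sup>2)\<^sup>2) ^ x" using K by (intro power_mono) auto
      have "real (Suc (2 * k n)) * n * real d ^ (2 * k n) * ((real (Suc (2 * k n)))\<^sup>2) ^ x * (2 * real d / real n) ^ x
          \<le> L\<^sup>2 * n * (real n ^ (x - 3) * (real d)\<^sup>2) * ((L\<^sup>2)\<^sup>2) ^ x * (2 * real d / real n) ^ x"
        using K dk a L1 by (intro mult_mono) auto
      also have "\<dots> = c2 * L ^ p2 * (real n * real n ^ (x - 3) / real n ^ x)"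
      proof -
        have "((L\<^sup>2)\<^sup>2) ^ x = L ^ (4 * x)" by (simp flip: power_mult)
        then show ?thesis by (simp add: c2_def p2_def power_add power_divide power2_eq_square)
      qed
      also have "real n * real n ^ (x - 3) / real n ^ x = 1 / (real n)\<^sup>2"
      proof -
        obtain y where y: "x = y + 3" using x3 le_Suc_ex by (metis add.commute)
        show ?thesis unfolding y using n by (simp add: power_add field_simps power2_eq_square power3_eq_cube)
      qed
      also have "\<dots> \<le> 1 / sqrt (real n)"
      proof -
        have "sqrt (real n) \<le> real n" by (rule sqle)
        also have "\<dots> \<le> (real n)\<^sup>2" using n by (simp add: power2_eq_square)
        finally show ?thesis using n by (simp add: frac_le)
      qed
      finally show ?thesis using L1 by (simp add: c2_def mult_left_mono)
    qed
    have B2: "real (Suc (10 * r n)) * n * real d ^ (10 * r n) * ((real (Suc (10 * r n)))\<^sup>2) ^ 2 * (2 * real d / real n) ^ 2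
        \<le> 4 * (real d)\<^sup>2 * (L ^ 10 / sqrt (real n))"
    proof -
      have "real d ^ (10 * r n) = exp (real (10 * r n) * ln (real d))"
        by (subst exp_of_nat_mult) (use d in simp)
      also have "\<dots> \<le> exp (L / 2)"
      proof -
        have "real (10 * r n) * ln (real d) \<le> 10 * (\<beta> * L) * ln (real d)" using rle ld by (intro mult_right_mono) auto
        also have "\<dots> = L / 2" using ld by (simp add: \<beta>_def)
        finally show ?thesis by simp
      qed
      also have "exp (L / 2) = sqrt (real n)"
      proof -
        have "exp (L / 2) * exp (L / 2) = real n" using eL by (simp add: exp_add[symmetric])
        then show ?thesis by (metis abs_of_pos exp_gt_zero real_sqrt_abs2)
      qed
      finally have dr: "real d ^ (10 * r n) \<le> sqrt (real n)" .
      have a: "((real (Suc (10 * r n)))\<^sup>2) ^ 2 \<le> ((L\<^sup>2)\<^sup>2) ^ 2" using R by (intro power_mono) auto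
      have "real (Suc (10 * r n)) * n * real d ^ (10 * r n) * ((real (Suc (10 * r n)))\<^sup>2) ^ 2 * (2 * real d / real n) ^ 2
          \<le> L\<^sup>2 * n * sqrt (real n) * ((L\<^sup>2)\<^sup>2) ^ 2 * (2 * real d / real n) ^ 2"
        using R dr a L1 by (intro mult_mono) auto
      also have "\<dots> = 4 * (real d)\<^sup>2 * L ^ 10 * (sqrt (real n) / real n)"
        using n by (simp add: power2_eq_square field_simps eval_nat_numeral)
      also have "sqrt (real n) / real n = 1 / sqrt (real n)" using n by (simp add: field_simps)
      finally show ?thesis by simp
    qed
    have dd: "real n \<le> real (n * d)" using d by (simp add: mult_le_cancel_left1)
    have big1: "2 * (2 * (2 * k n + x) + 2 * d + 2 * d\<^sup>2) \<le> n * d"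
    proof -
      have "real (2 * (2 * (2 * k n + x) + 2 * d + 2 * d\<^sup>2)) \<le> real (n * d)"
        using K elim(6) dd unfolding L_def[symmetric] by simp
      then show ?thesis by (simp only: of_nat_le_iff)
    qed
    have big2: "2 * (2 * (10 * r n + 2) + 2 * d + 2 * d\<^sup>2) \<le> n * d"
    proof -
      have "real (2 * (2 * (10 * r n + 2) + 2 * d + 2 * d\<^sup>2)) \<le> real (n * d)"
        using R elim(6) dd unfolding L_def[symmetric] by simp
      then show ?thesis by (simp only: of_nat_le_iff)
    qed
    have "tail_bound d s x (k n) (r n) n \<le> g n"
      unfolding tail_bound_def g_def L_def[symmetric] by (rule add_mono[OF T add_mono[OF B1 B2]])
    with k0 r0 big1 big2 show ?case by (simp add: admissible_def)
  qed
  then show ?thesis using that[of x g k r] g0 by (simp add: x_def)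
qed

theorem theorem1p15:
  fixes d :: nat and \<epsilon> :: real
  assumes "d \<ge> 3" and "\<epsilon> > 0"
  shows "\<exists>\<delta> :: nat \<Rightarrow> real. \<delta> \<in> o(\<lambda>_. 1) \<and>
    (\<forall>n. d < n \<and> even (n * d) \<longrightarrow>
      measure_pmf.prob (random_signed_regular_graph n d)
        {(E, w). spectral_radius (signed_adjacency_matrix n E w) \<le> 2 * sqrt (real d - 1) + \<epsilon>}
      \<ge> 1 - \<delta> n)"
proof -
  let ?c = "2 * sqrt (real d - 1) + \<epsilon>"
  let ?good = "\<lambda>n. {(E, w). spectral_radius (signed_adjacency_matrix n E w) \<le> ?c}"
  let ?bad = "\<lambda>n. {(E, w). \<not> spectral_radius (signed_adjacency_matrix n E w) \<le> ?c}"
  have "2 \<le> real d - 1" using assms by simp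
  then obtain s where s: "1 < s" "s\<^sup>2 \<le> real d - 1" "sqrt (real d - 1) * (s + 1 / s) \<le> ?c"
    using exists_growth_rate assms(2) by blast
  obtain k r :: "nat \<Rightarrow> nat" and x g where x: "0 < x" and g: "g \<longlonglongrightarrow> 0" and
    ev: "eventually (\<lambda>n. admissible d x (k n) (r n) n \<and> tail_bound d s x (k n) (r n) n \<le> g n) sequentially"
    by (rule tail_bound_tendsto_0[OF assms(1) s(1)])
  from ev obtain N where N: "\<And>n. N \<le> n \<Longrightarrow> admissible d x (k n) (r n) n \<and> tail_bound d s x (k n) (r n) n \<le> g n"
    unfolding eventually_sequentially by blast
  \<comment> \<open>Below \<open>N\<close> the value 1 makes the claimed lower bound 0.\<close>
  define \<delta> where "\<delta> n = (if N \<le> n then g n else 1)" for n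
  have "eventually (\<lambda>n. g n = \<delta> n) sequentially"
    unfolding eventually_sequentially by (intro exI[of _ N]) (simp add: \<delta>_def)
  then have "\<delta> \<longlonglongrightarrow> 0" using g tendsto_cong by fastforce
  then have "\<delta> \<in> o(\<lambda>_. 1)" by (intro smalloI_tendsto) auto
  moreover have "1 - \<delta> n \<le> measure_pmf.prob (random_signed_regular_graph n d) (?good n)"
    if n: "d < n" "even (n * d)" for n
  proof (cases "N \<le> n")
    case True
    have "measure_pmf.prob (random_signed_regular_graph n d) (?bad n) \<le> tail_bound d s x (k n) (r n) n"
      by (rule spectral_tail_bound[OF regular_graphs_nonempty[OF n] assms(1) _ s x]) (use N[OF True] n in auto)
    also have "\<dots> \<le> g n" using N[OF True] by simp
    finally have "measure_pmf.prob (random_signed_regular_graph n d) (?bad n) \<le> g n" .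
    moreover have "?good n = - ?bad n" by auto
    moreover have "measure_pmf.prob (random_signed_regular_graph n d) (- ?bad n)
        = 1 - measure_pmf.prob (random_signed_regular_graph n d) (?bad n)"
      using measure_pmf.prob_compl[of "?bad n" "random_signed_regular_graph n d"] by (simp add: Compl_eq_Diff_UNIV)
    ultimately show ?thesis using True by (simp add: \<delta>_def)
  next
    case False
    then show ?thesis by (simp add: \<delta>_def)
  qed
  ultimately show ?thesis by blast
qed

end
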